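(* The covering exponent of the sequence of sets $S_q\subset\mathbb{T}^2$ ($q=1,2,3,\dots$) is at most $2$, that is, \[-\liminf_{q\to\infty}\frac{\log \varphi(q)}{\log \mathrm{vol}\big(B_{\mathcal{R}(S_q)}\big)}\le 2.\]
   Context: $\mathbb{T}^2=(\mathbb{R}/\mathbb{Z})^2$ carries the flat metric induced from $\mathbb{R}^2$ and Lebesgue probability measure $\mathrm{vol}$; $\mathrm{vol}(B_R)=\pi R^2$ denotes the volume of a geodesic ball of radius $R<\frac12$. For a positive integer $q$, $\varphi(q)=\#(\mathbb{Z}/q\mathbb{Z})^\times$, $\overline{d}$ denotes the inverse of $d\in(\mathbb{Z}/q\mathbb{Z})^\times$ modulo $q$, and $S_q=\{(d/q,\overline{d}/q)\in\mathbb{T}^2:d\in(\mathbb{Z}/q\mathbb{Z})^\times\}$, a set of $\varphi(q)$ points. The covering radius $\mathcal{R}(P)$ of a finite set $P\subset\mathbb{T}^2$ is the least $R>0$ such that every point of $\mathbb{T}^2$ lies within distance $R$ of some point of $P$. The covering exponent of a sequence of finite sets $P_n$ with $\#P_n=N_n$ points is $-\liminf_{n\to\infty}\frac{\log N_n}{\log\mathrm{vol}(B_{\mathcal{R}(P_n)})}$. *)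

theory Defs
  imports "HOL-Analysis.Analysis" "HOL-Number_Theory.Number_Theory"
begin

section \<open>The flat torus\<close>

quotient_type circle = real / "\<lambda>x y :: real. x - y \<in> \<int>"
  morphisms rep_circle to_circle
proof (rule equivpI)
  show "reflp (\<lambda>x y :: real. x - y \<in> \<int>)"
    by (auto intro: reflpI)
  show "symp (\<lambda>x y :: real. x - y \<in> \<int>)"
  proof (rule sympI)
    fix x y :: real
    assume "x - y \<in> \<int>"
    then have "- (x - y) \<in> \<int>" by (rule Ints_minus)
    then show "y - x \<in> \<int>" by simp
  qed
  show "transp (\<lambda>x y :: real. x - y \<in> \<int>)"
  proof (rule transpI)
    fix x y z :: real
    assume "x - y \<in> \<int>" "y - z \<in> \<int>"
    then have "(x - y) + (y - z) \<in> \<int>" by (rule Ints_add)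
    then show "x - z \<in> \<int>" by simp
  qed
qed

lemma infdist_greatest:
  assumes "A \<noteq> {}" "\<And>a. a \<in> A \<Longrightarrow> d \<le> dist x a"
  shows "d \<le> infdist x A"
  unfolding infdist_notempty[OF assms(1)] using assms by (rule cINF_greatest)

lemma infdist_Ints_add:
  fixes x k :: real
  assumes "k \<in> \<int>"
  shows "infdist (x + k) \<int> = infdist x \<int>"
proof -
  have le: "infdist (y + l) \<int> \<le> infdist y \<int>" if "l \<in> \<int>" for y l :: real
  proof -
    obtain m :: real where m: "m \<in> \<int>" "infdist y \<int> = dist y m"
      using infdist_attains_inf[OF closed_Ints, of y] by blast
    have "infdist (y + l) \<int> \<le> dist (y + l) (m + l)"
      using m that by (intro infdist_le) auto
    then show ?thesis using m by (simp add: dist_real_def)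
  qed
  from le[of k x] le[of "- k" "x + k"] assms show ?thesis by simp
qed

text \<open>On \<open>\<real>/\<int>\<close> the quotient distance is the distance of the difference to the nearest integer.\<close>

instantiation circle :: metric_space
begin

lift_definition dist_circle :: "circle \<Rightarrow> circle \<Rightarrow> real"
  is "\<lambda>x y. infdist (x - y) \<int>"
proof -
  fix x x' y y' :: real
  assume "x - x' \<in> \<int>" "y - y' \<in> \<int>"
  then have k: "(x - x') - (y - y') \<in> \<int>" by (rule Ints_diff)
  have "x - y = (x' - y') + ((x - x') - (y - y'))" by simp
  with infdist_Ints_add[OF k] show "infdist (x - y) \<int> = infdist (x' - y') \<int>" by metis
qed

definition uniformity_circle :: "(circle \<times> circle) filter" where
  "uniformity_circle = (INF e\<in>{0 <..}. principal {(x, y). dist x y < e})"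

definition open_circle :: "circle set \<Rightarrow> bool" where
  "open_circle U \<longleftrightarrow> (\<forall>x\<in>U. \<forall>\<^sub>F (x', y) in uniformity. x' = x \<longrightarrow> y \<in> U)"

instance
proof
  show "(dist a b = 0) = (a = b)" for a b :: circle
  proof transfer
    fix a b :: real
    show "(infdist (a - b) \<int> = 0) = (a - b \<in> \<int>)"
      using in_closed_iff_infdist_zero[OF closed_Ints, of "a - b"] by auto
  qed
  show "dist a b \<le> dist a c + dist b c" for a b c :: circle
  proof transfer
    fix a b c :: real
    obtain m :: real where m: "m \<in> \<int>" "infdist (a - c) \<int> = dist (a - c) m"
      using infdist_attains_inf[OF closed_Ints, of "a - c"] by blast
    obtain n :: real where n: "n \<in> \<int>" "infdist (b - c) \<int> = dist (b - c) n"
      using infdist_attains_inf[OF closed_Ints, of "b - c"] by blast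
    have "infdist (a - b) \<int> \<le> dist (a - b) (m - n)"
      using m n by (intro infdist_le) auto
    also have "\<dots> \<le> dist (a - c) m + dist (b - c) n"
      by (simp add: dist_real_def)
    finally show "infdist (a - b) \<int> \<le> infdist (a - c) \<int> + infdist (b - c) \<int>"
      using m n by simp
  qed
qed (simp_all add: uniformity_circle_def open_circle_def)

end

text \<open>The product metric \<open>dist (a, b) (c, d) = sqrt ((dist a c)\<^sup>2 + (dist b d)\<^sup>2)\<close> is the flat
  metric; see \<open>dist_to_torus\<close> below.\<close>

type_synonym torus = "circle \<times> circle"

definition to_torus :: "real \<times> real \<Rightarrow> torus" where
  "to_torus z = (to_circle (fst z), to_circle (snd z))"

lemma dist_to_torus:
  "dist (to_torus z) (to_torus w) = infdist (z - w) (\<int> \<times> \<int>)"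
proof -
  define x y where x: "x = fst z - fst w" and y: "y = snd z - snd w"
  have xy: "z - w = (x, y)" unfolding x y by (simp add: prod_eq_iff)
  obtain m :: real where m: "m \<in> \<int>" "infdist x \<int> = dist x m"
    using infdist_attains_inf[OF closed_Ints, of x] by blast
  obtain n :: real where n: "n \<in> \<int>" "infdist y \<int> = dist y n"
    using infdist_attains_inf[OF closed_Ints, of y] by blast
  have d: "dist (to_torus z) (to_torus w) = sqrt ((dist x m)\<^sup>2 + (dist y n)\<^sup>2)"
    unfolding to_torus_def dist_Pair_Pair dist_circle.abs_eq x[symmetric] y[symmetric] m(2) n(2) ..
  have "infdist (x, y) (\<int> \<times> \<int>) \<le> dist (x, y) (m, n)"
    using m n by (intro infdist_le) auto
  moreover have "sqrt ((dist x m)\<^sup>2 + (dist y n)\<^sup>2) \<le> dist (x, y) p" if "p \<in> \<int> \<times> \<int>" for p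
  proof -
    obtain a b where p: "p = (a, b)" "a \<in> \<int>" "b \<in> \<int>" using \<open>p \<in> \<int> \<times> \<int>\<close> by auto
    have "dist x m \<le> dist x a" "dist y n \<le> dist y b"
      using infdist_le[OF p(2), of x] infdist_le[OF p(3), of y] m n by auto
    then show ?thesis
      unfolding p dist_Pair_Pair by (intro real_sqrt_le_mono add_mono power_mono) auto
  qed
  then have "sqrt ((dist x m)\<^sup>2 + (dist y n)\<^sup>2) \<le> infdist (x, y) (\<int> \<times> \<int>)"
    using m n by (intro infdist_greatest) auto
  ultimately show ?thesis unfolding d xy by (simp add: dist_Pair_Pair)
qed

text \<open>Lebesgue measure on the torus, transported from the fundamental domain \<open>[-1/2, 1/2)\<^sup>2\<close>.\<close>

definition torus_vol :: "torus measure" where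
  "torus_vol = distr (restrict_space lborel ({-1/2..<1/2} \<times> {-1/2..<1/2})) borel to_torus"

text \<open>Balls of equal radius are translates of each other, so the centre is immaterial. The value
  is \<open>pi * R\<^sup>2\<close> for \<open>R < 1/2\<close>, see \<open>ball_vol_eq\<close>; larger radii are allowed because the
  covering radius can exceed \<open>1/2\<close>, e.g. for a single point.\<close>

definition ball_vol :: "real \<Rightarrow> real" where
  "ball_vol R = measure torus_vol (ball (to_torus (0, 0)) R)"

lemma continuous_on_to_torus: "continuous_on A to_torus"
proof -
  have "dist (to_torus w) (to_torus z) \<le> dist w z" for w z
    unfolding dist_to_torus dist_norm
    using infdist_le[of 0 "\<int> \<times> \<int>" "w - z"] by (simp add: mem_Times_iff)
  then show ?thesis
    unfolding continuous_on_iff by (meson le_less_trans)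
qed

lemma measurable_to_torus:
  "to_torus \<in> restrict_space lborel A \<rightarrow>\<^sub>M borel"
  using borel_measurable_continuous_onI[OF continuous_on_to_torus]
  by (simp add: measurable_restrict_space1)

lemma ball_vol_eq:
  assumes "0 \<le> R" "R < 1/2"
  shows "ball_vol R = pi * R\<^sup>2"
proof -
  let ?D = "{-1/2..<1/2} \<times> {-1/2..<1/2} :: (real \<times> real) set"
  have inf: "infdist x \<int> = \<bar>x\<bar>" if "x \<in> {-1/2..<1/2}" for x :: real
  proof -
    have "\<bar>x\<bar> \<le> \<bar>x - a\<bar>" if a: "a \<in> \<int>" for a
    proof -
      from a obtain k :: int where k: "a = of_int k" by (rule Ints_cases)
      consider "k = 0" | "k \<ge> 1" | "k \<le> -1" by linarith
      then show ?thesis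
      proof cases
        case 2
        then have "real_of_int k \<ge> 1" by simp
        then show ?thesis using \<open>x \<in> _\<close> k by auto
      next
        case 3
        then have "real_of_int k \<le> -1" by linarith
        then show ?thesis using \<open>x \<in> _\<close> k by auto
      qed (use k in auto)
    qed
    then have "\<bar>x\<bar> \<le> infdist x \<int>" by (intro infdist_greatest) (auto simp: dist_real_def)
    moreover have "infdist x \<int> \<le> \<bar>x\<bar>" using infdist_le[of 0 \<int> x] by simp
    ultimately show ?thesis by simp
  qed
  have dT: "dist (to_torus (0, 0)) (to_torus (x, y)) = sqrt (x\<^sup>2 + y\<^sup>2)"
    if "x \<in> {-1/2..<1/2}" "y \<in> {-1/2..<1/2}" for x y
    by (subst dist_commute)
      (simp only: to_torus_def dist_Pair_Pair dist_circle.abs_eq fst_conv snd_conv diff_0_right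
        inf[OF that(1)] inf[OF that(2)] power2_abs)
  have dE: "dist (0, 0) (x, y) = sqrt (x\<^sup>2 + y\<^sup>2)" for x y :: real
    by (simp add: dist_Pair_Pair dist_real_def)
  have pre: "to_torus -` ball (to_torus (0, 0)) R \<inter> ?D = ball (0, 0) R"
  proof (intro equalityI subrelI)
    fix x y assume z: "(x, y) \<in> to_torus -` ball (to_torus (0, 0)) R \<inter> ?D"
    then have D: "x \<in> {-1/2..<1/2}" "y \<in> {-1/2..<1/2}" by blast+
    from z have "dist (to_torus (0, 0)) (to_torus (x, y)) < R" by simp
    then show "(x, y) \<in> ball (0, 0) R" unfolding mem_ball dT[OF D] dE .
  next
    fix x y :: real assume z: "(x, y) \<in> ball (0, 0) R"
    then have n: "sqrt (x\<^sup>2 + y\<^sup>2) < R" unfolding mem_ball dE .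
    have "\<bar>x\<bar> \<le> sqrt (x\<^sup>2 + y\<^sup>2)" "\<bar>y\<bar> \<le> sqrt (x\<^sup>2 + y\<^sup>2)"
      by (simp_all add: real_le_rsqrt)
    then have "\<bar>x\<bar> < 1/2" "\<bar>y\<bar> < 1/2" using n assms by linarith+
    then have D: "x \<in> {-1/2..<1/2}" "y \<in> {-1/2..<1/2}"
      unfolding atLeastLessThan_iff by linarith+
    have "to_torus (x, y) \<in> ball (to_torus (0, 0)) R"
      unfolding mem_ball dT[OF D] by (rule n)
    then show "(x, y) \<in> to_torus -` ball (to_torus (0, 0)) R \<inter> ?D" using D by blast
  qed
  have D: "?D \<in> sets lborel"
    unfolding sets_lborel by (rule borel_Times) simp_all
  have "ball_vol R = measure (restrict_space lborel ?D) (to_torus -` ball (to_torus (0, 0)) R \<inter> ?D)"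
    unfolding ball_vol_def torus_vol_def
    by (subst measure_distr[OF measurable_to_torus]) (auto simp: space_restrict_space)
  also have "\<dots> = measure lborel (ball (0, 0) R :: (real \<times> real) set)"
    unfolding pre by (rule measure_restrict_space) (use D pre in auto)
  also have "\<dots> = pi * R\<^sup>2"
    using content_ball[of R "(0, 0) :: real \<times> real"] assms
    by (simp add: unit_ball_vol_2 power2_eq_square)
  finally show ?thesis .
qed


section \<open>Covering radius and covering exponent\<close>

definition covering_radius :: "torus set \<Rightarrow> real" where
  "covering_radius P = (LEAST R. R > 0 \<and> (\<forall>x. \<exists>p\<in>P. dist x p \<le> R))"

text \<open>The liminf is taken in the extended reals.\<close>

definition covering_exponent :: "(nat \<Rightarrow> torus set) \<Rightarrow> ereal" where
  "covering_exponent P =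
     - liminf (\<lambda>n. ereal (ln (real (card (P n))) / ln (ball_vol (covering_radius (P n)))))"

lemma surj_to_torus: "to_torus ` ({0..1} \<times> {0..1}) = UNIV"
proof (intro equalityI subsetI)
  fix t :: torus
  obtain a b where t: "t = (a, b)" by (cases t)
  obtain x y where ab: "a = to_circle x" "b = to_circle y"
    by (metis Quotient3_abs_rep Quotient3_circle)
  have "to_circle x = to_circle (frac x)" for x
    by (simp add: circle.abs_eq_iff frac_def)
  then have "t = to_torus (frac x, frac y)" using t ab by (simp add: to_torus_def)
  moreover have "(frac x, frac y) \<in> {0..1} \<times> {0..1}"
    by (auto simp: less_imp_le frac_lt_1)
  ultimately show "t \<in> to_torus ` ({0..1} \<times> {0..1})" by blast
qed simp

lemma covering_radius_is_least:
  assumes "finite P" "P \<noteq> {}"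
  shows "covering_radius P > 0" "\<exists>p\<in>P. dist x p \<le> covering_radius P"
    and "R > 0 \<Longrightarrow> \<forall>x. \<exists>p\<in>P. dist x p \<le> R \<Longrightarrow> covering_radius P \<le> R"
proof -
  let ?Q = "\<lambda>R. R > 0 \<and> (\<forall>x. \<exists>p\<in>P. dist x p \<le> R)"
  have cpt: "compact (UNIV :: torus set)"
    unfolding surj_to_torus[symmetric]
    by (intro compact_continuous_image continuous_on_to_torus compact_Times) auto
  have ex: "(\<exists>p\<in>P. dist y p \<le> R) \<longleftrightarrow> infdist y P \<le> R" for y R
  proof -
    have "infdist y P = Min (dist y ` P)"
      using assms by (simp add: infdist_notempty cInf_eq_Min)
    then show ?thesis using assms by (simp add: Min_le_iff)
  qed
  have "continuous_on UNIV (\<lambda>x :: torus. infdist x P)"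
    by (intro continuous_intros)
  from continuous_attains_sup[OF cpt UNIV_not_empty this]
  obtain y where y: "\<And>x. infdist x P \<le> infdist y P"
    by blast
  have "\<exists>x. x \<notin> P"
  proof (rule ccontr)
    assume "\<nexists>x. x \<notin> P"
    then have "range (\<lambda>x. to_torus (x, 0)) \<subseteq> P" by (meson subsetI)
    then have "finite ((\<lambda>x. to_torus (x, 0)) ` {0..<1})"
      by (intro finite_subset[OF _ assms(1)]) (meson image_mono subset_UNIV subset_trans)
    moreover have "inj_on (\<lambda>x. to_torus (x, 0)) {0..<1}"
    proof (rule inj_onI)
      fix u v :: real
      assume *: "u \<in> {0..<1}" "v \<in> {0..<1}" "to_torus (u, 0) = to_torus (v, 0)"
      then have "u - v \<in> \<int>" by (simp add: to_torus_def circle.abs_eq_iff)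
      then obtain k :: int where k: "u - v = of_int k" by (rule Ints_cases)
      then have "of_int k < (1::real)" "of_int k > (-1::real)" using * by auto
      then have "k = 0" by linarith
      then show "u = v" using k by simp
    qed
    ultimately have "finite {0..<1::real}"
      by (rule finite_imageD)
    then show False using infinite_Ico[of 0 "1::real"] by simp
  qed
  then obtain x0 where "x0 \<notin> P" by blast
  then have "infdist x0 P \<noteq> 0"
    using in_closed_iff_infdist_zero[OF finite_imp_closed[OF assms(1)] assms(2)] by blast
  then have "infdist y P > 0"
    using y[of x0] infdist_nonneg[of x0 P] by linarith
  then have Q: "?Q (infdist y P)" using y ex by blast
  have min: "infdist y P \<le> R" if "?Q R" for R using that ex by blast
  have eq: "covering_radius P = infdist y P"
    unfolding covering_radius_def using Q min by (intro Least_equality) auto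
  show "covering_radius P > 0" "\<exists>p\<in>P. dist x p \<le> covering_radius P"
    using Q unfolding eq by blast+
  show "R > 0 \<Longrightarrow> \<forall>x. \<exists>p\<in>P. dist x p \<le> R \<Longrightarrow> covering_radius P \<le> R"
    using min unfolding eq by blast
qed


section \<open>The points of the modular hyperbola\<close>

text \<open>The units modulo \<open>q\<close> are represented by \<open>totatives q\<close>. The index \<open>q = 0\<close> is harmless:
  \<open>inverse_points 0 = {}\<close>, and a liminf does not depend on finitely many terms.\<close>

definition inverse_points :: "nat \<Rightarrow> torus set" where
  "inverse_points q =
     (\<lambda>d. to_torus (real d / real q, real_of_int (modular_inverse (int q) (int d)) / real q))
       ` totatives q"

lemma card_inverse_points: "card (inverse_points q) = totient q"
proof -
  have "inj_on (\<lambda>d. to_torus (real d / real q,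
          real_of_int (modular_inverse (int q) (int d)) / real q)) (totatives q)"
  proof (rule inj_onI)
    fix d e
    assume d: "d \<in> totatives q" and e: "e \<in> totatives q" and
      eq: "to_torus (real d / real q, real_of_int (modular_inverse (int q) (int d)) / real q) =
           to_torus (real e / real q, real_of_int (modular_inverse (int q) (int e)) / real q)"
    from d e have q: "q > 0" and b: "0 < d" "d \<le> q" "0 < e" "e \<le> q"
      by (auto simp: in_totatives_iff)
    from eq have "real d / real q - real e / real q \<in> \<int>"
      by (simp add: to_torus_def circle.abs_eq_iff)
    then obtain k :: int where "real d / real q - real e / real q = of_int k"
      by (rule Ints_cases)
    then have "real d - real e = of_int k * real q" using q by (simp add: field_simps)
    then have "real_of_int (int d - int e) = real_of_int (k * int q)" by simp
    then have k: "int d - int e = k * int q" by (simp only: of_int_eq_iff)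
    have "\<bar>int d - int e\<bar> < int q" using b by linarith
    then have "\<bar>k\<bar> * int q < 1 * int q" unfolding k by (simp add: abs_mult)
    then have "k = 0" using q by (simp add: mult_less_cancel_right)
    then show "d = e" using k by simp
  qed
  then show ?thesis by (simp add: inverse_points_def card_image totient_def)
qed

end

theory Submission
  imports Defs "Berlekamp_Zassenhaus.Finite_Field" "HOL-Algebra.Algebraic_Closure_Type"
    "HOL-Real_Asymp.Real_Asymp"
begin

text \<open>
  Detecting the points of \<open>S\<^sub>q\<close> in a square of side \<open>L/q\<close> by Fourier analysis on \<open>(\<int>/q\<int>)\<^sup>2\<close> gives a main
  term of order \<open>L\<^sup>2 \<phi>(q) / q\<^sup>2\<close> and an error term governed by Kloosterman sums modulo \<open>q\<close>. Square root
  cancellation in these sums makes the main term dominate once \<open>L\<close> exceeds \<open>q\<close> to the power \<open>3/4 + \<epsilon>\<close>,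
  so the covering radius is at most \<open>q\<close> to the power \<open>\<epsilon> - 1/4\<close>, and balls of this radius have volume
  about \<open>q\<close> to the power \<open>-1/2\<close>.

  Twisted multiplicativity reduces the bound for Kloosterman sums to prime powers. Proper powers are
  treated by stationary phase. For an odd prime \<open>p\<close> the bound is due to Weil. The sum over \<open>\<F>\<^sub>p\<close> and its
  analogues over the extensions of \<open>\<F>\<^sub>p\<close> are power sums \<open>-(\<alpha>\<^sup>n + \<beta>\<^sup>n)\<close> with \<open>\<alpha> \<beta> = p\<close>, because the
  L-function is a quadratic polynomial. Averaged over all nontrivial additive characters, these sums
  count the solutions of \<open>y\<^sup>p - y = x + a/x\<close>, that is, the points of the hyperelliptic curve
  \<open>w\<^sup>2 = (y\<^sup>p - y)\<^sup>2 - 4a\<close>. A version of Stepanov's method bounds the latter number from below over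
  the fields with \<open>p\<^sup>2\<^sup>m\<close> elements. As the sums are real, a lower bound suffices: if
  \<open>\<bar>\<alpha>\<bar>\<^sup>2 > p\<close>, then \<open>\<alpha>\<close> is real and its even powers cannot cancel.
\<close>

hide_const (open) Polynomials.degree up_ring.coeff up_ring.monom Coset.order Polynomials.lead_coeff
  module.smult Divisibility.irreducible Divisibility.prime

section \<open>Finite fields inside an algebraic closure\<close>

text \<open>Only exponents matter in the end, and for fixed A the quantity
  \<open>A ^ omega q\<close> stays below a constant times any given positive power of q. So each
  prime factor of q may cost a constant (8 in the Kloosterman bound, 4 in a divisor sum, 2 in the
  totient bound), and p = 2 can be treated crudely along with the other primes. The obstacle in the
  Fourier argument is the frequencies that share a factor with q: there the Kloosterman sums are
  larger by the root of a gcd. The box is therefore detected by the autocorrelation of an interval,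
  whose Fourier coefficients are nonnegative and can be summed over the multiples of any divisor of
  q by orthogonality. Stepanov's method runs over fields with Q^2 elements because x \<mapsto> x^Q
  is an involution there: the Q-th power of the auxiliary polynomial is again a polynomial of small
  degree on the field. All these fields are kept as subsets \<open>Fq n\<close> of one algebraically
  closed type, the fixed points of an iterated Frobenius map, since n has to vary inside a
  proof.\<close>

definition Fq :: "nat \<Rightarrow> 'a::field_prime_char set" where
  "Fq n = {x. x ^ (CHAR('a) ^ n) = x}"

lemma frobenius_add:
  "(x + y :: 'a::comm_ring_prime_char) ^ (CHAR('a) ^ n) = x ^ (CHAR('a) ^ n) + y ^ (CHAR('a) ^ n)"
  by (rule freshmans_dream') auto

lemma frobenius_sum:
  "(\<Sum>i\<in>A. f i :: 'a::comm_ring_prime_char) ^ (CHAR('a) ^ n) = (\<Sum>i\<in>A. f i ^ (CHAR('a) ^ n))"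
  by (rule freshmans_dream_sum') auto

lemma frobenius_uminus:
  "(- x :: 'a::comm_ring_prime_char) ^ (CHAR('a) ^ n) = - (x ^ (CHAR('a) ^ n))"
proof -
  have "x ^ (CHAR('a) ^ n) + (- x) ^ (CHAR('a) ^ n) = 0"
    using frobenius_add[of x "-x" n] by (simp add: power_0_left)
  thus ?thesis by (simp add: eq_neg_iff_add_eq_0 add.commute)
qed

lemma frobenius_diff:
  "(x - y :: 'a::comm_ring_prime_char) ^ (CHAR('a) ^ n) = x ^ (CHAR('a) ^ n) - y ^ (CHAR('a) ^ n)"
  using frobenius_add[of x "-y" n] by (simp add: frobenius_uminus)

lemma frobenius_inj:
  "x ^ (CHAR('a) ^ n) = y ^ (CHAR('a) ^ n) \<longleftrightarrow> x = (y :: 'a::field_prime_char)"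
proof
  assume "x ^ (CHAR('a) ^ n) = y ^ (CHAR('a) ^ n)"
  hence "(x - y) ^ (CHAR('a) ^ n) = 0" by (simp add: frobenius_diff)
  thus "x = y" by simp
qed auto

lemma Fq_iff: "x \<in> Fq n \<longleftrightarrow> x ^ (CHAR('a) ^ n) = (x :: 'a::field_prime_char)"
  by (simp add: Fq_def)

lemma Fq_0 [simp]: "0 \<in> Fq n" and Fq_1 [simp]: "1 \<in> Fq n"
  by (auto simp: Fq_def power_0_left)

lemma Fq_add: "x \<in> Fq n \<Longrightarrow> y \<in> Fq n \<Longrightarrow> x + y \<in> Fq n"
  and Fq_diff: "x \<in> Fq n \<Longrightarrow> y \<in> Fq n \<Longrightarrow> x - y \<in> Fq n"
  and Fq_uminus: "x \<in> Fq n \<Longrightarrow> - x \<in> Fq n"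
  and Fq_mult: "x \<in> Fq n \<Longrightarrow> y \<in> Fq n \<Longrightarrow> x * y \<in> Fq n"
  and Fq_divide: "x \<in> Fq n \<Longrightarrow> y \<in> Fq n \<Longrightarrow> x / y \<in> Fq n"
  and Fq_power: "x \<in> Fq n \<Longrightarrow> x ^ k \<in> Fq n"
  by (auto simp: Fq_def frobenius_add frobenius_diff frobenius_uminus power_mult_distrib power_divide)
     (metis power_commutes power_mult mult.commute)

lemma Fq_sum: "(\<And>i. i \<in> A \<Longrightarrow> f i \<in> Fq n) \<Longrightarrow> sum f A \<in> Fq n"
  by (induction A rule: infinite_finite_induct) (auto intro: Fq_add)

lemma Fq_of_nat: "of_nat k \<in> Fq n"
  by (induction k) (auto intro: Fq_add)

lemma Fq_of_int: "of_int k \<in> Fq n"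
  by (cases k) (auto intro: Fq_of_nat Fq_uminus simp del: of_nat_Suc)

lemma Fq_numeral: "numeral k \<in> Fq n"
  using Fq_of_nat[of "numeral k" n] by simp

lemma Fq_dvd: "k dvd n \<Longrightarrow> x \<in> Fq k \<Longrightarrow> x \<in> Fq n"
proof (elim dvdE)
  fix m assume x: "x \<in> Fq k" and n: "n = k * m"
  have "x ^ (CHAR('a) ^ (k * m)) = x" using x
    by (induction m) (simp_all add: Fq_def power_add power_mult)
  thus "x \<in> Fq n" by (simp add: Fq_def n)
qed

lemma CHAR_gt_1: "CHAR('a::field_prime_char) > 1"
  using CHAR_prime[where ?'a = 'a] prime_gt_1_nat by blast

lemma two_neq_0_odd_char:
  assumes "odd CHAR('a)"
  shows "(2 :: 'a::field_prime_char) \<noteq> 0"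
proof
  assume "(2 :: 'a) = 0"
  hence "of_nat 2 = (0 :: 'a)" by simp
  hence "CHAR('a) dvd 2" by (simp only: of_nat_eq_0_iff_char_dvd)
  hence "CHAR('a) \<le> 2" by (rule dvd_imp_le) simp
  with CHAR_gt_1[where ?'a = 'a] have "CHAR('a) = 2" by simp
  with assms show False by simp
qed

lemma degree_pow_minus_X:
  fixes q :: nat assumes "q > 1"
  shows "degree (monom 1 q - monom 1 1 :: 'a::field poly) = q"
proof (rule antisym)
  show "degree (monom 1 q - monom 1 1 :: 'a poly) \<le> q"
    using assms by (intro degree_diff_le) (auto simp: degree_monom_eq)
  show "q \<le> degree (monom 1 q - monom 1 1 :: 'a poly)"
    using assms by (intro le_degree) auto
qed

lemma sum_order_alg_closed:
  fixes f :: "'a::alg_closed_field poly"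
  assumes "f \<noteq> 0"
  shows "(\<Sum>x | poly f x = 0. order x f) = degree f"
proof -
  obtain A where A: "size A = degree f" "f = smult (lead_coeff f) (\<Prod>x\<in>#A. [:-x, 1:])"
    using alg_closed_imp_factorization[OF assms] by metis
  have "proots f = proots (\<Prod>x\<in>#A. [:-x, 1:])"
    using assms by (subst A(2)) simp
  also have "\<dots> = A"
    proof (induction A)
    case (add x A)
    have "(\<Prod>x\<in>#A. [:-x, 1:]) \<noteq> 0" by (auto simp: prod_mset_zero_iff)
    thus ?case using add by (simp add: proots_mult del: mult_pCons_left)
  qed simp
  finally have "size (proots f) = degree f" using A by simp
  thus ?thesis using assms by (simp add: size_multiset_overloaded_eq)
qed

lemma order_eq_1:
  fixes f :: "'a::idom poly"
  assumes "poly f x = 0" "poly (pderiv f) x \<noteq> 0"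
  shows "order x f = 1"
proof -
  have f0: "f \<noteq> 0" using assms by auto
  have "\<not> order x f \<ge> 2"
  proof
    assume "order x f \<ge> 2"
    hence "[:-x, 1:] ^ 2 dvd f" by (meson dvd_trans le_imp_power_dvd order_1)
    then obtain g where "f = [:-x, 1:] ^ 2 * g" by (elim dvdE)
    hence "f = [:-x, 1:] * ([:-x, 1:] * g)" by (simp only: power2_eq_square mult.assoc)
    hence "poly (pderiv f) x = 0"
      by (simp add: pderiv_mult del: mult_pCons_left)
    thus False using assms by simp
  qed
  moreover have "order x f \<noteq> 0" using assms f0 by (simp add: order_root)
  ultimately show ?thesis by simp
qed

text \<open>The roots of X^q - X are simple because its derivative is -1, so over an algebraically
  closed field their number is the degree. The case n = 0 is different: \<open>Fq 0\<close> is the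
  whole type.\<close>

lemma Fq_card:
  assumes "n > 0"
  shows "card (Fq n :: 'a::{alg_closed_field,field_prime_char} set) = CHAR('a) ^ n"
    and "finite (Fq n :: 'a set)"
proof -
  define q where "q = CHAR('a) ^ n"
  define f where "f = (monom 1 q - monom 1 1 :: 'a poly)"
  have p: "prime CHAR('a)" by simp
  have q: "q > 1" unfolding q_def using assms p by (metis one_less_power prime_gt_1_nat)
  have deg: "degree f = q" unfolding f_def by (rule degree_pow_minus_X[OF q])
  hence f0: "f \<noteq> 0" using q by auto
  have roots: "{x. poly f x = 0} = Fq n"
    by (auto simp: f_def Fq_def poly_monom q_def)
  have "of_nat q = (0::'a)" using assms by (simp add: q_def power_0_left)
  hence pd: "pderiv f = -1"
    by (simp add: f_def pderiv_diff pderiv_monom one_pCons monom_0)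
  have ord: "order x f = 1" if "poly f x = 0" for x
    using that pd by (intro order_eq_1) auto
  have "(\<Sum>x | poly f x = 0. order x f) = q" using sum_order_alg_closed[OF f0] deg by simp
  also have "(\<Sum>x | poly f x = 0. order x f) = (\<Sum>x | poly f x = 0. 1)"
    by (intro sum.cong) (auto simp: ord)
  finally show "card (Fq n :: 'a set) = CHAR('a) ^ n" unfolding roots q_def by simp
  show "finite (Fq n :: 'a set)" using poly_roots_finite[OF f0] roots by simp
qed

section \<open>Stepanov's method\<close>

text \<open>A supply of k free coefficients from a finite field. Its finiteness allows the
  pigeonhole principle in place of linear algebra.\<close>

definition polyF :: "nat \<Rightarrow> nat \<Rightarrow> 'a::field_prime_char poly set" where
  "polyF n k = {r. (\<forall>i. coeff r i \<in> Fq n) \<and> (\<forall>i\<ge>k. coeff r i = 0)}"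

lemma polyF_degree: "r \<in> polyF n k \<Longrightarrow> k > 0 \<Longrightarrow> degree r < k"
  using degree_lessI[of r k] by (cases "r = 0") (auto simp: polyF_def)

lemma polyF_I: "(\<And>i. coeff r i \<in> Fq n) \<Longrightarrow> degree r < k \<Longrightarrow> r \<in> polyF n k"
  unfolding polyF_def by (auto intro: coeff_eq_0)

lemma polyF_card:
  assumes "n > 0"
  shows "card (polyF n k :: 'a::{alg_closed_field,field_prime_char} poly set) = (CHAR('a) ^ n) ^ k"
    and "finite (polyF n k :: 'a poly set)"
proof -
  have bij: "bij_betw (\<lambda>r. restrict (coeff r) {..<k}) (polyF n k :: 'a poly set) ({..<k} \<rightarrow>\<^sub>E Fq n)"
  proof (rule bij_betw_byWitness[where f' = "\<lambda>c. \<Sum>i<k. monom (c i) i"])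
    show "\<forall>r\<in>polyF n k. (\<Sum>i<k. monom (restrict (coeff r) {..<k} i) i) = (r :: 'a poly)"
    proof
      fix r :: "'a poly" assume r: "r \<in> polyF n k"
      have "coeff (\<Sum>i<k. monom (restrict (coeff r) {..<k} i) i) j = coeff r j" for j
      proof -
        have "coeff (\<Sum>i<k. monom (restrict (coeff r) {..<k} i) i) j = (\<Sum>i<k. if i = j then coeff r i else 0)"
          by (simp add: coeff_sum)
        also have "\<dots> = coeff r j" using r by (auto simp: polyF_def)
        finally show ?thesis .
      qed
      thus "(\<Sum>i<k. monom (restrict (coeff r) {..<k} i) i) = r" by (rule poly_eqI)
    qed
    show "\<forall>c\<in>{..<k} \<rightarrow>\<^sub>E Fq n. restrict (coeff (\<Sum>i<k. monom (c i :: 'a) i)) {..<k} = c"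
    proof
      fix c :: "nat \<Rightarrow> 'a" assume c: "c \<in> {..<k} \<rightarrow>\<^sub>E Fq n"
      show "restrict (coeff (\<Sum>i<k. monom (c i :: 'a) i)) {..<k} = c"
      proof
        fix j show "restrict (coeff (\<Sum>i<k. monom (c i :: 'a) i)) {..<k} j = c j"
          using c by (cases "j < k") (simp_all add: coeff_sum PiE_def extensional_def)
      qed
    qed
    show "(\<lambda>r. restrict (coeff r) {..<k}) ` polyF n k \<subseteq> {..<k} \<rightarrow>\<^sub>E Fq n"
    proof
      fix c assume "c \<in> (\<lambda>r. restrict (coeff r) {..<k}) ` polyF n k"
      then obtain r where "r \<in> polyF n k" "c = restrict (coeff r) {..<k}" by blast
      thus "c \<in> {..<k} \<rightarrow>\<^sub>E Fq n" by (simp add: polyF_def PiE_def)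
    qed
    show "(\<lambda>c. \<Sum>i<k. monom (c i) i) ` ({..<k} \<rightarrow>\<^sub>E Fq n) \<subseteq> (polyF n k :: 'a poly set)"
    proof
      fix r :: "'a poly" assume "r \<in> (\<lambda>c. \<Sum>i<k. monom (c i) i) ` ({..<k} \<rightarrow>\<^sub>E Fq n)"
      then obtain c where c: "c \<in> {..<k} \<rightarrow>\<^sub>E Fq n" "r = (\<Sum>i<k. monom (c i) i)" by blast
      have "coeff r i = (if i < k then c i else 0)" for i by (simp add: c(2) coeff_sum)
      thus "r \<in> polyF n k" using c(1) by (auto simp: polyF_def PiE_def)
    qed
  qed
  show "card (polyF n k :: 'a poly set) = (CHAR('a) ^ n) ^ k"
    using bij_betw_same_card[OF bij] Fq_card[OF assms, where ?'a = 'a] by (simp add: card_PiE)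
  show "finite (polyF n k :: 'a poly set)"
    using bij_betw_finite[OF bij] Fq_card(2)[OF assms, where ?'a = 'a] by (simp add: finite_PiE)
qed

definition overF :: "nat \<Rightarrow> 'a::field_prime_char poly \<Rightarrow> bool" where
  "overF n r \<longleftrightarrow> (\<forall>i. coeff r i \<in> Fq n)"

lemma overF_add: "overF n r \<Longrightarrow> overF n s \<Longrightarrow> overF n (r + s)"
  and overF_diff: "overF n r \<Longrightarrow> overF n s \<Longrightarrow> overF n (r - s)"
  and overF_uminus: "overF n r \<Longrightarrow> overF n (- r)"
  and overF_mult: "overF n r \<Longrightarrow> overF n s \<Longrightarrow> overF n (r * s)"
  and overF_monom: "c \<in> Fq n \<Longrightarrow> overF n (monom c k)"
  and overF_pCons: "c \<in> Fq n \<Longrightarrow> overF n r \<Longrightarrow> overF n (pCons c r)"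
  and overF_0: "overF n 0"
  and overF_1: "overF n 1"
  by (auto simp: overF_def coeff_mult coeff_pCons intro!: Fq_add Fq_diff Fq_uminus Fq_mult Fq_sum split: nat.split)

lemma overF_power: "overF n r \<Longrightarrow> overF n (r ^ k)"
  by (induction k) (auto intro: overF_1 overF_mult)

lemma overF_sum: "(\<And>i. i \<in> A \<Longrightarrow> overF n (f i)) \<Longrightarrow> overF n (sum f A)"
  by (induction A rule: infinite_finite_induct) (auto intro: overF_0 overF_add)

text \<open>Compare orders at the simple root x: the left side has even order and the right side odd
  order unless both vanish.\<close>

lemma square_ne_simple_root_multiple:
  fixes f A E :: "'a::field poly"
  assumes "f \<noteq> 0" "order x f = 1" "c \<noteq> 0" "A\<^sup>2 = smult c (E\<^sup>2 * f)"
  shows "A = 0 \<and> E = 0"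
proof (cases "E = 0")
  case False
  have "A \<noteq> 0" using assms False by auto
  hence "order x (A\<^sup>2) = 2 * order x A" by (simp add: power2_eq_square order_mult)
  moreover have "order x (smult c (E\<^sup>2 * f)) = 2 * order x E + 1"
    using False assms(1,2,3) by (simp add: power2_eq_square order_mult order_smult)
  ultimately have "2 * order x A = 2 * order x E + 1" using assms(4) by simp
  thus ?thesis by presburger
qed (use assms in simp)

lemma monom_dvd_imp_eq_0:
  fixes r :: "'a::field poly"
  assumes "monom 1 k dvd r" "degree r < k"
  shows "r = 0"
proof (rule ccontr)
  assume "r \<noteq> 0"
  hence "degree (monom (1::'a) k) \<le> degree r" using assms(1) by (rule dvd_imp_degree_le[rotated])
  thus False using assms(2) by (simp add: degree_monom_eq)
qed

text \<open>Writing f = c + X g, additivity of Frobenius gives f^Q = c^Q + X^Q g^Q. So f^Q may be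
  treated as a constant modulo X^Q.\<close>

lemma power_char_mod_monom:
  fixes f :: "'a::field_prime_char poly"
  shows "monom 1 (CHAR('a) ^ m) dvd f ^ (CHAR('a) ^ m) - [:coeff f 0 ^ (CHAR('a) ^ m):]"
proof -
  obtain c g where f: "f = pCons c g" by (cases f)
  have "f = [:c:] + monom 1 1 * g" by (simp add: f monom_altdef)
  also have "\<dots> ^ (CHAR('a) ^ m) = [:c:] ^ (CHAR('a) ^ m) + (monom 1 1 * g) ^ (CHAR('a) ^ m)"
    using frobenius_add[of "[:c:]" "monom 1 1 * g" m] by simp
  also have "\<dots> = [:c ^ (CHAR('a) ^ m):] + monom 1 (CHAR('a) ^ m) * g ^ (CHAR('a) ^ m)"
    by (simp add: power_mult_distrib poly_const_pow monom_power)
  finally show ?thesis by (simp add: f)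
qed

text \<open>Block j starts at X^(jQ), so the lowest block that could be nonzero is divisible by X^Q.
  Multiplying it by its conjugate turns f^t into f^(2t) = f f^Q, where f^Q is a constant c modulo
  X^Q. What remains, A^2 - c E^2 f, has degree below Q and hence is 0, which the simple root of f
  forbids. Here t is (Q + 1)/2, one more than the t of \<open>stepanov_auxiliary\<close>.\<close>

lemma stepanov_nonvanishing:
  fixes f :: "'a::field_prime_char poly"
  assumes Q: "Q = CHAR('a) ^ m" and f0: "coeff f 0 \<noteq> 0" and simple: "order x f = 1"
    and degA: "\<And>j. j < J \<Longrightarrow> 2 * degree (A j) < Q"
    and degE: "\<And>j. j < J \<Longrightarrow> 2 * degree (E j) + degree f < Q"
    and t: "2 * t = Q + 1"
    and zero: "(\<Sum>j<J. (A j + E j * f ^ t) * monom 1 (j * Q)) = 0"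
    and j: "j < J"
  shows "A j = 0 \<and> E j = 0"
  using j
proof (induction j rule: less_induct)
  case (less j)
  let ?T = "\<lambda>i. (A i + E i * f ^ t) * monom 1 (i * Q)"
  have "(\<Sum>i<J. ?T i) = (\<Sum>i\<in>{j..<J}. ?T i)"
  proof (rule sum.mono_neutral_right)
    show "\<forall>i\<in>{..<J} - {j..<J}. ?T i = 0"
    proof
      fix i assume "i \<in> {..<J} - {j..<J}"
      hence "i < j" "i < J" by auto
      hence "A i = 0 \<and> E i = 0" by (rule less.IH)
      thus "?T i = 0" by simp
    qed
  qed auto
  also have "\<dots> = (A j + E j * f ^ t) * monom 1 (j * Q) + (\<Sum>i\<in>{Suc j..<J}. ?T i)"
    using less.prems by (rule sum.atLeast_Suc_lessThan)
  also have "(\<Sum>i\<in>{Suc j..<J}. ?T i) = monom 1 (j * Q) * (monom 1 Q *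
      (\<Sum>i\<in>{Suc j..<J}. (A i + E i * f ^ t) * monom 1 ((i - Suc j) * Q)))"
  proof -
    have "?T i = monom 1 (j * Q) * (monom 1 Q * ((A i + E i * f ^ t) * monom 1 ((i - Suc j) * Q)))"
      if "i \<in> {Suc j..<J}" for i
    proof -
      have "i * Q = j * Q + (Q + (i - Suc j) * Q)"
      proof -
        have "i = j + (1 + (i - Suc j))" using that by auto
        thus ?thesis by (metis add_mult_distrib mult_1)
      qed
      hence "monom (1::'a) (i * Q) = monom 1 (j * Q) * (monom 1 Q * monom 1 ((i - Suc j) * Q))"
        by (simp add: mult_monom)
      moreover have "x = y * (z * w) \<Longrightarrow> s * x = y * (z * (s * w))" for s x y z w :: "'a poly"
        by (simp add: mult_ac)
      ultimately show ?thesis by blast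
    qed
    thus ?thesis unfolding sum_distrib_left by (intro sum.cong refl)
  qed
  finally have "monom 1 (j * Q) * ((A j + E j * f ^ t) + monom 1 Q *
      (\<Sum>i\<in>{Suc j..<J}. (A i + E i * f ^ t) * monom 1 ((i - Suc j) * Q))) = 0"
    using zero by (simp only: distrib_left[of "monom 1 (j * Q)" _ "monom 1 Q * _"] mult.commute[of "A j + E j * f ^ t"])
  hence eq0: "(A j + E j * f ^ t) + monom 1 Q *
      (\<Sum>i\<in>{Suc j..<J}. (A i + E i * f ^ t) * monom 1 ((i - Suc j) * Q)) = 0"
    by (simp add: monom_eq_0_iff)
  hence "monom 1 Q dvd A j + E j * f ^ t"
  proof -
    have "x + y * z = 0 \<Longrightarrow> y dvd x" for x y z :: "'a poly"
      by (rule dvdI[of _ _ "- z"]) (simp add: eq_neg_iff_add_eq_0)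
    thus ?thesis using eq0 by blast
  qed
  hence "monom 1 Q dvd (A j + E j * f ^ t) * (A j - E j * f ^ t)" by (rule dvd_mult2)
  also have "(A j + E j * f ^ t) * (A j - E j * f ^ t) = (A j)\<^sup>2 - (E j)\<^sup>2 * f ^ (2 * t)"
    by (simp only: square_diff_square_factored[symmetric]) (simp add: power_mult mult.commute[of 2], simp add: power2_eq_square mult_ac)
  also have "f ^ (2 * t) = f * f ^ Q" by (simp add: t)
  finally have d1: "monom 1 Q dvd (A j)\<^sup>2 - (E j)\<^sup>2 * (f * f ^ Q)" .
  define c where "c = coeff f 0 ^ Q"
  have "monom 1 Q dvd (E j)\<^sup>2 * f * (f ^ Q - [:c:])"
    using power_char_mod_monom[of m f] by (simp add: Q c_def)
  from dvd_add[OF d1 this]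
  have "monom 1 Q dvd (A j)\<^sup>2 - (E j)\<^sup>2 * (f * f ^ Q) + (E j)\<^sup>2 * f * (f ^ Q - [:c:])" .
  also have "\<dots> = (A j)\<^sup>2 - smult c ((E j)\<^sup>2 * f)"
    by (simp add: right_diff_distrib mult_ac)
  finally have "monom 1 Q dvd (A j)\<^sup>2 - smult c ((E j)\<^sup>2 * f)" .
  moreover have "degree ((A j)\<^sup>2 - smult c ((E j)\<^sup>2 * f)) < Q"
  proof -
    have "degree ((A j)\<^sup>2) < Q" using degA[OF less.prems] degree_power_le[of "A j" 2] by simp
    moreover have "degree (smult c ((E j)\<^sup>2 * f)) \<le> 2 * degree (E j) + degree f"
      using degree_smult_le[of c "(E j)\<^sup>2 * f"] degree_mult_le[of "(E j)\<^sup>2" f] degree_power_le[of "E j" 2]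
      by linarith
    ultimately show ?thesis using degE[OF less.prems] by (intro degree_diff_less) auto
  qed
  ultimately have "(A j)\<^sup>2 - smult c ((E j)\<^sup>2 * f) = 0" by (rule monom_dvd_imp_eq_0)
  thus ?case using square_ne_simple_root_multiple[OF _ simple, of c "A j" "E j"] f0 by (cases "f = 0") (simp_all add: c_def)
qed

lemma polyF_iff: "r \<in> polyF n k \<longleftrightarrow> overF n r \<and> (\<forall>i\<ge>k. coeff r i = 0)"
  by (simp add: polyF_def overF_def)

text \<open>Stepanov's auxiliary polynomial is \<open>G = \<Sum>j<J. (A j + E j * f ^ (t + 1)) * X ^ (j * Q)\<close>. At a point
  with \<open>x ^ Q\<^sup>2 = x\<close> where \<open>f\<close> takes a non-square value, \<open>G(x) ^ Q\<close> is the value of the polynomial that is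
  annihilated identically in the following lemma. Hence \<open>G\<close> vanishes there, and the Frobenius map
  replaces the derivatives of the classical argument.\<close>

lemma stepanov_auxiliary:
  fixes f :: "'a::{alg_closed_field,field_prime_char} poly"
  assumes n: "n > 0" and Q: "Q = CHAR('a) ^ m" and Qt: "Q = 2 * t + 1"
    and f: "overF n f" "degree f = 2 * D" and t: "t \<ge> D + 3" and J: "J = t + 1 + D"
  obtains A E where "\<And>j. j < J \<Longrightarrow> degree (A j) < t" "\<And>j. j < J \<Longrightarrow> degree (E j) < t - D"
    "\<exists>j<J. A j \<noteq> 0 \<or> E j \<noteq> 0"
    "(\<Sum>j<J. (A j ^ Q - E j ^ Q * f ^ (t + 1)) * monom 1 j) = 0"
proof -
  \<comment> \<open>The number of coefficients of a value of \<Phi>, that is, the number of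
    conditions; each of the J blocks offers t + (t - D) = 2t - D unknowns.\<close>
  define M where "M = Q * (t - 1) + D + J"
  define q where "q = CHAR('a) ^ n"
  define W where "W = {..<J} \<rightarrow>\<^sub>E ((polyF n t :: 'a poly set) \<times> (polyF n (t - D) :: 'a poly set))"
  \<comment> \<open>\<Phi> is additive but involves Q-th powers of the unknowns, so it is not linear
    over the field. An element of its kernel is obtained as the difference of two arguments with
    equal values.\<close>
  define \<Phi> where "\<Phi> = (\<lambda>w. \<Sum>j<J. (fst (w j) ^ Q - snd (w j) ^ Q * f ^ (t + 1)) * monom (1::'a) j)"
  have p: "prime CHAR('a)" by simp
  have q1: "q > 1" unfolding q_def using n p by (metis one_less_power prime_gt_1_nat)
  have degf: "degree (f ^ (t + 1)) \<le> (t + 1) * (2 * D)"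
    using degree_power_le[of f "t + 1"] f(2) by (simp add: mult.commute)
  \<comment> \<open>The E-blocks get D coefficients fewer than the A-blocks. After the Q-th power
    this saves Q D in degree, while f^(t + 1) has degree 2D(t + 1) = D(Q + 1); both kinds of term
    then fit the same bound up to D.\<close>
  have arith: "Q * (t - D - 1) + (t + 1) * (2 * D) = Q * (t - 1) + D"
  proof -
    obtain u where u: "t = D + 3 + u" using t le_Suc_ex by blast
    show ?thesis by (simp add: u Qt algebra_simps)
  qed
  have "\<Phi> ` W \<subseteq> polyF n M"
  proof
    fix r assume "r \<in> \<Phi> ` W"
    then obtain w where w: "w \<in> W" "r = \<Phi> w" by blast
    have A: "fst (w j) \<in> polyF n t" and E: "snd (w j) \<in> polyF n (t - D)" if "j < J" for j
      using w(1) that by (auto simp: W_def PiE_def Pi_def mem_Times_iff)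
    have "overF n r" unfolding w(2) \<Phi>_def using A E f(1)
      by (intro overF_sum overF_mult overF_diff overF_power overF_monom) (auto simp: polyF_iff)
    moreover have "degree r < M"
      unfolding w(2) \<Phi>_def
    proof (rule degree_sum_less)
      fix j assume j: "j \<in> {..<J}"
      have dA: "degree (fst (w j) ^ Q) \<le> Q * (t - 1)"
      proof -
        have "degree (fst (w j) ^ Q) \<le> degree (fst (w j)) * Q" by (rule degree_power_le)
        also have "degree (fst (w j)) \<le> t - 1" using polyF_degree[OF A, of j] j t by simp
        finally show ?thesis by (simp add: mult.commute)
      qed
      have dE: "degree (snd (w j) ^ Q * f ^ (t + 1)) \<le> Q * (t - 1) + D"
      proof -
        have "degree (snd (w j)) \<le> t - D - 1" using polyF_degree[OF E, of j] j t by simp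
        hence "degree (snd (w j)) * Q \<le> Q * (t - D - 1)" by (simp add: mult.commute)
        hence "degree (snd (w j) ^ Q) \<le> Q * (t - D - 1)"
          using degree_power_le[of "snd (w j)" Q] by linarith
        thus ?thesis using degree_mult_le[of "snd (w j) ^ Q" "f ^ (t + 1)"] degf arith by linarith
      qed
      have "degree ((fst (w j) ^ Q - snd (w j) ^ Q * f ^ (t + 1)) * monom (1::'a) j) \<le> Q * (t - 1) + D + j"
      proof -
        have "degree (fst (w j) ^ Q - snd (w j) ^ Q * f ^ (t + 1)) \<le> Q * (t - 1) + D"
          using dA dE by (intro degree_diff_le) auto
        thus ?thesis
          using degree_mult_le[of "fst (w j) ^ Q - snd (w j) ^ Q * f ^ (t + 1)" "monom (1::'a) j"]
          by (simp add: degree_monom_eq)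
      qed
      also have "\<dots> < M" using j by (simp add: M_def)
      finally show "degree ((fst (w j) ^ Q - snd (w j) ^ Q * f ^ (t + 1)) * monom (1::'a) j) < M" .
    qed (simp add: M_def J)
    ultimately show "r \<in> polyF n M" by (intro polyF_I) (auto simp: overF_def)
  qed
  hence "card (\<Phi> ` W) \<le> q ^ M"
    using card_mono[OF polyF_card(2)[OF n], of "\<Phi> ` W" M] polyF_card(1)[OF n, of M, where ?'a = 'a]
    by (simp add: q_def)
  also have "\<dots> < q ^ (J * (2 * t - D))"
  proof (rule power_strict_increasing[OF _ q1])
    obtain u where u: "t = D + 3 + u" using t le_Suc_ex by blast
    \<comment> \<open>Here M = 2t^2 + 2D, and unknowns minus conditions equals 2t + D(t - D - 3).
      This is where t \<ge> D + 3 enters.\<close>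
    show "M < J * (2 * t - D)" by (simp add: u Qt J M_def algebra_simps)
  qed
  also have "\<dots> = card W"
  proof -
    have "card W = (q ^ t * q ^ (t - D)) ^ J"
      unfolding W_def q_def using polyF_card(1)[OF n, where ?'a = 'a]
      by (simp add: card_PiE card_cartesian_product)
    also have "q ^ t * q ^ (t - D) = q ^ (2 * t - D)" using t by (simp flip: power_add add: mult_2)
    finally have "card W = (q ^ (2 * t - D)) ^ J" .
    also have "\<dots> = q ^ (J * (2 * t - D))" by (simp only: power_mult[symmetric] mult.commute)
    finally show ?thesis by (rule sym)
  qed
  finally have "\<not> inj_on \<Phi> W" using card_image by fastforce
  then obtain v w where vw: "v \<in> W" "w \<in> W" "v \<noteq> w" "\<Phi> v = \<Phi> w" unfolding inj_on_def by blast
  show thesis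
  proof
    fix j assume j: "j < J"
    have "fst (v j) \<in> polyF n t" "snd (v j) \<in> polyF n (t - D)" "fst (w j) \<in> polyF n t" "snd (w j) \<in> polyF n (t - D)"
      using vw(1,2) j by (auto simp: W_def PiE_def Pi_def mem_Times_iff)
    thus "degree (fst (v j) - fst (w j)) < t" "degree (snd (v j) - snd (w j)) < t - D"
      using t by (auto intro!: degree_diff_less intro: polyF_degree)
  next
    obtain j where j: "v j \<noteq> w j" using vw(3) by blast
    have "j < J"
    proof (rule ccontr)
      assume "\<not> j < J"
      hence "v j = undefined" "w j = undefined" using vw(1,2) by (auto simp: W_def PiE_def extensional_def)
      thus False using j by simp
    qed
    thus "\<exists>j<J. fst (v j) - fst (w j) \<noteq> 0 \<or> snd (v j) - snd (w j) \<noteq> 0"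
      using j by (auto simp: prod_eq_iff)
  next
    have *: "(r - s) ^ Q = r ^ Q - s ^ Q" for r s :: "'a poly"
      using frobenius_diff[of r s m] by (simp add: Q)
    have "(\<Sum>j<J. ((fst (v j) - fst (w j)) ^ Q - (snd (v j) - snd (w j)) ^ Q * f ^ (t + 1)) * monom 1 j) = \<Phi> v - \<Phi> w"
      unfolding \<Phi>_def * sum_subtractf[symmetric] by (intro sum.cong refl) (simp only: algebra_simps)
    thus "(\<Sum>j<J. ((fst (v j) - fst (w j)) ^ Q - (snd (v j) - snd (w j)) ^ Q * f ^ (t + 1)) * monom 1 j) = 0"
      using vw(4) by simp
  qed
qed

text \<open>The auxiliary polynomial vanishes at every point counted, and twice its degree is at
  most Q^2 + 4DQ. Simple zeros suffice: no higher multiplicity is gained, since the degree is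
  already about half the size of the field.\<close>

lemma stepanov_bound:
  fixes f :: "'a::{alg_closed_field,field_prime_char} poly"
  assumes Q: "Q = CHAR('a) ^ m" and m: "m > 0" and odd: "odd Q"
    and f: "overF (2 * m) f" "degree f = 2 * D" "coeff f 0 \<noteq> 0" "order x0 f = 1"
  shows "2 * card {x \<in> Fq (2 * m). poly f x ^ ((Q\<^sup>2 - 1) div 2) = -1} \<le> Q\<^sup>2 + (4 * D + 5) * Q"
proof -
  define S where "S = {x \<in> Fq (2 * m). poly f x ^ ((Q\<^sup>2 - 1) div 2) = -1}"
  obtain t where Qt: "Q = 2 * t + 1" using odd by (elim oddE)
  have Q2: "CHAR('a) ^ (2 * m) = Q\<^sup>2" unfolding Q by (rule power_even_eq)
  have cardF: "card (Fq (2 * m) :: 'a set) = Q\<^sup>2" "finite (Fq (2 * m) :: 'a set)"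
    using Fq_card[of "2 * m", where ?'a = 'a] m Q2 by auto
  have "S \<subseteq> Fq (2 * m)" by (auto simp: S_def)
  hence triv: "card S \<le> Q\<^sup>2" using cardF by (metis card_mono)
  show ?thesis
  proof (cases "t \<ge> D + 3")
    \<comment> \<open>For t \<le> D + 2 one has Q \<le> 2D + 5, and the trivial bound Q^2 is good
      enough. The constant 5 originates here.\<close>
    case False
    hence "Q \<le> 2 * D + 5" using Qt by simp
    hence "Q * Q \<le> (2 * D + 5) * Q" by (rule mult_right_mono) simp
    hence "Q\<^sup>2 \<le> (4 * D + 5) * Q" by (simp add: power2_eq_square algebra_simps)
    thus ?thesis using triv unfolding S_def by simp
  next
    case t: True
    define J where "J = t + 1 + D"
    obtain A E where AE: "\<And>j. j < J \<Longrightarrow> degree (A j) < t" "\<And>j. j < J \<Longrightarrow> degree (E j) < t - D"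
        "\<exists>j<J. A j \<noteq> 0 \<or> E j \<noteq> 0"
        "(\<Sum>j<J. (A j ^ Q - E j ^ Q * f ^ (t + 1)) * monom 1 j) = 0"
    proof -
      have "2 * m > 0" using m by simp
      from stepanov_auxiliary[OF this Q Qt f(1,2) t J_def] show thesis using that by blast
    qed
    define G where "G = (\<Sum>j<J. (A j + E j * f ^ (t + 1)) * monom 1 (j * Q))"
    have "G \<noteq> 0"
    proof
      assume "G = 0"
      have "2 * degree (A j) < Q" if "j < J" for j using AE(1)[OF that] Qt by simp
      moreover have "2 * degree (E j) + degree f < Q" if "j < J" for j using AE(2)[OF that] Qt f(2) by simp
      ultimately have "A j = 0 \<and> E j = 0" if "j < J" for j
        using stepanov_nonvanishing[OF Q f(3,4), of J A E "t + 1" j] \<open>G = 0\<close> that Qt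
        by (simp add: G_def)
      thus False using AE(3) by blast
    qed
    have "S \<subseteq> {x. poly G x = 0}"
    proof
      fix x assume x: "x \<in> S"
      have xQ: "x ^ Q\<^sup>2 = x" using x by (simp add: S_def Fq_iff Q2)
      \<comment> \<open>The exponent (t + 1)Q exceeds (Q^2 - 1)/2 by exactly t + 1. Hence the Q-th
        power only multiplies f(x)^(t + 1) by the quadratic character of f(x), which is -1 on
        S.\<close>
      have "(poly f x ^ (t + 1)) ^ Q = poly f x ^ ((Q\<^sup>2 - 1) div 2) * poly f x ^ (t + 1)"
      proof -
        have "(t + 1) * Q = (Q\<^sup>2 - 1) div 2 + (t + 1)" by (simp add: Qt power2_eq_square algebra_simps)
        thus ?thesis by (metis power_add power_mult)
      qed
      hence fx: "(poly f x ^ (t + 1)) ^ Q = - (poly f x ^ (t + 1))" using x by (simp add: S_def)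
      have "poly G x ^ Q = (\<Sum>j<J. ((poly (A j) x + poly (E j) x * poly f x ^ (t + 1)) * x ^ (j * Q)) ^ Q)"
        unfolding G_def Q by (simp add: poly_sum poly_monom frobenius_sum)
      also have "\<dots> = (\<Sum>j<J. (poly (A j) x ^ Q - poly (E j) x ^ Q * poly f x ^ (t + 1)) * x ^ j)"
      proof (intro sum.cong refl)
        fix j
        have "(x ^ (j * Q)) ^ Q = (x ^ Q\<^sup>2) ^ j"
          by (simp only: power2_eq_square power_mult[symmetric] mult_ac)
        hence x: "(x ^ (j * Q)) ^ Q = x ^ j" using xQ by simp
        have "(poly (A j) x + poly (E j) x * poly f x ^ (t + 1)) ^ Q
            = poly (A j) x ^ Q + poly (E j) x ^ Q * (poly f x ^ (t + 1)) ^ Q"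
          unfolding Q by (simp add: frobenius_add power_mult_distrib)
        thus "((poly (A j) x + poly (E j) x * poly f x ^ (t + 1)) * x ^ (j * Q)) ^ Q =
            (poly (A j) x ^ Q - poly (E j) x ^ Q * poly f x ^ (t + 1)) * x ^ j"
          by (simp only: power_mult_distrib[of _ "x ^ (j * Q)"] x fx) simp
      qed
      also have "\<dots> = poly (\<Sum>j<J. (A j ^ Q - E j ^ Q * f ^ (t + 1)) * monom 1 j) x"
        by (simp add: poly_sum poly_monom)
      also have "\<dots> = 0" by (simp only: AE(4) poly_0)
      finally show "x \<in> {x. poly G x = 0}" by simp
    qed
    hence "card S \<le> degree G"
      using card_mono[OF poly_roots_finite[OF \<open>G \<noteq> 0\<close>]] card_poly_roots_bound[OF \<open>G \<noteq> 0\<close>] le_trans by blast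
    also have "degree G \<le> (t + 2 * D) * Q + t"
      unfolding G_def
    proof (rule degree_sum_le)
      fix j assume j: "j \<in> {..<J}"
      have "degree (f ^ (t + 1)) \<le> (t + 1) * (2 * D)"
        using degree_power_le[of f "t + 1"] f(2) by (simp add: mult.commute)
      hence "degree (E j * f ^ (t + 1)) \<le> (t - D) + (t + 1) * (2 * D)"
        using degree_mult_le[of "E j" "f ^ (t + 1)"] AE(2)[of j] j by simp
      also have "(t - D) + (t + 1) * (2 * D) = D * Q + t" using t by (simp add: Qt algebra_simps)
      finally have "degree (E j * f ^ (t + 1)) \<le> D * Q + t" .
      moreover have "degree (A j) \<le> D * Q + t" using AE(1)[of j] j by simp
      ultimately have "degree (A j + E j * f ^ (t + 1)) \<le> D * Q + t" by (rule degree_add_le[rotated])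
      hence "degree ((A j + E j * f ^ (t + 1)) * monom 1 (j * Q)) \<le> D * Q + t + j * Q"
        using degree_mult_le[of "A j + E j * f ^ (t + 1)" "monom 1 (j * Q)"] by (simp add: degree_monom_eq)
      also have "j * Q \<le> (t + D) * Q" using j by (intro mult_right_mono) (auto simp: J_def)
      finally show "degree ((A j + E j * f ^ (t + 1)) * monom 1 (j * Q)) \<le> (t + 2 * D) * Q + t"
        by (simp add: algebra_simps)
    qed simp
    finally have "2 * card S \<le> 2 * ((t + 2 * D) * Q + t)" by simp
    also have "\<dots> \<le> Q\<^sup>2 + (4 * D + 5) * Q" by (simp add: Qt power2_eq_square algebra_simps)
    finally show ?thesis unfolding S_def .
  qed
qed

section \<open>Traces, Artin-Schreier fibres and the hyperelliptic curve\<close>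

definition frob_trace :: "nat \<Rightarrow> 'a::field_prime_char \<Rightarrow> 'a" where
  "frob_trace n z = (\<Sum>i<n. z ^ (CHAR('a) ^ i))"

lemma frob_trace_in_Fq:
  assumes "z \<in> Fq n"
  shows "frob_trace n z \<in> Fq 1"
proof -
  have "frob_trace n z ^ (CHAR('a) ^ 1) = (\<Sum>i<n. z ^ (CHAR('a) ^ Suc i))"
    unfolding frob_trace_def frobenius_sum by (simp only: power_mult[symmetric] power_one_right power_Suc2)
  also have "\<dots> = (\<Sum>i<n. z ^ (CHAR('a) ^ i))"
  proof (cases n)
    case (Suc k)
    have "(\<Sum>i<n. z ^ (CHAR('a) ^ Suc i)) = (\<Sum>i<k. z ^ (CHAR('a) ^ Suc i)) + z"
      using assms by (simp add: Suc Fq_iff)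
    thus ?thesis unfolding Suc sum.lessThan_Suc_shift by simp
  qed simp
  finally show ?thesis by (simp add: Fq_iff frob_trace_def)
qed

text \<open>The sum telescopes. For y in \<open>Fq n\<close> the result is 0, which is the easy
  direction of the additive form of Hilbert 90.\<close>

lemma frob_trace_artin_schreier:
  "frob_trace n (y ^ CHAR('a) - y) = y ^ (CHAR('a) ^ n) - (y :: 'a::field_prime_char)"
proof -
  have "frob_trace n (y ^ CHAR('a) - y) = (\<Sum>i<n. y ^ (CHAR('a) ^ Suc i) - y ^ (CHAR('a) ^ i))"
    by (simp add: frob_trace_def frobenius_diff flip: power_mult)
  also have "\<dots> = y ^ (CHAR('a) ^ n) - y ^ (CHAR('a) ^ 0)"
    by (rule sum_lessThan_telescope)
  finally show ?thesis by simp
qed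

lemma card_artin_schreier_fibre:
  "card {y :: 'a::{alg_closed_field,field_prime_char}. y ^ CHAR('a) - y = c} \<le> CHAR('a)"
  "finite {y :: 'a::{alg_closed_field,field_prime_char}. y ^ CHAR('a) - y = c}"
proof -
  define f where "f = monom 1 CHAR('a) - monom 1 1 + [:- c:]"
  have p: "CHAR('a) > 1" by (rule CHAR_gt_1)
  have deg: "degree f = CHAR('a)"
    unfolding f_def using degree_pow_minus_X[OF p, where ?'a = 'a] p by (subst degree_add_eq_left) auto
  have f0: "f \<noteq> 0" using deg p by auto
  have eq: "{y. y ^ CHAR('a) - y = c} = {y. poly f y = 0}" by (auto simp: f_def poly_monom)
  show "card {y. y ^ CHAR('a) - y = c} \<le> CHAR('a)"
    unfolding eq using card_poly_roots_bound[OF f0] deg by simp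
  show "finite {y. y ^ CHAR('a) - y = c}" unfolding eq using f0 by (rule poly_roots_finite)
qed

text \<open>The discriminant of x^2 - u x + a for u = y^p - y, in other words of the equation x +
  a/x = y^p - y in x.\<close>

definition hyper_poly :: "'a::field_prime_char \<Rightarrow> 'a poly" where
  "hyper_poly a = (monom 1 CHAR('a) - monom 1 1)\<^sup>2 - [:4 * a:]"

lemma poly_hyper_poly: "poly (hyper_poly a) y = (y ^ CHAR('a) - y)\<^sup>2 - 4 * (a :: 'a::field_prime_char)"
  by (simp add: hyper_poly_def poly_monom)

text \<open>The polynomial y^p - y has derivative -1, so the derivative of
  \<open>hyper_poly a\<close> is -2(y^p - y). At a root this is nonzero, because (y^p - y)^2 = 4a
  there. The simple root is what the nonvanishing part of Stepanov's method asks for.\<close>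

lemma hyper_poly_props:
  fixes a :: "'a::{alg_closed_field,field_prime_char}"
  assumes a: "a \<in> Fq 1" "a \<noteq> 0" and odd: "odd CHAR('a)"
  shows "overF n (hyper_poly a)" "degree (hyper_poly a) = 2 * CHAR('a)"
    "coeff (hyper_poly a) 0 \<noteq> 0" "\<exists>x. order x (hyper_poly a) = 1"
proof -
  have p: "CHAR('a) > 1" by (rule CHAR_gt_1)
  note two = two_neq_0_odd_char[OF odd]
  have four: "4 * a \<noteq> 0"
  proof -
    have eq: "4 * a = 2 * (2 * a)" by simp
    show ?thesis using two a(2) unfolding eq mult_eq_0_iff by blast
  qed
  show "overF n (hyper_poly a)"
    unfolding hyper_poly_def using Fq_dvd[OF _ a(1), of n]
    by (intro overF_diff overF_power overF_monom overF_pCons overF_0 Fq_mult Fq_numeral) auto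
  have deg: "degree (monom 1 CHAR('a) - monom 1 1 :: 'a poly) = CHAR('a)"
    by (rule degree_pow_minus_X[OF p])
  hence "degree ((monom 1 CHAR('a) - monom 1 1 :: 'a poly)\<^sup>2) = 2 * CHAR('a)"
    using p by (subst degree_power_eq) auto
  thus "degree (hyper_poly a) = 2 * CHAR('a)"
    unfolding hyper_poly_def diff_conv_add_uminus using p by (subst degree_add_eq_left) auto
  show "coeff (hyper_poly a) 0 \<noteq> 0"
    using four p poly_hyper_poly[of a 0] by (simp add: poly_0_coeff_0 power_0_left)
  obtain b where b: "b\<^sup>2 = 4 * a" using nth_root_exists[of 2 "4 * a"] by auto
  have b0: "b \<noteq> 0" using b four by auto
  define f where "f = monom 1 CHAR('a) - monom 1 1 + [:- b:]"
  have "degree f = CHAR('a)"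
    unfolding f_def using deg p by (subst degree_add_eq_left) auto
  then obtain x where "poly f x = 0" using alg_closed_imp_poly_has_root[of f] p by auto
  hence x: "x ^ CHAR('a) - x = b" by (simp add: f_def poly_monom)
  have "poly (hyper_poly a) x = 0" by (simp add: poly_hyper_poly x b)
  moreover have "poly (pderiv (hyper_poly a)) x = - 2 * b"
  proof -
    have "pderiv (monom 1 CHAR('a) - monom 1 1 :: 'a poly) = -1"
      by (simp add: pderiv_diff pderiv_monom one_pCons monom_0)
    hence "pderiv (hyper_poly a) = (monom 1 CHAR('a) - monom 1 1) * (-1) + (monom 1 CHAR('a) - monom 1 1) * (-1)"
      by (simp only: hyper_poly_def pderiv_diff power2_eq_square pderiv_mult pderiv_pCons) simp
    from arg_cong[OF this, of "\<lambda>r. poly r x"]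
    have "poly (pderiv (hyper_poly a)) x = (x ^ CHAR('a) - x) * (-1) + (x ^ CHAR('a) - x) * (-1)"
      by (simp only: poly_add poly_mult poly_diff poly_monom poly_minus poly_1 power_one_right mult_1)
    thus ?thesis unfolding x by simp
  qed
  ultimately show "\<exists>x. order x (hyper_poly a) = 1" using two b0 by (intro exI[of _ x] order_eq_1) auto
qed

definition kloosterman_zeros :: "nat \<Rightarrow> 'a::field_prime_char \<Rightarrow> 'a set" where
  "kloosterman_zeros n a = {x \<in> Fq n. x \<noteq> 0 \<and> frob_trace n (x + a / x) = 0}"

text \<open>If the discriminant at y is a nonzero square, the quadratic formula gives two values x
  with x + a/x = y^p - y, and the right side has trace 0. Conversely, a given x comes from at most p
  values of y.\<close>

lemma kloosterman_zeros_ge: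
  fixes a :: "'a::{alg_closed_field,field_prime_char}"
  assumes n: "n > 0" and a: "a \<in> Fq n" "a \<noteq> 0" and odd: "odd CHAR('a)"
  shows "2 * card {y \<in> Fq n. poly (hyper_poly a) y ^ ((CHAR('a) ^ n - 1) div 2) = 1}
           \<le> CHAR('a) * card (kloosterman_zeros n a)"
proof -
  define q where "q = CHAR('a) ^ n"
  define Y where "Y = {y \<in> Fq n. poly (hyper_poly a) y ^ ((q - 1) div 2) = 1}"
  have finF: "finite (Fq n :: 'a set)" by (rule Fq_card(2)[OF n])
  have finY: "finite Y" using finF by (simp add: Y_def)
  have p: "CHAR('a) > 1" by (rule CHAR_gt_1)
  note two = two_neq_0_odd_char[OF odd]
  have oddq: "odd q" unfolding q_def using odd by simp
  have q1: "q > 1" unfolding q_def by (rule one_less_power[OF p n])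
  have "\<forall>y\<in>Y. \<exists>w. w \<in> Fq n \<and> w \<noteq> 0 \<and> w\<^sup>2 = poly (hyper_poly a) y"
  proof
    fix y assume y: "y \<in> Y"
    obtain w where w: "w\<^sup>2 = poly (hyper_poly a) y" using nth_root_exists[of 2] by auto
    \<comment> \<open>Euler's criterion: w^(q - 1) is the power of the discriminant that equals 1,
      so the square root, taken in the closure, lies in \<open>Fq n\<close>.\<close>
    have "w ^ q = w * (w\<^sup>2) ^ ((q - 1) div 2)"
    proof -
      have "q = Suc (2 * ((q - 1) div 2))" using oddq by presburger
      hence "w ^ q = w ^ Suc (2 * ((q - 1) div 2))" by simp
      thus ?thesis by (simp add: power_mult)
    qed
    hence wF: "w ^ q = w" and D1: "poly (hyper_poly a) y ^ ((q - 1) div 2) = 1"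
      using y by (simp_all add: w Y_def)
    have "w \<noteq> 0"
    proof
      assume "w = 0"
      hence "poly (hyper_poly a) y = 0" using w by simp
      hence "(0::'a) ^ ((q - 1) div 2) = 1" using D1 by simp
      moreover have "(q - 1) div 2 > 0" using q1 oddq by presburger
      ultimately show False by (simp add: power_0_left)
    qed
    thus "\<exists>w. w \<in> Fq n \<and> w \<noteq> 0 \<and> w\<^sup>2 = poly (hyper_poly a) y"
      using w wF by (auto simp: Fq_iff q_def)
  qed
  from bchoice[OF this] obtain w
    where w': "\<forall>y\<in>Y. w y \<in> Fq n \<and> w y \<noteq> 0 \<and> (w y)\<^sup>2 = poly (hyper_poly a) y" ..
  hence w: "w y \<in> Fq n \<and> w y \<noteq> 0 \<and> (w y)\<^sup>2 = poly (hyper_poly a) y" if "y \<in> Y" for y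
    using that by blast
  define sol where "sol = (\<lambda>y s. (y ^ CHAR('a) - y + s * w y) / 2)"
  define P where "P = Sigma Y (\<lambda>y. {sol y 1, sol y (-1)})"
  have "card P = (\<Sum>y\<in>Y. card {sol y 1, sol y (-1)})"
    unfolding P_def using finY by simp
  also have "\<dots> = (\<Sum>y\<in>Y. 2)"
  proof (intro sum.cong refl)
    fix y assume "y \<in> Y"
    hence "sol y 1 \<noteq> sol y (-1)"
    proof -
      have "sol y 1 - sol y (-1) = (2 * w y) / 2"
        by (simp only: sol_def diff_divide_distrib[symmetric]) (simp add: algebra_simps)
      hence "sol y 1 - sol y (-1) = w y" using two by simp
      thus ?thesis using w[OF \<open>y \<in> Y\<close>] by auto
    qed
    thus "card {sol y 1, sol y (-1)} = 2" by simp
  qed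
  finally have cardP: "card P = 2 * card Y" by simp
  have PX: "P \<subseteq> (\<Union>x\<in>kloosterman_zeros n a. (\<lambda>y. (y, x)) ` {y. y ^ CHAR('a) - y = x + a / x})"
  proof
    fix z assume "z \<in> P"
    then obtain y s where y: "y \<in> Y" and s: "s = 1 \<or> s = -1" and z: "z = (y, sol y s)"
      unfolding P_def by blast
    define x where "x = sol y s"
    define u where "u = y ^ CHAR('a) - y"
    have s2: "s * s = 1" using s by auto
    have ww: "w y * w y = u * u - 4 * a"
      using w[OF y] by (simp add: power2_eq_square poly_hyper_poly u_def)
    have "2 * x = u + s * w y" using two by (simp add: x_def sol_def u_def)
    hence "(2 * x - u) * (2 * x - u) = (s * s) * (w y * w y)" by (simp add: mult_ac)
    hence "4 * (x * x) - 4 * (u * x) + u * u = u * u - 4 * a" unfolding s2 ww by (simp add: algebra_simps)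
    hence "2 * (2 * (x * x - u * x + a)) = 0" by (simp add: algebra_simps)
    hence eq: "x * x - u * x + a = 0" using two unfolding mult_eq_0_iff by blast
    have x0: "x \<noteq> 0" using eq a by auto
    have yF: "y \<in> Fq n" using y by (simp add: Y_def)
    hence uF: "u \<in> Fq n" unfolding u_def by (intro Fq_diff Fq_power)
    have "s \<in> Fq n" using s by (auto intro: Fq_uminus)
    hence xF: "x \<in> Fq n" unfolding x_def sol_def using w[OF y] yF uF
      by (intro Fq_divide Fq_add Fq_mult Fq_numeral) (auto simp: u_def)
    have "u * x = x * x + a" using eq by (simp add: algebra_simps)
    hence u: "u = x + a / x" using x0 by (simp add: field_simps)
    have "frob_trace n u = 0"
      unfolding u_def using frob_trace_artin_schreier[of n y] yF by (simp add: Fq_iff)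
    hence "x \<in> kloosterman_zeros n a" using xF x0 u by (simp add: kloosterman_zeros_def)
    moreover have "z \<in> (\<lambda>y. (y, x)) ` {y. y ^ CHAR('a) - y = x + a / x}"
      using u by (auto simp: z x_def u_def)
    ultimately show "z \<in> (\<Union>x\<in>kloosterman_zeros n a. (\<lambda>y. (y, x)) ` {y. y ^ CHAR('a) - y = x + a / x})"
      by blast
  qed
  have finX: "finite (kloosterman_zeros n a)" using finF by (simp add: kloosterman_zeros_def)
  have "card P \<le> card (\<Union>x\<in>kloosterman_zeros n a. (\<lambda>y. (y, x)) ` {y. y ^ CHAR('a) - y = x + a / x})"
    by (rule card_mono[OF _ PX]) (use finX card_artin_schreier_fibre(2) in auto)
  also have "\<dots> \<le> (\<Sum>x\<in>kloosterman_zeros n a. card ((\<lambda>y. (y, x)) ` {y. y ^ CHAR('a) - y = x + a / x}))"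
    by (rule card_UN_le[OF finX])
  also have "\<dots> \<le> (\<Sum>x\<in>kloosterman_zeros n a. CHAR('a))"
  proof (rule sum_mono)
    fix x :: 'a
    show "card ((\<lambda>y. (y, x)) ` {y. y ^ CHAR('a) - y = x + a / x}) \<le> CHAR('a)"
      using card_image_le[OF card_artin_schreier_fibre(2)] card_artin_schreier_fibre(1) by (rule le_trans)
  qed
  finally have "card P \<le> card (kloosterman_zeros n a) * CHAR('a)" by simp
  thus ?thesis using cardP by (simp add: Y_def q_def mult.commute)
qed

text \<open>The field splits into zeros, squares and non-squares of the discriminant. Stepanov's
  upper bound for the non-squares, with D = p, leaves at least about half of the field for the
  squares. The at most 2p zeros cost 4p \<le> 4pQ after doubling, which raises 4p + 5 to 8p +
  5.\<close>

lemma kloosterman_zeros_lower_bound: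
  fixes a :: "'a::{alg_closed_field,field_prime_char}"
  assumes m: "m > 0" and a: "a \<in> Fq 1" "a \<noteq> 0" and odd: "odd CHAR('a)"
  shows "CHAR('a) ^ (2 * m) \<le> CHAR('a) * card (kloosterman_zeros (2 * m) a) + (8 * CHAR('a) + 5) * CHAR('a) ^ m"
proof -
  define p where "p = CHAR('a)"
  define Q where "Q = p ^ m"
  define D where "D = hyper_poly a"
  have p: "p > 1" unfolding p_def by (rule CHAR_gt_1)
  have Q2: "p ^ (2 * m) = Q\<^sup>2" unfolding Q_def by (rule power_even_eq)
  have Q1: "Q \<ge> 1" using p by (simp add: Q_def)
  have oddQ: "odd Q" using odd by (simp add: Q_def p_def)
  have oddq: "odd (Q\<^sup>2)" using oddQ by simp
  have n: "2 * m > 0" using m by simp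
  have aF: "a \<in> Fq (2 * m)" using Fq_dvd[OF _ a(1)] by simp
  define e where "e = (Q\<^sup>2 - 1) div 2"
  define N where "N = (\<lambda>c. {y \<in> Fq (2 * m). poly D y ^ e = c})"
  define N0 where "N0 = {y \<in> Fq (2 * m). poly D y = 0}"
  obtain x0 where x0: "order x0 D = 1" using hyper_poly_props(4)[OF a odd] by (auto simp: D_def)
  note D = hyper_poly_props(1-3)[OF a odd, folded D_def]
  have D0: "D \<noteq> 0" using D(3) by auto
  have fin: "finite (Fq (2 * m) :: 'a set)" by (rule Fq_card(2)[OF n])
  have minus: "2 * card (N (-1)) \<le> Q\<^sup>2 + (4 * p + 5) * Q"
    unfolding N_def e_def p_def[symmetric]
    using stepanov_bound[of Q m D p x0] m oddQ D x0 by (simp add: Q_def p_def)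
  have plus: "2 * card (N 1) \<le> p * card (kloosterman_zeros (2 * m) a)"
    using kloosterman_zeros_ge[OF n aF a(2) odd] Q2 by (simp add: N_def D_def e_def p_def)
  have "card N0 \<le> card {y. poly D y = 0}"
    using poly_roots_finite[OF D0] by (intro card_mono) (auto simp: N0_def)
  hence zero: "card N0 \<le> 2 * p" using card_poly_roots_bound[OF D0] D(2) by (simp add: p_def)
  have "Fq (2 * m) \<subseteq> N0 \<union> (N 1 \<union> N (-1))"
  proof
    fix y :: 'a assume y: "y \<in> Fq (2 * m)"
    have "poly D y \<in> Fq (2 * m)"
      unfolding D_def poly_hyper_poly using y aF by (intro Fq_diff Fq_power Fq_mult Fq_numeral)
    hence "poly D y ^ (Q\<^sup>2) = poly D y" using Q2 by (simp add: Fq_iff p_def)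
    also have "Q\<^sup>2 = Suc (e * 2)" using oddq unfolding e_def by presburger
    finally have "poly D y * ((poly D y ^ e)\<^sup>2 - 1) = 0"
      by (simp add: power_mult algebra_simps)
    hence "poly D y = 0 \<or> (poly D y ^ e)\<^sup>2 = 1" by simp
    hence "poly D y = 0 \<or> poly D y ^ e = 1 \<or> poly D y ^ e = -1" by (simp add: power2_eq_1_iff)
    thus "y \<in> N0 \<union> (N 1 \<union> N (-1))" using y by (auto simp: N0_def N_def)
  qed
  hence "card (Fq (2 * m) :: 'a set) \<le> card (N0 \<union> (N 1 \<union> N (-1)))"
    using fin by (intro card_mono) (auto simp: N0_def N_def)
  also have "\<dots> \<le> card N0 + (card (N 1) + card (N (-1)))"
    by (meson add_left_mono card_Un_le le_trans)
  finally have "Q\<^sup>2 \<le> card N0 + (card (N 1) + card (N (-1)))"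
    using Fq_card(1)[OF n, where ?'a = 'a] Q2 by (simp add: p_def)
  hence "2 * Q\<^sup>2 \<le> 4 * p + p * card (kloosterman_zeros (2 * m) a) + Q\<^sup>2 + (4 * p + 5) * Q"
    using minus plus zero by linarith
  moreover have "4 * p \<le> 4 * p * Q" using mult_le_mono2[OF Q1, of "4 * p"] by simp
  moreover have "(4 * p + 5) * Q = 4 * p * Q + 5 * Q" "(8 * p + 5) * Q = 4 * p * Q + 4 * p * Q + 5 * Q"
    by (simp_all add: algebra_simps)
  ultimately have "Q\<^sup>2 \<le> p * card (kloosterman_zeros (2 * m) a) + (8 * p + 5) * Q" by linarith
  thus ?thesis using Q2 by (simp add: p_def Q_def)
qed

section \<open>Norm forms of the elements of finite fields\<close>

definition frob_poly :: "'a::field_prime_char poly \<Rightarrow> 'a poly" where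
  "frob_poly f = map_poly (\<lambda>c. c ^ CHAR('a)) f"

lemma coeff_frob_poly: "coeff (frob_poly f) i = coeff f i ^ CHAR('a)"
  for f :: "'a::field_prime_char poly"
  by (simp add: frob_poly_def coeff_map_poly power_0_left)

lemma overF_1_iff: "overF 1 f \<longleftrightarrow> frob_poly f = f"
  by (auto simp: overF_def Fq_iff poly_eq_iff coeff_frob_poly)

lemma frob_poly_mult: "frob_poly (f * g) = frob_poly f * frob_poly g"
  for f :: "'a::field_prime_char poly"
proof (rule poly_eqI)
  fix i
  show "coeff (frob_poly (f * g)) i = coeff (frob_poly f * frob_poly g) i"
    using frobenius_sum[of "\<lambda>j. coeff f j * coeff g (i - j)" "{..i}" 1]
    by (simp add: coeff_frob_poly coeff_mult power_mult_distrib)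
qed

lemma frob_poly_1: "frob_poly 1 = 1"
  by (rule poly_eqI) (simp add: coeff_frob_poly power_0_left)

lemma frob_poly_power: "frob_poly (f ^ k) = frob_poly f ^ k"
  by (induction k) (simp_all add: frob_poly_1 frob_poly_mult)

lemma frob_poly_prod: "frob_poly (prod f A) = (\<Prod>i\<in>A. frob_poly (f i))"
  by (induction A rule: infinite_finite_induct) (simp_all add: frob_poly_1 frob_poly_mult)

lemma frob_poly_linear: "frob_poly [:- y, 1:] = [:- (y ^ CHAR('a)), 1:]" for y :: "'a::field_prime_char"
proof (rule poly_eqI)
  fix i show "coeff (frob_poly [:- y, 1:]) i = coeff [:- (y ^ CHAR('a)), 1:] i"
    using frobenius_uminus[of y 1]
    by (cases i; cases "i - 1") (simp_all add: coeff_frob_poly coeff_pCons power_0_left split: nat.splits)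
qed

lemma overF_quotient:
  assumes "overF 1 (f * g)" "overF 1 f" "f \<noteq> 0"
  shows "overF 1 g"
proof -
  have "f * frob_poly g = f * g" using assms unfolding overF_1_iff frob_poly_mult by simp
  thus ?thesis using assms(3) unfolding overF_1_iff by simp
qed

text \<open>Applying Frobenius to the coefficients fixes f and carries a factor (X - x)^i to (X -
  x^p)^i.\<close>

lemma order_frobenius:
  assumes "overF 1 f" "f \<noteq> 0"
  shows "order x f \<le> order (x ^ CHAR('a)) (f :: 'a::field_prime_char poly)"
proof -
  obtain g where g: "f = [:- x, 1:] ^ order x f * g" using order_1[of x f] by (elim dvdE)
  have "f = frob_poly f" using assms unfolding overF_1_iff by simp
  also have "\<dots> = [:- (x ^ CHAR('a)), 1:] ^ order x f * frob_poly g"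
    by (subst g) (simp only: frob_poly_mult frob_poly_power frob_poly_linear)
  finally have "[:- (x ^ CHAR('a)), 1:] ^ order x f dvd f" by (rule dvdI)
  thus ?thesis using assms(2) by (simp add: order_divides)
qed

lemma order_frobenius_iterate:
  assumes "overF 1 f" "f \<noteq> 0"
  shows "order x f \<le> order (x ^ (CHAR('a) ^ j)) (f :: 'a::field_prime_char poly)"
proof (induction j)
  case (Suc j)
  have "order (x ^ (CHAR('a) ^ j)) f \<le> order ((x ^ (CHAR('a) ^ j)) ^ CHAR('a)) f"
    by (rule order_frobenius[OF assms])
  thus ?case using Suc by (simp add: power_mult[symmetric] power_Suc2 del: power_Suc)
qed simp

lemma prod_linear_powers_dvd:
  fixes f :: "'a::field poly"
  assumes "finite Y" "f \<noteq> 0" "\<And>y. y \<in> Y \<Longrightarrow> i \<le> order y f"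
  shows "(\<Prod>y\<in>Y. [:- y, 1:] ^ i) dvd f"
  using assms
proof (induction Y rule: finite_induct)
  case (insert y Y)
  define h where "h = (\<Prod>z\<in>Y. [:- z, 1:] ^ i)"
  have "h dvd f" using insert by (auto simp: h_def)
  then obtain g where g: "f = h * g" by (elim dvdE)
  have "poly h y \<noteq> 0" using insert.hyps by (auto simp: h_def poly_prod)
  hence "order y h = 0" by (rule order_0I)
  hence "order y f = order y g" using g insert.prems(1) by (simp add: order_mult)
  moreover have "i \<le> order y f" using insert.prems(2) by simp
  ultimately have "[:- y, 1:] ^ i dvd g" by (simp add: order_divides)
  hence "h * [:- y, 1:] ^ i dvd h * g" by (rule mult_dvd_mono[OF dvd_refl])
  thus ?case using insert.hyps by (simp add: g h_def mult.commute)
qed simp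

text \<open>For x in \<open>Fq k\<close> this is the characteristic polynomial over the prime field
  of multiplication by x on the field with p^k elements, so a power of the minimal polynomial of
  x.\<close>

definition conj_poly :: "nat \<Rightarrow> 'a::field_prime_char \<Rightarrow> 'a poly" where
  "conj_poly k x = (\<Prod>i<k. [:- (x ^ (CHAR('a) ^ i)), 1:])"

lemma conj_poly_nz: "conj_poly k x \<noteq> 0"
  by (simp add: conj_poly_def)

lemma degree_conj_poly: "degree (conj_poly k x) = k"
  unfolding conj_poly_def by (subst degree_prod_eq_sum_degree) auto

lemma lead_coeff_conj_poly: "lead_coeff (conj_poly k x) = 1"
  by (simp add: conj_poly_def lead_coeff_prod)

lemma conj_poly_Suc: "conj_poly (Suc k) x = [:- x, 1:] * conj_poly k (x ^ CHAR('a))"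
  for x :: "'a::field_prime_char"
  unfolding conj_poly_def prod.lessThan_Suc_shift by (simp add: power_mult del: mult_pCons_left)

lemma conj_poly_add: "conj_poly (k + l) x = conj_poly k x * conj_poly l (x ^ (CHAR('a) ^ k))"
  for x :: "'a::field_prime_char"
proof (induction k arbitrary: x)
  case (Suc k)
  show ?case by (simp add: conj_poly_Suc Suc power_mult mult.assoc del: mult_pCons_left)
qed (simp add: conj_poly_def)

text \<open>In \<open>conj_poly (Suc k) x\<close> one may split off the first factor X - x or the
  last factor X - x^(p^k), and these agree. Cancelling them shows invariance under
  Frobenius.\<close>

lemma conj_poly_overF:
  assumes "x \<in> Fq k"
  shows "overF 1 (conj_poly k (x :: 'a::field_prime_char))"
proof -
  have "frob_poly (conj_poly k x) = conj_poly k (x ^ CHAR('a))"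
    unfolding conj_poly_def frob_poly_prod frob_poly_linear
    by (simp only: power_mult[symmetric] mult.commute)
  also have "[:- x, 1:] * \<dots> = conj_poly k x * [:- x, 1:]"
    using conj_poly_add[of k 1 x] assms unfolding conj_poly_Suc[symmetric]
    by (simp add: conj_poly_def Fq_iff del: mult_pCons_left mult_pCons_right prod.lessThan_Suc)
  finally have "[:- x, 1:] * frob_poly (conj_poly k x) = [:- x, 1:] * conj_poly k x"
    by (simp only: mult.commute)
  thus ?thesis unfolding overF_1_iff by (subst (asm) mult_left_cancel) auto
qed

lemma conj_poly_multiple:
  assumes "x \<in> Fq e"
  shows "conj_poly (e * i) x = conj_poly e (x :: 'a::field_prime_char) ^ i"
proof (induction i)
  case (Suc i)
  have "conj_poly (e * Suc i) x = conj_poly e x * conj_poly (e * i) (x ^ (CHAR('a) ^ e))"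
    by (simp add: conj_poly_add)
  thus ?case using Suc assms by (simp add: Fq_iff)
qed (simp add: conj_poly_def)

text \<open>The Frobenius orbit of x stays inside the finite set of roots and must repeat;
  injectivity of Frobenius moves the repetition back to x itself.\<close>

lemma root_in_some_Fq:
  fixes x :: "'a::field_prime_char"
  assumes f: "overF 1 f" "f \<noteq> 0" and x: "poly f x = 0"
  shows "\<exists>e>0. x \<in> Fq e"
proof -
  have root: "poly f (x ^ (CHAR('a) ^ j)) = 0" for j
    using order_frobenius_iterate[OF f, of x j] x f(2) by (metis le_zero_eq order_root)
  have "range (\<lambda>j. x ^ (CHAR('a) ^ j)) \<subseteq> {y. poly f y = 0}" using root by auto
  hence "finite (range (\<lambda>j. x ^ (CHAR('a) ^ j)))"
    using poly_roots_finite[OF f(2)] by (rule finite_subset)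
  hence "\<not> inj (\<lambda>j::nat. x ^ (CHAR('a) ^ j))" using finite_imageD by blast
  then obtain j l where "j \<noteq> l" "x ^ (CHAR('a) ^ j) = x ^ (CHAR('a) ^ l)" unfolding inj_on_def by blast
  then obtain j l where jl: "j < l" "x ^ (CHAR('a) ^ j) = x ^ (CHAR('a) ^ l)"
    by (metis linorder_neqE_nat)
  have "x ^ (CHAR('a) ^ l) = (x ^ (CHAR('a) ^ (l - j))) ^ (CHAR('a) ^ j)"
    using jl(1) by (simp flip: power_mult power_add)
  hence "x = x ^ (CHAR('a) ^ (l - j))" using jl(2) frobenius_inj by metis
  thus ?thesis using jl(1) by (intro exI[of _ "l - j"]) (simp add: Fq_iff)
qed

text \<open>Let e be the degree of x over the prime field. Then x lies in \<open>Fq k\<close>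
  exactly when k = e i, and \<open>conj_poly k x\<close> is the i-th power of the minimal
  polynomial. It divides f exactly for i up to the multiplicity of x, so each unit of multiplicity
  contributes one k.\<close>

lemma card_conj_poly_dvd:
  fixes f :: "'a::field_prime_char poly"
  assumes f: "overF 1 f" "f \<noteq> 0" and x: "poly f x = 0"
  shows "card {k \<in> {1..degree f}. x \<in> Fq k \<and> conj_poly k x dvd f} = order x f"
proof -
  define e where "e = (LEAST e. e > 0 \<and> x \<in> Fq e)"
  have e: "e > 0" "x \<in> Fq e"
    using LeastI_ex[of "\<lambda>e. e > 0 \<and> x \<in> Fq e"] root_in_some_Fq[OF assms] by (auto simp: e_def)
  have emin: "e \<le> k" if "k > 0" "x \<in> Fq k" for k
    unfolding e_def using that by (intro Least_le) simp
  have Fq_e: "x \<in> Fq k \<longleftrightarrow> e dvd k" for k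
  proof
    assume k: "x \<in> Fq k"
    have "x \<in> Fq (e * (k div e))" by (rule Fq_dvd[OF _ e(2)]) simp
    hence "x ^ (CHAR('a) ^ (e * (k div e))) = x" by (simp add: Fq_iff)
    hence "x ^ (CHAR('a) ^ (e * (k div e) + k mod e)) = x ^ (CHAR('a) ^ (k mod e))"
      by (simp only: power_add power_mult)
    hence "x \<in> Fq (k mod e)" using k by (simp add: Fq_iff)
    hence "\<not> k mod e > 0" using emin[of "k mod e"] e(1) mod_less_divisor[of e k] by linarith
    thus "e dvd k" by (simp add: dvd_eq_mod_eq_0)
  qed (use Fq_dvd e in blast)
  have inj: "inj_on (\<lambda>j. x ^ (CHAR('a) ^ j)) {..<e}"
  proof (rule linorder_inj_onI)
    fix j l assume jl: "j < l" "j \<in> {..<e}" "l \<in> {..<e}"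
    have eq: "x ^ (CHAR('a) ^ l) = (x ^ (CHAR('a) ^ (l - j))) ^ (CHAR('a) ^ j)"
      using jl(1) by (simp flip: power_mult power_add)
    show "x ^ (CHAR('a) ^ j) \<noteq> x ^ (CHAR('a) ^ l)"
    proof
      assume "x ^ (CHAR('a) ^ j) = x ^ (CHAR('a) ^ l)"
      hence "x = x ^ (CHAR('a) ^ (l - j))" unfolding eq frobenius_inj .
      hence "x \<in> Fq (l - j)" by (simp add: Fq_iff)
      thus False using emin[of "l - j"] jl by auto
    qed
  qed auto
  have dvd_iff: "conj_poly (e * i) x dvd f \<longleftrightarrow> i \<le> order x f" for i
  proof
    assume d: "conj_poly (e * i) x dvd f"
    obtain e' where e': "e = Suc e'" using e(1) gr0_implies_Suc by blast
    have "[:- x, 1:] ^ i dvd conj_poly e x ^ i"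
      unfolding e' conj_poly_Suc by (intro dvd_power_same dvd_triv_left)
    hence "[:- x, 1:] ^ i dvd f" using d conj_poly_multiple[OF e(2)] by (metis dvd_trans)
    thus "i \<le> order x f" using f(2) by (simp add: order_divides)
  next
    assume i: "i \<le> order x f"
    define Y where "Y = (\<lambda>j. x ^ (CHAR('a) ^ j)) ` {..<e}"
    have "conj_poly (e * i) x = (\<Prod>j<e. [:- (x ^ (CHAR('a) ^ j)), 1:] ^ i)"
      unfolding conj_poly_multiple[OF e(2)] unfolding conj_poly_def by (rule prod_power_distrib)
    also have "\<dots> = (\<Prod>y\<in>Y. [:- y, 1:] ^ i)"
      unfolding Y_def by (subst prod.reindex[OF inj]) simp
    also have "\<dots> dvd f"
    proof (rule prod_linear_powers_dvd[OF _ f(2)])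
      fix y assume "y \<in> Y"
      then obtain j where "y = x ^ (CHAR('a) ^ j)" by (auto simp: Y_def)
      thus "i \<le> order y f" using order_frobenius_iterate[OF f, of x j] i by simp
    qed (simp add: Y_def)
    finally show "conj_poly (e * i) x dvd f" .
  qed
  have "{k \<in> {1..degree f}. x \<in> Fq k \<and> conj_poly k x dvd f} = (\<lambda>i. e * i) ` {1..order x f}"
  proof (intro equalityI subsetI)
    fix k assume k: "k \<in> {k \<in> {1..degree f}. x \<in> Fq k \<and> conj_poly k x dvd f}"
    then obtain i where i: "k = e * i" using Fq_e by (auto elim: dvdE)
    have "i \<le> order x f" using k dvd_iff i by simp
    moreover have "i \<ge> 1" using k i by (cases i) auto
    ultimately show "k \<in> (\<lambda>i. e * i) ` {1..order x f}" using i by auto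
  next
    fix k assume "k \<in> (\<lambda>i. e * i) ` {1..order x f}"
    then obtain i where "k = e * i" "i \<in> {1..order x f}" by blast
    hence i: "k = e * i" "i \<ge> 1" "i \<le> order x f" by auto
    have d: "conj_poly k x dvd f" using dvd_iff i by simp
    hence "k \<le> degree f" using dvd_imp_degree_le[OF d f(2)] by (simp add: degree_conj_poly)
    moreover have "k \<ge> 1" using i e(1) by simp
    moreover have "x \<in> Fq k" using Fq_e i by simp
    ultimately show "k \<in> {k \<in> {1..degree f}. x \<in> Fq k \<and> conj_poly k x dvd f}" using d by simp
  qed
  also have "card \<dots> = order x f"
    using e(1) by (subst card_image) (auto simp: inj_on_def)
  finally show ?thesis .
qed

text \<open>Summation over the roots yields their total multiplicity. This is the polynomial
  analogue of the identity that the von Mangoldt function sums to log n over the divisors of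
  n.\<close>

lemma card_conj_poly_dvd_total:
  fixes f :: "'a::{alg_closed_field,field_prime_char} poly"
  assumes f: "overF 1 f" "coeff f 0 \<noteq> 0"
  shows "card {z \<in> (SIGMA k:{1..degree f}. Fq k - {0}). conj_poly (fst z) (snd z) dvd f} = degree f"
proof -
  have f0: "f \<noteq> 0" using f(2) by auto
  define R where "R = {x. poly f x = 0}"
  have finR: "finite R" unfolding R_def by (rule poly_roots_finite[OF f0])
  let ?K = "\<lambda>x. {k \<in> {1..degree f}. x \<in> Fq k \<and> conj_poly k x dvd f}"
  have "{z \<in> (SIGMA k:{1..degree f}. Fq k - {0}). conj_poly (fst z) (snd z) dvd f}
      = (\<lambda>(x, k). (k, x)) ` Sigma R ?K"
  proof (intro equalityI subsetI)
    fix z assume "z \<in> {z \<in> (SIGMA k:{1..degree f}. Fq k - {0}). conj_poly (fst z) (snd z) dvd f}"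
    then obtain k x where z: "z = (k, x)" "k \<in> {1..degree f}" "x \<in> Fq k" "conj_poly k x dvd f" by auto
    obtain k' where k': "k = Suc k'" using z(2) by (cases k) auto
    have "[:- x, 1:] dvd conj_poly k x" unfolding k' conj_poly_Suc by (rule dvd_triv_left)
    hence "[:- x, 1:] dvd f" using z(4) by (rule dvd_trans)
    hence "x \<in> R" by (simp add: R_def poly_eq_0_iff_dvd)
    thus "z \<in> (\<lambda>(x, k). (k, x)) ` Sigma R ?K" using z by auto
  next
    fix z assume "z \<in> (\<lambda>(x, k). (k, x)) ` Sigma R ?K"
    then obtain x k where z: "z = (k, x)" "x \<in> R" "k \<in> ?K x" by auto
    have "x \<noteq> 0" using z(2) f(2) by (auto simp: R_def poly_0_coeff_0)
    thus "z \<in> {z \<in> (SIGMA k:{1..degree f}. Fq k - {0}). conj_poly (fst z) (snd z) dvd f}"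
      using z by auto
  qed
  also have "card \<dots> = card (Sigma R ?K)" by (rule card_image) (auto simp: inj_on_def)
  also have "\<dots> = (\<Sum>x\<in>R. card (?K x))" using finR by simp
  also have "\<dots> = (\<Sum>x\<in>R. order x f)"
    by (intro sum.cong refl card_conj_poly_dvd f f0) (simp add: R_def)
  also have "\<dots> = degree f" unfolding R_def by (rule sum_order_alg_closed[OF f0])
  finally show ?thesis .
qed

section \<open>The L-function of a Kloosterman sum\<close>

text \<open>The character is a function on the whole closure but is constrained on the prime field
  only; larger fields enter through their trace.\<close>

locale prime_field_character =
  fixes \<psi> :: "'a::{alg_closed_field,field_prime_char} \<Rightarrow> complex"
  assumes psi_add: "x \<in> Fq 1 \<Longrightarrow> y \<in> Fq 1 \<Longrightarrow> \<psi> (x + y) = \<psi> x * \<psi> y"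
    and psi_0: "\<psi> 0 = 1"
    and psi_nontrivial: "\<exists>x\<in>Fq 1. \<psi> x \<noteq> 1"
begin

definition kloos :: "nat \<Rightarrow> 'a \<Rightarrow> complex" where
  "kloos n a = (\<Sum>x\<in>Fq n - {0}. \<psi> (frob_trace n (x + a / x)))"

text \<open>The nonzero constant coefficient mirrors the restriction x \<noteq> 0 in the Kloosterman
  sum.\<close>

definition monics :: "nat \<Rightarrow> 'a poly set" where
  "monics d = {f. overF 1 f \<and> degree f = d \<and> lead_coeff f = 1 \<and> coeff f 0 \<noteq> 0}"

text \<open>If \<open>f\<close> is monic with roots \<open>x\<^sub>i\<close>, then \<open>\<psi>\<close> is evaluated at \<open>\<Sum>x\<^sub>i + a \<Sum>1/x\<^sub>i\<close>. The reversed
  polynomial makes this correct also for \<open>f = 1\<close>.\<close>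

definition lam :: "'a \<Rightarrow> 'a poly \<Rightarrow> complex" where
  "lam a f = \<psi> (- coeff (reflect_poly f) 1 - a * (coeff f 1 / coeff f 0))"

text \<open>The coefficient of T^d in the L-function, written as a Dirichlet series over monic
  polynomials.\<close>

definition L_coeff :: "'a \<Rightarrow> nat \<Rightarrow> complex" where
  "L_coeff a d = (\<Sum>f\<in>monics d. lam a f)"

lemma finite_monics: "finite (monics d)"
proof (rule finite_subset)
  show "monics d \<subseteq> polyF 1 (Suc d)"
    by (auto simp: monics_def overF_def intro!: polyF_I)
  show "finite (polyF 1 (Suc d) :: 'a poly set)" by (rule polyF_card(2)) simp
qed

lemma overF_reflect: "overF n f \<Longrightarrow> overF n (reflect_poly f)"
  by (auto simp: overF_def coeff_reflect_poly)

lemma monics_mult: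
  assumes "f \<in> monics d" "g \<in> monics e"
  shows "f * g \<in> monics (d + e)"
proof -
  have "f \<noteq> 0" "g \<noteq> 0" using assms by (auto simp: monics_def)
  thus ?thesis using assms
    by (auto simp: monics_def lead_coeff_mult[symmetric] coeff_mult_0 degree_mult_eq intro: overF_mult)
       (simp add: coeff_mult_degree_sum)
qed

text \<open>The sum of the roots and the sum of their inverses are both additive under
  multiplication of polynomials.\<close>

lemma lam_mult:
  assumes a: "a \<in> Fq 1" and f: "f \<in> monics d" and g: "g \<in> monics e"
  shows "lam a (f * g) = lam a f * lam a g"
proof -
  have cl: "- coeff (reflect_poly f) 1 - a * (coeff f 1 / coeff f 0) \<in> Fq 1" if "overF 1 f" for f
    using that overF_reflect[OF that] a by (auto simp: overF_def intro!: Fq_diff Fq_uminus Fq_mult Fq_divide)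
  have f0: "coeff f 0 \<noteq> 0" "coeff g 0 \<noteq> 0" using f g by (auto simp: monics_def)
  have l: "coeff (reflect_poly f) 0 = 1" "coeff (reflect_poly g) 0 = 1" using f g by (auto simp: monics_def)
  have c1: "coeff (r * s) 1 = coeff r 0 * coeff s 1 + coeff r 1 * coeff s 0" for r s :: "'a poly"
    by (simp add: coeff_mult)
  have "coeff (reflect_poly (f * g)) 1 = coeff (reflect_poly f) 1 + coeff (reflect_poly g) 1"
    unfolding reflect_poly_mult c1 l by simp
  moreover have "coeff (f * g) 1 / coeff (f * g) 0 = coeff f 1 / coeff f 0 + coeff g 1 / coeff g 0"
    unfolding c1 coeff_mult_0 using f0 by (simp add: field_simps)
  ultimately have "- coeff (reflect_poly (f * g)) 1 - a * (coeff (f * g) 1 / coeff (f * g) 0)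
     = (- coeff (reflect_poly f) 1 - a * (coeff f 1 / coeff f 0))
       + (- coeff (reflect_poly g) 1 - a * (coeff g 1 / coeff g 0))"
    by (simp only:) (simp only: distrib_left minus_add_distrib diff_conv_add_uminus add_ac)
  thus ?thesis unfolding lam_def using psi_add[OF cl cl] f g by (simp only:) (simp add: monics_def)
qed

lemma conj_poly_monics:
  assumes "x \<in> Fq k" "x \<noteq> 0"
  shows "conj_poly k x \<in> monics k"
proof -
  have "coeff (conj_poly k x) 0 = (\<Prod>i<k. - (x ^ (CHAR('a) ^ i)))"
    unfolding conj_poly_def by (simp add: poly_0_coeff_0[symmetric] poly_prod)
  also have "\<dots> \<noteq> 0" using assms(2) by simp
  finally show ?thesis
    using conj_poly_overF[OF assms(1)] by (simp add: monics_def degree_conj_poly lead_coeff_conj_poly[simplified degree_conj_poly])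
qed

text \<open>Vieta's formulas for the sum of the roots and the sum of their inverses.\<close>

lemma coeffs_prod_linear:
  fixes y :: "nat \<Rightarrow> 'a"
  assumes "\<And>i. i < k \<Longrightarrow> y i \<noteq> 0"
  defines "f \<equiv> (\<Prod>i<k. [:- y i, 1:])"
  shows "coeff (reflect_poly f) 0 = 1 \<and> coeff f 0 \<noteq> 0 \<and> coeff (reflect_poly f) 1 = - (\<Sum>i<k. y i)
     \<and> coeff f 1 / coeff f 0 = - (\<Sum>i<k. 1 / y i)"
  using assms(1) unfolding f_def
proof (induction k)
  case (Suc k)
  define g where "g = (\<Prod>i<k. [:- y i, 1:])"
  have IH: "coeff (reflect_poly g) 0 = 1" "coeff g 0 \<noteq> 0" "coeff (reflect_poly g) 1 = - (\<Sum>i<k. y i)"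
     "coeff g 1 / coeff g 0 = - (\<Sum>i<k. 1 / y i)" using Suc by (auto simp: g_def)
  have yk: "y k \<noteq> 0" using Suc.prems by simp
  have c1: "coeff (r * s) 1 = coeff r 0 * coeff s 1 + coeff r 1 * coeff s 0" for r s :: "'a poly"
    by (simp add: coeff_mult)
  have rl: "coeff (reflect_poly [:- y k, 1:]) 0 = 1" "coeff (reflect_poly [:- y k, 1:]) 1 = - y k"
    by (simp_all add: coeff_reflect_poly)
  have l: "coeff [:- y k, 1:] 0 = - y k" "coeff [:- y k, 1:] 1 = 1" by simp_all
  have eq: "(\<Prod>i<Suc k. [:- y i, 1:]) = g * [:- y k, 1:]" by (simp only: g_def prod.lessThan_Suc)
  show ?case unfolding eq reflect_poly_mult c1 coeff_mult_0 rl l IH(1,3)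
    using IH(2,4) yk by (simp add: field_simps)
qed simp

text \<open>The roots are the Frobenius conjugates of x, and a is fixed by Frobenius, so both root
  sums combine to the trace of x + a/x.\<close>

lemma lam_conj_poly:
  assumes a: "a \<in> Fq 1" and x: "x \<noteq> 0"
  shows "lam a (conj_poly k x) = \<psi> (frob_trace k (x + a / x))"
proof -
  have ai: "a ^ (CHAR('a) ^ i) = a" for i
    using Fq_dvd[of 1 i a] a by (cases "i = 0") (auto simp: Fq_iff)
  have c: "coeff (reflect_poly (conj_poly k x)) 1 = - (\<Sum>i<k. x ^ (CHAR('a) ^ i))"
     "coeff (conj_poly k x) 1 / coeff (conj_poly k x) 0 = - (\<Sum>i<k. 1 / x ^ (CHAR('a) ^ i))"
    using coeffs_prod_linear[of k "\<lambda>i. x ^ (CHAR('a) ^ i)"] x by (auto simp: conj_poly_def)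
  have "frob_trace k (x + a / x) = (\<Sum>i<k. x ^ (CHAR('a) ^ i)) + a * (\<Sum>i<k. 1 / x ^ (CHAR('a) ^ i))"
    unfolding frob_trace_def by (simp add: frobenius_add power_divide ai sum.distrib sum_distrib_left)
  thus ?thesis unfolding lam_def c by simp
qed

lemma L_coeff_0: "L_coeff a 0 = 1"
proof -
  have "monics 0 = {1}"
  proof (intro equalityI subsetI)
    fix f assume "f \<in> monics 0"
    hence "degree f = 0" "coeff f 0 = 1" by (auto simp: monics_def)
    thus "f \<in> {1}" by (metis degree_0_id one_pCons singletonI)
  qed (auto simp: monics_def overF_1)
  thus ?thesis by (simp add: L_coeff_def lam_def psi_0)
qed

text \<open>The logarithmic derivative of the Euler product, in the form of a double count of the pairs
  \<open>(f, x)\<close> such that the norm form \<open>conj_poly k x\<close> divides \<open>f\<close>.\<close>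

lemma L_coeff_recurrence:
  assumes a: "a \<in> Fq 1"
  shows "of_nat d * L_coeff a d = (\<Sum>k=1..d. kloos k a * L_coeff a (d - k))"
proof -
  define T where "T = (SIGMA k:{1..d}. (Fq k :: 'a set) - {0})"
  have finT: "finite T" unfolding T_def
    by (intro finite_SigmaI finite_Diff Fq_card(2)) auto
  \<comment> \<open>The factor d on the left of the recurrence is this number of pairs attached to
    each f.\<close>
  have cnt: "card {z \<in> T. conj_poly (fst z) (snd z) dvd f} = d" if "f \<in> monics d" for f
    using card_conj_poly_dvd_total[of f] that by (simp add: monics_def T_def)
  have "of_nat d * L_coeff a d = (\<Sum>f\<in>monics d. \<Sum>z\<in>{z \<in> T. conj_poly (fst z) (snd z) dvd f}. lam a f)"
    unfolding L_coeff_def sum_distrib_left by (intro sum.cong refl) (simp add: cnt)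
  also have "\<dots> = (\<Sum>z\<in>T. \<Sum>f\<in>{f \<in> monics d. conj_poly (fst z) (snd z) dvd f}. lam a f)"
    by (rule sum.swap_restrict[OF finite_monics finT])
  also have "\<dots> = (\<Sum>z\<in>T. \<psi> (frob_trace (fst z) (snd z + a / snd z)) * L_coeff a (d - fst z))"
  proof (intro sum.cong refl)
    fix z assume "z \<in> T"
    then obtain k x where z: "z = (k, x)" and k: "k \<in> {1..d}" and x: "x \<in> Fq k" "x \<noteq> 0"
      unfolding T_def by blast
    define N where "N = conj_poly k x"
    have N: "N \<in> monics k" unfolding N_def by (rule conj_poly_monics[OF x])
    have N0: "N \<noteq> 0" by (simp add: N_def conj_poly_nz)
    \<comment> \<open>Cofactors of N are again monic over the prime field with nonzero constant
      coefficient, so the inner sum is \<open>lam a N\<close> times an L-coefficient of degree d -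
      k.\<close>
    have "{f \<in> monics d. N dvd f} = (\<lambda>g. N * g) ` monics (d - k)"
    proof (intro equalityI subsetI)
      fix f assume f: "f \<in> {f \<in> monics d. N dvd f}"
      then obtain g where g: "f = N * g" by blast
      have g0: "g \<noteq> 0" using f g by (auto simp: monics_def)
      have "overF 1 g" using overF_quotient[of N g] f g N N0 by (simp add: monics_def)
      moreover have "degree g = d - k" using f g N N0 g0 by (auto simp: monics_def degree_mult_eq)
      moreover have "lead_coeff g = 1"
      proof -
        have "lead_coeff (N * g) = 1" "lead_coeff N = 1" using f N unfolding monics_def g by blast+
        thus ?thesis unfolding lead_coeff_mult by simp
      qed
      moreover have "coeff g 0 \<noteq> 0" using f g by (auto simp: monics_def coeff_mult_0)
      ultimately show "f \<in> (\<lambda>g. N * g) ` monics (d - k)" using g by (auto simp: monics_def)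
    next
      fix f assume "f \<in> (\<lambda>g. N * g) ` monics (d - k)"
      then obtain g where g: "g \<in> monics (d - k)" "f = N * g" by blast
      have "N * g \<in> monics (k + (d - k))" by (rule monics_mult[OF N g(1)])
      thus "f \<in> {f \<in> monics d. N dvd f}" using g k by simp
    qed
    hence "(\<Sum>f\<in>{f \<in> monics d. N dvd f}. lam a f) = (\<Sum>g\<in>monics (d - k). lam a (N * g))"
      using N0 by (simp add: sum.reindex inj_on_def)
    also have "\<dots> = (\<Sum>g\<in>monics (d - k). lam a N * lam a g)"
      by (intro sum.cong refl lam_mult[OF a N])
    also have "\<dots> = lam a N * L_coeff a (d - k)" by (simp add: L_coeff_def sum_distrib_left)
    finally show "(\<Sum>f\<in>{f \<in> monics d. conj_poly (fst z) (snd z) dvd f}. lam a f)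
        = \<psi> (frob_trace (fst z) (snd z + a / snd z)) * L_coeff a (d - fst z)"
      using lam_conj_poly[OF a x(2), of k] by (simp add: z N_def)
  qed
  also have "\<dots> = (\<Sum>k=1..d. \<Sum>x\<in>Fq k - {0}. \<psi> (frob_trace k (x + a / x)) * L_coeff a (d - k))"
    unfolding T_def by (subst sum.Sigma) (auto simp: Fq_card split_def)
  also have "\<dots> = (\<Sum>k=1..d. kloos k a * L_coeff a (d - k))"
    by (simp add: kloos_def sum_distrib_right)
  finally show ?thesis .
qed

lemma monics_shift:
  assumes "f \<in> monics d" "overF 1 r" "degree r < d" "coeff r 0 = 0"
  shows "f + r \<in> monics d" "f - r \<in> monics d"
proof -
  have "f + s \<in> monics d" if "overF 1 s" "degree s < d" "coeff s 0 = 0" for s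
  proof -
    have "degree (f + s) = d" using assms(1) that(2) by (subst degree_add_eq_left) (auto simp: monics_def)
    thus ?thesis using assms(1) that by (auto simp: monics_def overF_add coeff_eq_0)
  qed
  from this[of r] this[of "- r"] show "f + r \<in> monics d" "f - r \<in> monics d"
    using assms by (auto simp: overF_uminus)
qed

lemma lam_eq:
  assumes "f \<in> monics d" "d > 0"
  shows "lam a f = \<psi> (- coeff f (d - 1) - a * (coeff f 1 / coeff f 0))"
  using assms by (simp add: lam_def coeff_reflect_poly monics_def)

lemma lam_arg_in_Fq:
  assumes "f \<in> monics d" "a \<in> Fq 1"
  shows "- coeff f i - a * (coeff f 1 / coeff f 0) \<in> Fq 1"
  using assms by (auto simp: monics_def overF_def intro!: Fq_diff Fq_uminus Fq_mult Fq_divide)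

text \<open>For d \<ge> 3 the coefficient of index d - 1 is distinct from those of index 0 and 1.
  Translating it by -t permutes the monic polynomials and multiplies every term by \<psi>(t)
  \<noteq> 1.\<close>

lemma L_coeff_high:
  assumes d: "d \<ge> 3" and a: "a \<in> Fq 1"
  shows "L_coeff a d = 0"
proof -
  obtain t where t: "t \<in> Fq 1" "\<psi> t \<noteq> 1" using psi_nontrivial by blast
  define r where "r = monom (- t) (d - 1)"
  have r: "overF 1 r" "degree r < d" "coeff r 0 = 0" "coeff r 1 = 0" "coeff r (d - 1) = - t"
    using d t degree_monom_le[of "- t" "d - 1"] by (auto simp: r_def intro!: overF_monom Fq_uminus)
  have "L_coeff a d = (\<Sum>f\<in>monics d. lam a (f + r))"
    unfolding L_coeff_def
    by (rule sum.reindex_bij_witness[of _ "\<lambda>f. f + r" "\<lambda>f. f - r"]) (use monics_shift r in auto)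
  also have "\<dots> = (\<Sum>f\<in>monics d. \<psi> t * lam a f)"
  proof (intro sum.cong refl)
    fix f assume f: "f \<in> monics d"
    have "- coeff (f + r) (d - 1) - a * (coeff (f + r) 1 / coeff (f + r) 0)
        = t + (- coeff f (d - 1) - a * (coeff f 1 / coeff f 0))" using r by simp
    note eq = this
    have d0: "d > 0" using d by simp
    show "lam a (f + r) = \<psi> t * lam a f"
      unfolding lam_eq[OF f d0] lam_eq[OF monics_shift(1)[OF f r(1-3)] d0] eq
      by (rule psi_add[OF t(1) lam_arg_in_Fq[OF f a]])
  qed
  also have "\<dots> = \<psi> t * L_coeff a d" by (simp add: L_coeff_def sum_distrib_left)
  finally show ?thesis using t(2) by simp
qed

text \<open>For X^2 + c X + b the two relevant coefficients coincide and the character is evaluated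
  at -c(1 + a/b). The sum over c vanishes unless b = -a, and then all p values of c contribute
  1.\<close>

lemma L_coeff_2:
  assumes a: "a \<in> Fq 1" "a \<noteq> 0"
  shows "L_coeff a 2 = of_nat CHAR('a)"
proof -
  define A where "A = {f \<in> monics 2. coeff f 0 = - a}"
  define B where "B = {f \<in> monics 2. coeff f 0 \<noteq> - a}"
  have AB: "monics 2 = A \<union> B" "A \<inter> B = {}" "finite A" "finite B"
    using finite_monics by (auto simp: A_def B_def)
  have "(\<Sum>f\<in>B. lam a f) = 0"
  proof -
    obtain t where t: "t \<in> Fq 1" "\<psi> t \<noteq> 1" using psi_nontrivial by blast
    \<comment> \<open>The change of the linear coefficient that adds t to the argument of \<psi>. It
      depends on the constant coefficient only, so the shift is undone by subtracting the same
      amount.\<close>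
    define c where "c = (\<lambda>f. - t / (1 + a / coeff f 0))"
    define r where "r = (\<lambda>f. monom (c f) 1)"
    have r: "overF 1 (r f)" "degree (r f) < 2" "coeff (r f) 0 = 0" "coeff (r f) 1 = c f" if "f \<in> B" for f
    proof -
      have "c f \<in> Fq 1" using that t a unfolding c_def
        by (intro Fq_divide Fq_add Fq_uminus) (auto simp: B_def monics_def overF_def)
      thus "overF 1 (r f)" by (simp add: r_def overF_monom)
      show "degree (r f) < 2" using degree_monom_le[of "c f" 1] by (simp add: r_def)
    qed (simp_all add: r_def)
    have cc: "c (f + monom u 1) = c f" "c (f - monom u 1) = c f" for f u by (simp_all add: c_def)
    have sh: "f + r f \<in> B" "f - r f \<in> B" if "f \<in> B" for f
      using monics_shift[of f 2 "r f"] r[OF that] that by (auto simp: B_def)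
    have "(\<Sum>f\<in>B. lam a f) = (\<Sum>f\<in>B. lam a (f + r f))"
      by (rule sum.reindex_bij_witness[of _ "\<lambda>f. f + r f" "\<lambda>f. f - r f"])
         (use sh in \<open>auto simp: r_def cc[unfolded One_nat_def]\<close>)
    also have "\<dots> = (\<Sum>f\<in>B. \<psi> t * lam a f)"
    proof (intro sum.cong refl)
      fix f assume fB: "f \<in> B"
      hence f: "f \<in> monics 2" by (simp add: B_def)
      have f0: "coeff f 0 \<noteq> 0" "coeff f 0 \<noteq> - a" using fB by (auto simp: B_def monics_def)
      have nz: "coeff f 0 + a \<noteq> 0" using f0(2) by (metis eq_neg_iff_add_eq_0)
      have "c f + a * (c f / coeff f 0) = c f * (1 + a / coeff f 0)" by (simp add: distrib_left)
      also have "1 + a / coeff f 0 \<noteq> 0" using f0(1) nz by (simp add: field_simps)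
      hence "c f * (1 + a / coeff f 0) = - t" by (simp add: c_def)
      finally have "t = - (c f + a * (c f / coeff f 0))" by simp
      hence "- coeff (f + r f) 1 - a * (coeff (f + r f) 1 / coeff (f + r f) 0)
        = t + (- coeff f 1 - a * (coeff f 1 / coeff f 0))"
        using r[OF fB] by (simp add: add_divide_distrib distrib_left)
      note eq = this
      have fr: "f + r f \<in> monics 2" using sh[OF fB] by (simp add: B_def)
      have "lam a (f + r f) = \<psi> (- coeff (f + r f) 1 - a * (coeff (f + r f) 1 / coeff (f + r f) 0))"
        using lam_eq[OF fr, of a] by simp
      also have "\<dots> = \<psi> t * \<psi> (- coeff f 1 - a * (coeff f 1 / coeff f 0))"
        unfolding eq by (rule psi_add[OF t(1) lam_arg_in_Fq[OF f a(1)]])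
      finally show "lam a (f + r f) = \<psi> t * lam a f" using lam_eq[OF f, of a] by simp
    qed
    also have "\<dots> = \<psi> t * (\<Sum>f\<in>B. lam a f)" by (simp add: sum_distrib_left)
    finally show ?thesis using t(2) by simp
  qed
  moreover have "(\<Sum>f\<in>A. lam a f) = (\<Sum>f\<in>A. 1)"
  proof (intro sum.cong refl)
    fix f assume "f \<in> A"
    thus "lam a f = 1" using a lam_eq[of f 2 a] by (simp add: A_def psi_0)
  qed
  moreover have "card A = CHAR('a)"
  proof -
    have "A = (\<lambda>c. [:- a, c, 1:]) ` Fq 1"
    proof (intro equalityI subsetI)
      fix f assume f: "f \<in> A"
      hence d: "degree f = 2" "coeff f 2 = 1" "coeff f 0 = - a" "coeff f 1 \<in> Fq 1"
        by (auto simp: A_def monics_def overF_def)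
      have "f = [:- a, coeff f 1, 1:]"
      proof (rule poly_eqI)
        fix i :: nat consider "i = 0" | "i = 1" | "i = 2" | "i > 2" by linarith
        thus "coeff f i = coeff [:- a, coeff f 1, 1:] i"
        proof cases
          case 4 thus ?thesis using d(1) by (simp add: coeff_eq_0)
        qed (use d in \<open>simp_all add: numeral_2_eq_2\<close>)
      qed
      thus "f \<in> (\<lambda>c. [:- a, c, 1:]) ` Fq 1" using d(4) by blast
    next
      fix f assume "f \<in> (\<lambda>c. [:- a, c, 1:]) ` Fq 1"
      then obtain c where "c \<in> Fq 1" "f = [:- a, c, 1:]" by blast
      thus "f \<in> A" using a by (auto simp: A_def monics_def intro!: overF_pCons overF_0 Fq_uminus)
    qed
    also have "card \<dots> = card (Fq 1 :: 'a set)" by (rule card_image) (auto simp: inj_on_def)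
    also have "\<dots> = CHAR('a)" using Fq_card(1)[of 1, where ?'a = 'a] by simp
    finally show ?thesis .
  qed
  ultimately show ?thesis unfolding L_coeff_def AB(1) by (subst sum.union_disjoint) (use AB in auto)
qed

text \<open>The L-coefficients are 1, \<open>kloos 1 a\<close>, p, 0, 0, ..., so the recurrence
  becomes Newton's identities for two numbers with sum \<open>- kloos 1 a\<close> and product
  p.\<close>

lemma kloos_recurrence:
  assumes a: "a \<in> Fq 1" "a \<noteq> 0"
  shows "kloos 2 a = 2 * of_nat CHAR('a) - (kloos 1 a)\<^sup>2"
    and "n > 0 \<Longrightarrow> kloos (n + 2) a = - kloos 1 a * kloos (n + 1) a - of_nat CHAR('a) * kloos n a"
proof -
  note rec = L_coeff_recurrence[OF a(1)]
  have L1: "L_coeff a 1 = kloos 1 a" using rec[of 1] by (simp add: L_coeff_0)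
  have "{1..2::nat} = {1,2}" by auto
  thus "kloos 2 a = 2 * of_nat CHAR('a) - (kloos 1 a)\<^sup>2"
    using rec[of 2] L1 L_coeff_2[OF a] by (simp add: L_coeff_0 power2_eq_square algebra_simps)
  assume n: "n > 0"
  have "0 = (\<Sum>k=1..n + 2. kloos k a * L_coeff a (n + 2 - k))"
    using rec[of "n + 2"] L_coeff_high[of "n + 2" a] a n by simp
  also have "\<dots> = (\<Sum>k\<in>{n, n + 1, n + 2}. kloos k a * L_coeff a (n + 2 - k))"
  proof (rule sum.mono_neutral_right)
    show "\<forall>k\<in>{1..n + 2} - {n, n + 1, n + 2}. kloos k a * L_coeff a (n + 2 - k) = 0"
    proof
      fix k assume "k \<in> {1..n + 2} - {n, n + 1, n + 2}"
      hence "n + 2 - k \<ge> 3" by auto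
      thus "kloos k a * L_coeff a (n + 2 - k) = 0" using L_coeff_high[OF _ a(1)] by simp
    qed
  qed (use n in auto)
  also have "\<dots> = kloos n a * of_nat CHAR('a) + (kloos (n + 1) a * kloos 1 a + kloos (n + 2) a)"
    using L_coeff_2[OF a] L1 by (simp add: L_coeff_0)
  finally show "kloos (n + 2) a = - kloos 1 a * kloos (n + 1) a - of_nat CHAR('a) * kloos n a"
    by (simp add: algebra_simps eq_neg_iff_add_eq_0 minus_equation_iff)
qed

end

section \<open>The Weil bound\<close>

lemma power_sum_recurrence:
  fixes s :: "nat \<Rightarrow> 'b::field"
  assumes s2: "s 2 = 2 * p - (s 1)\<^sup>2"
    and rec: "\<And>n. n > 0 \<Longrightarrow> s (n + 2) = - s 1 * s (n + 1) - p * s n"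
    and \<alpha>: "\<alpha> + \<beta> = - s 1" "\<alpha> * \<beta> = p" and n: "n > 0"
  shows "s n = - (\<alpha> ^ n + \<beta> ^ n)"
  using n
proof (induction n rule: less_induct)
  case (less n)
  have s1: "s 1 = - (\<alpha> + \<beta>)" using \<alpha>(1) by simp
  consider "n = 1" | "n = 2" | m where "n = m + 2" "m > 0"
    using less.prems by (metis One_nat_def Suc_1 add.commute add_2_eq_Suc gr0_conv_Suc not0_implies_Suc)
  thus ?case
  proof cases
    case 1 thus ?thesis using s1 by simp
  next
    case 2 thus ?thesis using s2 unfolding s1 \<alpha>(2)[symmetric] by (simp add: power2_eq_square algebra_simps)
  next
    case 3
    have IH: "s m = - (\<alpha> ^ m + \<beta> ^ m)" "s (m + 1) = - (\<alpha> ^ (m + 1) + \<beta> ^ (m + 1))"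
      using less.IH[of m] less.IH[of "m + 1"] 3 by auto
    show ?thesis unfolding 3(1) rec[OF 3(2)] IH s1 \<alpha>(2)[symmetric]
      by (simp add: algebra_simps)
  qed
qed

text \<open>Let \<alpha>, \<beta> be the roots of Z^2 + s(1) Z + p. If the discriminant is not
  positive, they are conjugate of modulus sqrt p. If it is positive, they are real with product p
  and distinct squares, so one square exceeds p, and both terms of an even power sum have the same
  sign.\<close>

lemma even_power_sum_le:
  fixes s :: "nat \<Rightarrow> real"
  assumes p: "p > 0" and s2: "s 2 = 2 * p - (s 1)\<^sup>2"
    and rec: "\<And>n. n > 0 \<Longrightarrow> s (n + 2) = - s 1 * s (n + 1) - p * s n"
  shows "m > 0 \<Longrightarrow> s (2 * m) \<le> 2 * p ^ m"
    and "\<bar>s 1\<bar> > 2 * sqrt p \<Longrightarrow> \<exists>b>p. \<forall>m>0. s (2 * m) \<le> - (b ^ m)"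
proof -
  have real_case: "\<exists>b>p. \<forall>m>0. s (2 * m) \<le> - (b ^ m)" if big: "(s 1)\<^sup>2 > 4 * p"
  proof -
    define \<Delta> where "\<Delta> = sqrt ((s 1)\<^sup>2 - 4 * p)"
    define \<alpha> \<beta> where "\<alpha> = (- s 1 + \<Delta>) / 2" and "\<beta> = (- s 1 - \<Delta>) / 2"
    have \<Delta>: "\<Delta> > 0" "\<Delta>\<^sup>2 = (s 1)\<^sup>2 - 4 * p" using big by (auto simp: \<Delta>_def)
    have sum: "\<alpha> + \<beta> = - s 1" by (simp add: \<alpha>_def \<beta>_def field_simps)
    have prod: "\<alpha> * \<beta> = p" using \<Delta>(2) by (simp add: \<alpha>_def \<beta>_def field_simps power2_eq_square)
    have eq: "s (2 * m) = - ((\<alpha>\<^sup>2) ^ m + (\<beta>\<^sup>2) ^ m)" if "m > 0" for m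
      using power_sum_recurrence[OF s2 rec sum prod, of "2 * m"] that by (simp add: power_mult)
    have ne: "\<alpha>\<^sup>2 \<noteq> \<beta>\<^sup>2"
    proof
      assume "\<alpha>\<^sup>2 = \<beta>\<^sup>2"
      hence "(\<alpha> - \<beta>) * (\<alpha> + \<beta>) = 0" by (simp add: power2_eq_square algebra_simps)
      moreover have "\<alpha> - \<beta> = \<Delta>" by (simp add: \<alpha>_def \<beta>_def field_simps)
      moreover have "s 1 \<noteq> 0" using big p by auto
      ultimately show False using \<Delta> sum by simp
    qed
    have pp: "\<alpha>\<^sup>2 * \<beta>\<^sup>2 = p * p" unfolding power_mult_distrib[symmetric] prod by (rule power2_eq_square)
    have "\<alpha>\<^sup>2 > p \<or> \<beta>\<^sup>2 > p"
    proof (rule ccontr)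
      assume "\<not> ?thesis"
      hence le: "\<alpha>\<^sup>2 \<le> p" "\<beta>\<^sup>2 \<le> p" by auto
      have "\<alpha>\<^sup>2 * \<beta>\<^sup>2 \<le> p * \<beta>\<^sup>2" "p * \<beta>\<^sup>2 \<le> p * p" "\<alpha>\<^sup>2 * \<beta>\<^sup>2 \<le> \<alpha>\<^sup>2 * p" "\<alpha>\<^sup>2 * p \<le> p * p"
        using le p by (auto intro: mult_mono)
      hence "p * \<beta>\<^sup>2 = p * p" "\<alpha>\<^sup>2 * p = p * p" using pp by linarith+
      thus False using ne p by simp
    qed
    thus ?thesis
    proof
      assume "\<alpha>\<^sup>2 > p"
      thus ?thesis using eq by (intro exI[of _ "\<alpha>\<^sup>2"]) auto
    next
      assume "\<beta>\<^sup>2 > p"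
      thus ?thesis using eq by (intro exI[of _ "\<beta>\<^sup>2"]) auto
    qed
  qed
  show "s (2 * m) \<le> 2 * p ^ m" if m: "m > 0"
  proof (cases "(s 1)\<^sup>2 > 4 * p")
    case True
    then obtain b where b: "b > p" "\<forall>m>0. s (2 * m) \<le> - (b ^ m)" using real_case by blast
    have "s (2 * m) \<le> - (b ^ m)" using b m by simp
    also have "\<dots> \<le> 0" using b p by simp
    also have "\<dots> \<le> 2 * p ^ m" using p by simp
    finally show ?thesis .
  next
    case False
    define \<alpha> where "\<alpha> = Complex (- s 1 / 2) (sqrt (4 * p - (s 1)\<^sup>2) / 2)"
    have im: "(sqrt (4 * p - (s 1)\<^sup>2))\<^sup>2 = 4 * p - (s 1)\<^sup>2" using False by simp
    have norm: "(cmod \<alpha>)\<^sup>2 = p"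
      unfolding cmod_power2 using im by (simp add: \<alpha>_def power_divide diff_divide_distrib)
    have sum: "\<alpha> + cnj \<alpha> = - complex_of_real (s 1)" by (simp add: \<alpha>_def complex_add_cnj)
    have prod: "\<alpha> * cnj \<alpha> = complex_of_real p" using norm complex_norm_square[of "\<alpha>"] by simp
    have "complex_of_real (s (2 * m)) = - (\<alpha> ^ (2 * m) + cnj \<alpha> ^ (2 * m))"
      by (rule power_sum_recurrence[of "\<lambda>n. complex_of_real (s n)" "complex_of_real p"])
         (use s2 rec sum prod m in simp_all)
    hence "s (2 * m) = - Re (\<alpha> ^ (2 * m) + cnj \<alpha> ^ (2 * m))"
      by (metis Re_complex_of_real uminus_complex.simps(1))
    also have "\<dots> \<le> cmod (\<alpha> ^ (2 * m) + cnj \<alpha> ^ (2 * m))"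
      using abs_Re_le_cmod[of "\<alpha> ^ (2 * m) + cnj \<alpha> ^ (2 * m)"] by linarith
    also have "\<dots> \<le> cmod (\<alpha> ^ (2 * m)) + cmod (cnj \<alpha> ^ (2 * m))" by (rule norm_triangle_ineq)
    also have "\<dots> = 2 * p ^ m" using norm by (simp add: norm_power power_mult)
    finally show ?thesis .
  qed
  show "\<exists>b>p. \<forall>m>0. s (2 * m) \<le> - (b ^ m)" if "\<bar>s 1\<bar> > 2 * sqrt p"
  proof (rule real_case)
    have "(2 * sqrt p)\<^sup>2 < \<bar>s 1\<bar>\<^sup>2" using that p by (intro power_strict_mono) auto
    thus "4 * p < (s 1)\<^sup>2" using p by (simp add: power_mult_distrib)
  qed
qed

text \<open>A violation at i makes s(i, 2m) fall below -b^m for some b > p. The other terms are at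
  most 2 p^m each, whether or not they violate the bound themselves, so they cannot compensate and
  the lower bound fails for large m.\<close>

lemma weil_numbers_bound:
  fixes s :: "'j \<Rightarrow> nat \<Rightarrow> real"
  assumes p: "p > 0" and J: "finite J"
    and s2: "\<And>j. j \<in> J \<Longrightarrow> s j 2 = 2 * p - (s j 1)\<^sup>2"
    and rec: "\<And>j n. j \<in> J \<Longrightarrow> n > 0 \<Longrightarrow> s j (n + 2) = - s j 1 * s j (n + 1) - p * s j n"
    and lower: "\<And>m. m > 0 \<Longrightarrow> (\<Sum>j\<in>J. s j (2 * m)) \<ge> - C * p ^ m"
    and i: "i \<in> J"
  shows "\<bar>s i 1\<bar> \<le> 2 * sqrt p"
proof (rule ccontr)
  assume "\<not> ?thesis"
  then obtain b where b: "b > p" "\<forall>m>0. s i (2 * m) \<le> - (b ^ m)"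
    using even_power_sum_le(2)[OF p s2[OF i] rec[OF i]] by auto
  define K where "K = C + 2 * real (card J)"
  have bound: "(b / p) ^ m \<le> K" if m: "m > 0" for m
  proof -
    have "- C * p ^ m \<le> s i (2 * m) + (\<Sum>j\<in>J - {i}. s j (2 * m))"
      using lower[OF m] sum.remove[OF J i, of "\<lambda>j. s j (2 * m)"] by simp
    also have "(\<Sum>j\<in>J - {i}. s j (2 * m)) \<le> (\<Sum>j\<in>J - {i}. 2 * p ^ m)"
      by (intro sum_mono even_power_sum_le(1)[OF p s2 rec] m) auto
    also have "\<dots> \<le> real (card J) * (2 * p ^ m)"
      using J p by (auto intro!: mult_right_mono card_Diff1_le)
    finally have "- C * p ^ m \<le> s i (2 * m) + real (card J) * (2 * p ^ m)" by simp
    moreover have "s i (2 * m) \<le> - (b ^ m)" using b(2) m by blast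
    moreover have "K * p ^ m = C * p ^ m + real (card J) * (2 * p ^ m)" by (simp add: K_def algebra_simps)
    ultimately have "b ^ m \<le> K * p ^ m" by linarith
    thus ?thesis using p by (simp add: power_divide divide_le_eq)
  qed
  obtain N where N: "(b / p) ^ N > K" using real_arch_pow[of "b / p" K] b p by (auto simp: field_simps)
  have "(b / p) ^ N \<le> (b / p) ^ Suc N" using b p by (intro power_increasing) (auto simp: field_simps)
  thus False using N bound[of "Suc N"] by simp
qed

section \<open>Averaging over all additive characters\<close>

context prime_field_character
begin

lemma psi_of_nat_mult: "x \<in> Fq 1 \<Longrightarrow> \<psi> (of_nat k * x) = \<psi> x ^ k"
  by (induction k) (auto simp: psi_0 distrib_right psi_add Fq_mult Fq_of_nat)

lemma norm_psi:
  assumes "x \<in> Fq 1" shows "cmod (\<psi> x) = 1"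
proof -
  have "\<psi> x ^ CHAR('a) = 1" using psi_of_nat_mult[OF assms, of "CHAR('a)"] by (simp add: psi_0)
  hence "cmod (\<psi> x) ^ CHAR('a) = 1" by (simp flip: norm_power)
  thus ?thesis using power_eq_imp_eq_base[of "cmod (\<psi> x)" "CHAR('a)" 1] by simp
qed

lemma psi_uminus:
  assumes "x \<in> Fq 1" shows "\<psi> (- x) = cnj (\<psi> x)"
proof -
  have "\<psi> x * \<psi> (- x) = 1" using psi_add[OF assms Fq_uminus[OF assms]] by (simp add: psi_0)
  moreover have "\<psi> x * cnj (\<psi> x) = 1" using complex_norm_square[of "\<psi> x"] norm_psi[OF assms] by simp
  moreover have "\<psi> x \<noteq> 0" using norm_psi[OF assms] by auto
  ultimately show ?thesis by (metis mult_left_cancel)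
qed

lemma character_scale:
  assumes "c \<in> Fq 1" "c \<noteq> 0"
  shows "prime_field_character (\<lambda>x. \<psi> (c * x))"
proof
  obtain x where x: "x \<in> Fq 1" "\<psi> x \<noteq> 1" using psi_nontrivial by blast
  show "\<exists>x\<in>Fq 1. \<psi> (c * x) \<noteq> 1"
    using x assms by (intro bexI[of _ "x / c"]) (auto intro: Fq_divide)
qed (use assms in \<open>auto simp: psi_0 distrib_left psi_add Fq_mult\<close>)

lemma sum_psi_mult:
  assumes z: "z \<in> Fq 1"
  shows "(\<Sum>c\<in>Fq 1. \<psi> (c * z)) = (if z = 0 then of_nat CHAR('a) else 0)"
proof (cases "z = 0")
  case True
  thus ?thesis using Fq_card(1)[of 1, where ?'a = 'a] by (simp add: psi_0)
next
  case False
  obtain x where x: "x \<in> Fq 1" "\<psi> x \<noteq> 1" using psi_nontrivial by blast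
  define t where "t = x / z"
  have t: "t \<in> Fq 1" unfolding t_def using x z by (intro Fq_divide)
  have "(\<Sum>c\<in>Fq 1. \<psi> (c * z)) = (\<Sum>c\<in>Fq 1. \<psi> ((c + t) * z))"
    by (rule sum.reindex_bij_witness[of _ "\<lambda>c. c + t" "\<lambda>c. c - t"]) (use t in \<open>auto intro: Fq_add Fq_diff\<close>)
  also have "\<dots> = (\<Sum>c\<in>Fq 1. \<psi> x * \<psi> (c * z))"
  proof (intro sum.cong refl)
    fix c :: 'a assume c: "c \<in> Fq 1"
    have "(c + t) * z = x + c * z" using False by (simp add: t_def distrib_right)
    thus "\<psi> ((c + t) * z) = \<psi> x * \<psi> (c * z)" using psi_add[OF x(1) Fq_mult[OF c z]] by simp
  qed
  also have "\<dots> = \<psi> x * (\<Sum>c\<in>Fq 1. \<psi> (c * z))" by (simp add: sum_distrib_left)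
  finally show ?thesis using False x(2) by simp
qed

text \<open>Complex conjugation replaces \<psi>(z) by \<psi>(-z), which the substitution x \<mapsto>
  -x undoes.\<close>

lemma kloos_real:
  assumes a: "a \<in> Fq 1" and n: "n > 0"
  shows "kloos n a = complex_of_real (Re (kloos n a))"
proof -
  have aF: "a \<in> Fq n" using Fq_dvd[OF _ a] by simp
  have cl: "frob_trace n (x + a / x) \<in> Fq 1" if "x \<in> Fq n" for x
    using that aF by (intro frob_trace_in_Fq Fq_add Fq_divide)
  have neg: "frob_trace n (- z) = - frob_trace n z" for z :: 'a
    by (simp add: frob_trace_def frobenius_uminus sum_negf)
  have "cnj (kloos n a) = (\<Sum>x\<in>Fq n - {0}. \<psi> (frob_trace n (- x + a / (- x))))"
    unfolding kloos_def cnj_sum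
  proof (intro sum.cong refl)
    fix x :: 'a assume x: "x \<in> Fq n - {0}"
    have eq: "- x + a / (- x) = - (x + a / x)" by simp
    show "cnj (\<psi> (frob_trace n (x + a / x))) = \<psi> (frob_trace n (- x + a / (- x)))"
      unfolding eq neg using psi_uminus[OF cl[of x]] x by simp
  qed
  also have "\<dots> = kloos n a"
    unfolding kloos_def
    by (rule sum.reindex_bij_witness[of _ uminus uminus]) (auto intro: Fq_uminus)
  finally show ?thesis by (simp add: complex_eq_iff)
qed

text \<open>As c runs through the nonzero elements of the prime field, z \<mapsto> \<psi>(c z) runs
  through the nontrivial characters. By orthogonality their sums over the field with p^n elements
  add up to p times the number of x of trace 0, minus p^n - 1. For n = 2m the lower bound for that
  number supplies C = 8p + 5.\<close>

theorem weil_kloosterman_bound: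
  assumes a: "a \<in> Fq 1" "a \<noteq> 0" and odd: "odd CHAR('a)"
  shows "cmod (kloos 1 a) \<le> 2 * sqrt (real CHAR('a))"
proof -
  define p where "p = CHAR('a)"
  have p: "p > 1" unfolding p_def by (rule CHAR_gt_1)
  define K where "K = (\<lambda>c n. prime_field_character.kloos (\<lambda>x. \<psi> (c * x)) n a)"
  define s where "s = (\<lambda>c n. Re (K c n))"
  define J where "J = (Fq 1 :: 'a set) - {0}"
  have finF: "finite (Fq n :: 'a set)" if "n > 0" for n using that by (rule Fq_card(2))
  have J: "finite J" using finF by (simp add: J_def)
  have ch: "prime_field_character (\<lambda>x. \<psi> (c * x))" if "c \<in> J" for c
    using that by (intro character_scale) (auto simp: J_def)
  have K_real: "K c n = complex_of_real (s c n)" if "c \<in> J" "n > 0" for c n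
    unfolding K_def s_def by (rule prime_field_character.kloos_real[OF ch[OF that(1)] a(1) that(2)])
  have s2: "s c 2 = 2 * real p - (s c 1)\<^sup>2" if c: "c \<in> J" for c
  proof -
    have "K c 2 = 2 * of_nat p - (K c 1)\<^sup>2"
      unfolding K_def p_def by (rule prime_field_character.kloos_recurrence(1)[OF ch[OF c] a])
    hence "complex_of_real (s c 2) = complex_of_real (2 * real p - (s c 1)\<^sup>2)"
      by (simp add: K_real[OF c])
    thus ?thesis by (simp only: of_real_eq_iff)
  qed
  have rec: "s c (n + 2) = - s c 1 * s c (n + 1) - real p * s c n" if c: "c \<in> J" and n: "n > 0" for c n
  proof -
    have "K c (n + 2) = - K c 1 * K c (n + 1) - of_nat p * K c n"
      unfolding K_def p_def by (rule prime_field_character.kloos_recurrence(2)[OF ch[OF c] a n])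
    hence "complex_of_real (s c (n + 2)) = complex_of_real (- s c 1 * s c (n + 1) - real p * s c n)"
      using n by (simp add: K_real[OF c])
    thus ?thesis by (simp only: of_real_eq_iff)
  qed
  have lower: "(\<Sum>c\<in>J. s c (2 * m)) \<ge> - real (8 * p + 5) * real p ^ m" if m: "m > 0" for m
  proof -
    define n where "n = 2 * m"
    have n: "n > 0" using m by (simp add: n_def)
    have aF: "a \<in> Fq n" using Fq_dvd[OF _ a(1)] by simp
    let ?t = "\<lambda>x. frob_trace n (x + a / x)"
    have cl: "?t x \<in> Fq 1" if "x \<in> Fq n" for x
      using that aF by (intro frob_trace_in_Fq Fq_add Fq_divide)
    have "(\<Sum>c\<in>J. K c n) = (\<Sum>c\<in>J. \<Sum>x\<in>Fq n - {0}. \<psi> (c * ?t x))"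
      unfolding K_def by (intro sum.cong refl) (simp add: prime_field_character.kloos_def[OF ch])
    also have "\<dots> = (\<Sum>x\<in>Fq n - {0}. \<Sum>c\<in>J. \<psi> (c * ?t x))" by (rule sum.swap)
    also have "\<dots> = (\<Sum>x\<in>Fq n - {0}. (if ?t x = 0 then of_nat p else 0) - 1)"
    proof (intro sum.cong refl)
      fix x :: 'a assume "x \<in> Fq n - {0}"
      hence "(\<Sum>c\<in>Fq 1. \<psi> (c * ?t x)) = (if ?t x = 0 then of_nat p else 0)"
        unfolding p_def by (intro sum_psi_mult cl) auto
      thus "(\<Sum>c\<in>J. \<psi> (c * ?t x)) = (if ?t x = 0 then of_nat p else 0) - 1"
        unfolding J_def by (subst sum_diff1) (auto simp: finF psi_0)
    qed
    also have "\<dots> = of_nat p * of_nat (card (kloosterman_zeros n a)) - of_nat (p ^ n - 1)"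
    proof -
      have "(\<Sum>x\<in>Fq n - {0}. if ?t x = 0 then (of_nat p :: complex) else 0) = (\<Sum>x\<in>kloosterman_zeros n a. of_nat p)"
        using finF[OF n] by (intro sum.mono_neutral_cong_right) (auto simp: kloosterman_zeros_def)
      moreover have "card (Fq n - {0::'a}) = p ^ n - 1"
        using Fq_card(1)[OF n, where ?'a = 'a] finF[OF n] by (simp add: p_def)
      ultimately show ?thesis by (simp add: sum_subtractf)
    qed
    finally have "Re (\<Sum>c\<in>J. K c n) = real p * real (card (kloosterman_zeros n a)) - real (p ^ n - 1)"
      by simp
    hence "(\<Sum>c\<in>J. s c n) = real p * real (card (kloosterman_zeros n a)) - real (p ^ n - 1)"
      by (simp add: s_def)
    moreover have "real (p ^ n) \<le> real (p * card (kloosterman_zeros n a) + (8 * p + 5) * p ^ m)"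
      using kloosterman_zeros_lower_bound[OF m a odd] unfolding n_def p_def by (simp only: of_nat_le_iff)
    moreover have "real (p ^ n - 1) \<le> real (p ^ n)" by simp
    ultimately show ?thesis unfolding n_def by (simp only: of_nat_add of_nat_mult of_nat_power minus_mult_left[symmetric])
  qed
  have "1 \<in> J" by (simp add: J_def)
  hence "\<bar>s 1 1\<bar> \<le> 2 * sqrt (real p)"
    using weil_numbers_bound[of "real p" J s "real (8 * p + 5)" 1] p J s2 rec lower by simp
  moreover have "kloos 1 a = K 1 1" by (simp add: K_def)
  ultimately show ?thesis using K_real[OF \<open>1 \<in> J\<close>, of 1] by (simp add: p_def)
qed

end

section \<open>Kloosterman sums over the integers modulo a prime\<close>

definition unit_exp :: "int \<Rightarrow> int \<Rightarrow> complex" where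
  "unit_exp q x = cis (2 * pi * real_of_int x / real_of_int q)"

lemma unit_exp_add: "unit_exp q (x + y) = unit_exp q x * unit_exp q y"
  by (simp add: unit_exp_def cis_mult add_divide_distrib distrib_left)

lemma unit_exp_0 [simp]: "unit_exp q 0 = 1"
  by (simp add: unit_exp_def)

lemma norm_unit_exp [simp]: "cmod (unit_exp q x) = 1"
  by (simp add: unit_exp_def)

lemma cnj_unit_exp: "cnj (unit_exp q x) = unit_exp q (- x)"
  by (simp add: unit_exp_def cis_cnj)

lemma unit_exp_eq_1_iff:
  assumes "q > 0" shows "unit_exp q x = 1 \<longleftrightarrow> q dvd x"
proof
  assume "q dvd x"
  then obtain k where "x = q * k" by (elim dvdE)
  hence "2 * pi * real_of_int x / real_of_int q = 2 * pi * real_of_int k" using assms by simp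
  thus "unit_exp q x = 1" unfolding unit_exp_def using cis_multiple_2pi[of "real_of_int k"] by simp
next
  assume "unit_exp q x = 1"
  hence "cos (2 * pi * real_of_int x / real_of_int q) = 1"
    unfolding unit_exp_def by (metis cis.simps(1) one_complex.simps(1))
  then obtain k :: int where "2 * pi * real_of_int x / real_of_int q = real_of_int k * 2 * pi"
    using cos_one_2pi_int by blast
  hence "real_of_int x = real_of_int (k * q)" using assms by (simp add: field_simps)
  hence "x = k * q" by (simp only: of_int_eq_iff)
  thus "q dvd x" by simp
qed

lemma unit_exp_cong:
  assumes "q > 0" "[x = y] (mod q)"
  shows "unit_exp q x = unit_exp q y"
proof -
  have "unit_exp q (x - y) = 1" using assms by (simp add: unit_exp_eq_1_iff cong_iff_dvd_diff)
  thus ?thesis using unit_exp_add[of q "x - y" y] by simp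
qed

text \<open>For q = 1 this is {0} rather than empty, so that the Kloosterman sum modulo 1 is
  1.\<close>

definition units_mod :: "int \<Rightarrow> int set" where
  "units_mod q = {x \<in> {0..<q}. coprime x q}"

lemma finite_units_mod [simp]: "finite (units_mod q)"
  by (rule finite_subset[of _ "{0..<q}"]) (auto simp: units_mod_def)

definition kloosterman :: "int \<Rightarrow> int \<Rightarrow> int \<Rightarrow> complex" where
  "kloosterman q m n = (\<Sum>x\<in>units_mod q. unit_exp q (m * x + n * modular_inverse q x))"

definition weil_bound_at :: "nat \<Rightarrow> bool" where
  "weil_bound_at p \<longleftrightarrow> (\<forall>m n. \<not> int p dvd m \<longrightarrow> \<not> int p dvd n \<longrightarrow>
     cmod (kloosterman (int p) m n) \<le> 2 * sqrt (real p))"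

text \<open>The map \<open>of_int\<close> identifies the residues modulo p with the prime field.
  Taking \<psi>(x) = e(m x / p) and a = n/m turns \<psi>(x + a/x) into the phase with coefficients m
  and n.\<close>

lemma weil_bound_at_CHAR:
  assumes odd: "odd CHAR('a::{alg_closed_field,field_prime_char})"
  shows "weil_bound_at CHAR('a)"
  unfolding weil_bound_at_def
proof (intro allI impI)
  fix m n :: int
  define p where "p = CHAR('a)"
  assume m: "\<not> int CHAR('a) dvd m" and n: "\<not> int CHAR('a) dvd n"
  have p: "p > 1" "prime p" using CHAR_prime[where ?'a = 'a] prime_gt_1_nat unfolding p_def by blast+
  have eq_iff: "(of_int k :: 'a) = of_int l \<longleftrightarrow> [k = l] (mod int p)" for k l
    unfolding p_def by (rule of_int_eq_iff_cong_CHAR)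
  have zero_iff: "(of_int k :: 'a) = 0 \<longleftrightarrow> int p dvd k" for k
    using eq_iff[of k 0] by (simp add: cong_0_iff)
  have inj: "inj_on (of_int :: int \<Rightarrow> 'a) {0..<int p}"
    by (auto simp: inj_on_def eq_iff cong_less_imp_eq_int)
  have img: "of_int ` {0..<int p} = (Fq 1 :: 'a set)"
  proof (rule card_subset_eq)
    show "finite (Fq 1 :: 'a set)" by (rule Fq_card(2)) simp
    show "of_int ` {0..<int p} \<subseteq> (Fq 1 :: 'a set)" by (auto intro: Fq_of_int)
    show "card (of_int ` {0..<int p} :: 'a set) = card (Fq 1 :: 'a set)"
      using Fq_card(1)[of 1, where ?'a = 'a] inj by (simp add: card_image p_def)
  qed
  \<comment> \<open>On the prime field the value does not depend on the integer chosen to represent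
    x; elsewhere it is arbitrary.\<close>
  define \<psi> where "\<psi> = (\<lambda>x::'a. unit_exp (int p) (m * (SOME k. x = of_int k)))"
  have psi: "\<psi> (of_int k) = unit_exp (int p) (m * k)" for k
  proof -
    have "(of_int k :: 'a) = of_int (SOME l. (of_int k :: 'a) = of_int l)" by (rule someI[of _ k]) simp
    hence "[k = (SOME l. (of_int k :: 'a) = of_int l)] (mod int p)" by (simp only: eq_iff)
    hence "unit_exp (int p) (m * k) = unit_exp (int p) (m * (SOME l. (of_int k :: 'a) = of_int l))"
      using p by (intro unit_exp_cong cong_scalar_left) auto
    thus ?thesis by (simp add: \<psi>_def)
  qed
  interpret prime_field_character \<psi>
  proof
    fix x y :: 'a assume "x \<in> Fq 1" "y \<in> Fq 1"
    then obtain k l where kl: "x = of_int k" "y = of_int l" unfolding img[symmetric] by blast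
    show "\<psi> (x + y) = \<psi> x * \<psi> y"
      unfolding kl of_int_add[symmetric] psi by (simp add: distrib_left unit_exp_add)
  next
    show "\<psi> 0 = 1" using psi[of 0] by simp
    show "\<exists>x\<in>Fq 1. \<psi> x \<noteq> 1"
      using psi[of 1] m p by (intro bexI[of _ 1]) (auto simp: unit_exp_eq_1_iff p_def)
  qed
  define a where "a = (of_int n / of_int m :: 'a)"
  have a: "a \<in> Fq 1" "a \<noteq> 0"
    using m n zero_iff by (auto simp: a_def p_def intro!: Fq_divide Fq_of_int)
  have units: "units_mod (int p) = {0..<int p} - {0}"
  proof -
    have "coprime x (int p) \<longleftrightarrow> x \<noteq> 0" if "x \<in> {0..<int p}" for x
    proof -
      have "prime (int p)" using p by simp
      hence "coprime (int p) x \<longleftrightarrow> \<not> int p dvd x" by (metis coprime_absorb_left not_prime_unit prime_imp_coprime)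
      also have "\<dots> \<longleftrightarrow> x \<noteq> 0" using that zdvd_not_zless[of x "int p"] by (cases "x = 0") auto
      finally show ?thesis by (simp add: coprime_commute)
    qed
    thus ?thesis by (auto simp: units_mod_def)
  qed
  have "(Fq 1 - {0} :: 'a set) = of_int ` units_mod (int p)"
    unfolding units img[symmetric] by (subst inj_on_image_set_diff[OF inj]) (use p in auto)
  hence "kloos 1 a = (\<Sum>x\<in>units_mod (int p). \<psi> (of_int x + a / of_int x))"
    unfolding kloos_def frob_trace_def
    using sum.reindex[OF inj_on_subset[OF inj], of "units_mod (int p)" "\<lambda>x. \<psi> (x + a / x)"]
    by (simp add: units o_def)
  also have "\<dots> = kloosterman (int p) m n"
    unfolding kloosterman_def
  proof (intro sum.cong refl)
    fix x assume x: "x \<in> units_mod (int p)"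
    have inv: "of_int (modular_inverse (int p) y) = (1 / of_int y :: 'a)" if "coprime y (int p)" for y
    proof -
      have "[y * modular_inverse (int p) y = 1] (mod int p)" by (rule cong_modular_inverse1[OF that])
      hence eq: "(of_int y * of_int (modular_inverse (int p) y) :: 'a) = 1"
        using eq_iff[of "y * modular_inverse (int p) y" 1] by simp
      hence "(of_int y :: 'a) \<noteq> 0" by auto
      thus ?thesis using eq by (simp add: field_simps)
    qed
    have cm: "coprime m (int p)" using m p prime_imp_coprime[of "int p" m] by (simp add: p_def coprime_commute)
    have cx: "coprime x (int p)" using x by (simp add: units_mod_def)
    let ?k = "x + n * modular_inverse (int p) m * modular_inverse (int p) x"
    have "of_int x + a / of_int x = (of_int ?k :: 'a)"
      by (simp add: a_def inv[OF cm] inv[OF cx])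
    hence "\<psi> (of_int x + a / of_int x) = unit_exp (int p) (m * ?k)" by (simp only: psi)
    also have "\<dots> = unit_exp (int p) (m * x + n * modular_inverse (int p) x)"
    proof (rule unit_exp_cong)
      have "[m * modular_inverse (int p) m * (n * modular_inverse (int p) x) = 1 * (n * modular_inverse (int p) x)] (mod int p)"
        by (intro cong_mult cong_modular_inverse1 cm cong_refl)
      hence "[m * x + m * modular_inverse (int p) m * (n * modular_inverse (int p) x)
          = m * x + 1 * (n * modular_inverse (int p) x)] (mod int p)"
        by (intro cong_add cong_refl)
      thus "[m * ?k = m * x + n * modular_inverse (int p) x] (mod int p)"
        by (simp add: algebra_simps)
    qed (use p in auto)
    finally show "\<psi> (of_int x + a / of_int x) = unit_exp (int p) (m * x + n * modular_inverse (int p) x)" .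
  qed
  finally show "cmod (kloosterman (int CHAR('a)) m n) \<le> 2 * sqrt (real CHAR('a))"
    using weil_kloosterman_bound[OF a odd] by (simp add: p_def)
qed

text \<open>The bound above is available in every algebraically closed field of odd characteristic that
  exists as a type, but types cannot depend on a variable \<open>p\<close>. We therefore fix a type whose
  cardinality is a constant \<open>bad_prime\<close>, chosen to be a prime violating the bound if there is one:
  the bound at \<open>bad_prime\<close> then implies it at every odd prime.\<close>

definition bad_prime :: nat where
  "bad_prime = (SOME p. prime p \<and> odd p \<and> ((\<exists>q. prime q \<and> odd q \<and> \<not> weil_bound_at q) \<longrightarrow> \<not> weil_bound_at p))"

lemma bad_prime: "prime bad_prime" "odd bad_prime"
  and bad_prime_worst: "prime q \<Longrightarrow> odd q \<Longrightarrow> weil_bound_at bad_prime \<Longrightarrow> weil_bound_at q"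
proof -
  have "\<exists>p. prime p \<and> odd p \<and> ((\<exists>q. prime q \<and> odd q \<and> \<not> weil_bound_at q) \<longrightarrow> \<not> weil_bound_at p)"
  proof (cases "\<exists>q. prime q \<and> odd q \<and> \<not> weil_bound_at q")
    case False
    moreover have "prime (3::nat)" by simp
    ultimately show ?thesis by (intro exI[of _ 3]) auto
  qed blast
  from someI_ex[OF this, folded bad_prime_def]
  show "prime bad_prime" "odd bad_prime"
    "prime q \<Longrightarrow> odd q \<Longrightarrow> weil_bound_at bad_prime \<Longrightarrow> weil_bound_at q" by blast+
qed

typedef bad_prime_index = "{..<bad_prime}"
  using prime_gt_0_nat[OF bad_prime(1)] by blast

instance bad_prime_index :: prime_card
proof
  have "CARD(bad_prime_index) = bad_prime"
    using type_definition.card[OF type_definition_bad_prime_index] by simp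
  thus "prime CARD(bad_prime_index)" using bad_prime(1) by simp
qed

instance alg_closure :: (field_prime_char) field_prime_char
  by (rule field_prime_charI') simp

theorem weil_bound_prime:
  assumes "prime p" "odd p"
  shows "weil_bound_at p"
proof (rule bad_prime_worst[OF assms])
  have "CHAR(bad_prime_index mod_ring alg_closure) = bad_prime"
    using type_definition.card[OF type_definition_bad_prime_index] by simp
  thus "weil_bound_at bad_prime"
    using weil_bound_at_CHAR[where ?'a = "bad_prime_index mod_ring alg_closure"] bad_prime(2) by simp
qed

section \<open>Kloosterman sums modulo integers\<close>

text \<open>The maps g and h need to be mutually inverse on residue classes only. Reduction modulo q
  is hidden in the congruence hypotheses, so translations and modular inverses can be substituted
  unreduced.\<close>

lemma sum_residues_reindex:
  fixes F :: "int \<Rightarrow> complex"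
  assumes q: "q > 0" and F: "\<And>x y. [x = y] (mod q) \<Longrightarrow> F x = F y"
    and P: "\<And>x y. [x = y] (mod q) \<Longrightarrow> P x = P y"
    and g: "\<And>x y. P x \<Longrightarrow> [x = y] (mod q) \<Longrightarrow> [g x = g y] (mod q)"
    and h: "\<And>x y. P x \<Longrightarrow> [x = y] (mod q) \<Longrightarrow> [h x = h y] (mod q)"
    and gh: "\<And>x. P x \<Longrightarrow> [g (h x) = x] (mod q)" and hg: "\<And>x. P x \<Longrightarrow> [h (g x) = x] (mod q)"
    and Pg: "\<And>x. P x \<Longrightarrow> P (g x)" and Ph: "\<And>x. P x \<Longrightarrow> P (h x)"
  shows "(\<Sum>x\<in>{x \<in> {0..<q}. P x}. F (g x)) = (\<Sum>x\<in>{x \<in> {0..<q}. P x}. F x)"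
proof (rule sum.reindex_bij_witness[of _ "\<lambda>x. h x mod q" "\<lambda>x. g x mod q"])
  fix x assume x: "x \<in> {x \<in> {0..<q}. P x}"
  have m: "[y mod q = y] (mod q)" for y by simp
  have "[h (g x mod q) = h (g x)] (mod q)" using x Pg P[OF m] by (intro h m) auto
  hence "[h (g x mod q) = x] (mod q)" using hg[of x] x by (auto intro: cong_trans)
  thus "h (g x mod q) mod q = x" using x by (simp add: cong_def)
  have "[g (h x mod q) = g (h x)] (mod q)" using x Ph P[OF m] by (intro g m) auto
  hence "[g (h x mod q) = x] (mod q)" using gh[of x] x by (auto intro: cong_trans)
  thus "g (h x mod q) mod q = x" using x by (simp add: cong_def)
  show "g x mod q \<in> {x \<in> {0..<q}. P x}" "h x mod q \<in> {x \<in> {0..<q}. P x}"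
    using x q Pg Ph P[OF m] by auto
  show "F (g x mod q) = F (g x)" by (rule F[OF m])
qed

lemma sum_residues_shift:
  fixes F :: "int \<Rightarrow> complex"
  assumes q: "q > 0" and F: "\<And>x y. [x = y] (mod q) \<Longrightarrow> F x = F y"
  shows "(\<Sum>x\<in>{0..<q}. F (x + a)) = (\<Sum>x\<in>{0..<q}. F x)"
proof -
  have "{x \<in> {0..<q}. True} = {0..<q}" by auto
  moreover have "(\<Sum>x\<in>{x \<in> {0..<q}. True}. F (x + a)) = (\<Sum>x\<in>{x \<in> {0..<q}. True}. F x)"
    by (rule sum_residues_reindex[where g = "\<lambda>x. x + a" and h = "\<lambda>x. x - a", OF q F])
       (auto intro: cong_add cong_diff)
  ultimately show ?thesis by simp
qed

lemma coprime_cong_int: "[x = y] (mod q) \<Longrightarrow> coprime x q \<longleftrightarrow> coprime y (q::int)"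
  using cong_imp_coprime cong_sym by blast

lemma modular_inverse_cong:
  assumes "q > 0" "[x * y = 1] (mod q)"
  shows "[(modular_inverse q x) = (y::int)] (mod q)"
proof -
  have "coprime x q" using assms(2) using coprime_cong_int[OF assms(2)] by simp
  hence "[x * modular_inverse q x = 1] (mod q)" by (rule cong_modular_inverse1)
  hence "[x * modular_inverse q x = x * y] (mod q)" using assms(2) cong_sym cong_trans by blast
  thus ?thesis using \<open>coprime x q\<close> by (simp add: cong_mult_lcancel)
qed

lemma modular_inverse_cong_arg:
  assumes "q > 0" "coprime x q" "[x = y] (mod q)"
  shows "[(modular_inverse q x) = modular_inverse q (y::int)] (mod q)"
proof (rule modular_inverse_cong[OF assms(1)])
  have "coprime y q" using assms coprime_cong_int by blast
  hence "[y * modular_inverse q y = 1] (mod q)" by (rule cong_modular_inverse1)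
  moreover have "[x * modular_inverse q y = y * modular_inverse q y] (mod q)"
    using assms(3) by (intro cong_mult cong_refl)
  ultimately show "[x * modular_inverse q y = 1] (mod q)" by (rule cong_trans[rotated])
qed

lemma sum_units_reindex:
  fixes F :: "int \<Rightarrow> complex"
  assumes q: "q > 0" and F: "\<And>x y. [x = y] (mod q) \<Longrightarrow> F x = F y"
    and g: "\<And>x y. coprime x q \<Longrightarrow> [x = y] (mod q) \<Longrightarrow> [g x = g y] (mod q)"
    and h: "\<And>x y. coprime x q \<Longrightarrow> [x = y] (mod q) \<Longrightarrow> [h x = h y] (mod q)"
    and gh: "\<And>x. coprime x q \<Longrightarrow> [g (h x) = x] (mod q)" and hg: "\<And>x. coprime x q \<Longrightarrow> [h (g x) = x] (mod q)"
    and Pg: "\<And>x. coprime x q \<Longrightarrow> coprime (g x) q" and Ph: "\<And>x. coprime x q \<Longrightarrow> coprime (h x) q"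
  shows "(\<Sum>x\<in>units_mod q. F (g x)) = (\<Sum>x\<in>units_mod q. F x)"
  unfolding units_mod_def
  by (rule sum_residues_reindex[OF q F coprime_cong_int g h gh hg Pg Ph])

lemma sum_units_shift:
  fixes F :: "int \<Rightarrow> complex"
  assumes q: "q > 0" and F: "\<And>x y. [x = y] (mod q) \<Longrightarrow> F x = F y"
    and a: "\<And>x. coprime (x + a) q \<longleftrightarrow> coprime x q"
  shows "(\<Sum>x\<in>units_mod q. F (x + a)) = (\<Sum>x\<in>units_mod q. F x)"
  by (rule sum_units_reindex[of q F "\<lambda>x. x + a" "\<lambda>x. x - a", OF q F])
     (use a a[of "x - a" for x] in \<open>auto simp: cong_add_rcancel cong_diff\<close>)

lemma sum_unit_exp:
  assumes q: "q > 0"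
  shows "(\<Sum>v\<in>{0..<q}. unit_exp q (v * c)) = (if q dvd c then of_int q else 0)"
proof (cases "q dvd c")
  case True
  hence "unit_exp q (v * c) = 1" for v using q by (simp add: unit_exp_eq_1_iff)
  thus ?thesis using True q by simp
next
  case False
  have "(\<Sum>v\<in>{0..<q}. unit_exp q (v * c)) = (\<Sum>v\<in>{0..<q}. unit_exp q ((v + 1) * c))"
    by (rule sum_residues_shift[of q "\<lambda>v. unit_exp q (v * c)" 1, symmetric, OF q])
       (intro unit_exp_cong q cong_mult cong_refl)
  also have "\<dots> = unit_exp q c * (\<Sum>v\<in>{0..<q}. unit_exp q (v * c))"
    by (simp add: distrib_right unit_exp_add sum_distrib_left mult.commute[of _ "unit_exp q c"])
  finally have "(\<Sum>v\<in>{0..<q}. unit_exp q (v * c)) = 0 \<or> unit_exp q c = 1" by simp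
  thus ?thesis using False q by (simp add: unit_exp_eq_1_iff)
qed

text \<open>At residues that are not units, \<open>modular_inverse\<close> takes a fixed default
  value. The phase is thus a function of the residue class everywhere, as reindexing
  demands.\<close>

lemma kloosterman_phase_cong:
  assumes q: "q > 0" and xy: "[x = y] (mod q)"
  shows "unit_exp q (m * x + n * modular_inverse q x) = unit_exp q (m * y + n * modular_inverse q y)"
proof (cases "coprime x q")
  case True
  show ?thesis
    by (intro unit_exp_cong q cong_add cong_mult cong_refl xy modular_inverse_cong_arg True)
next
  case False
  hence "\<not> coprime y q" using coprime_cong_int[OF xy] by simp
  thus ?thesis using False xy by (auto intro!: unit_exp_cong q cong_mult)
qed

lemma card_units_mod_le: "q \<ge> 0 \<Longrightarrow> real (card (units_mod q)) \<le> real_of_int q"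
proof -
  assume "q \<ge> 0"
  have "card (units_mod q) \<le> card {0..<q}" by (rule card_mono) (auto simp: units_mod_def)
  thus ?thesis using \<open>q \<ge> 0\<close> by simp
qed

lemma kloosterman_trivial: "q \<ge> 0 \<Longrightarrow> cmod (kloosterman q m n) \<le> real_of_int q"
proof -
  assume q: "q \<ge> 0"
  have "cmod (kloosterman q m n) \<le> (\<Sum>x\<in>units_mod q. 1)"
    unfolding kloosterman_def by (intro sum_norm_le) simp
  thus ?thesis using card_units_mod_le[OF q] by simp
qed

lemma kloosterman_commute:
  assumes q: "q > 0"
  shows "kloosterman q m n = kloosterman q n m"
proof -
  let ?F = "\<lambda>x. unit_exp q (m * x + n * modular_inverse q x)"
  have inv2: "[(modular_inverse q (modular_inverse q x)) = x] (mod q)" if "coprime x q" for x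
    using that by (intro modular_inverse_cong q cong_modular_inverse2)
  have "kloosterman q m n = (\<Sum>x\<in>units_mod q. ?F (modular_inverse q x))"
    unfolding kloosterman_def
    by (rule sum_units_reindex[where g = "modular_inverse q" and h = "modular_inverse q", symmetric, OF q])
       (auto intro: kloosterman_phase_cong[OF q] modular_inverse_cong_arg[OF q] inv2)
  also have "\<dots> = kloosterman q n m"
    unfolding kloosterman_def
  proof (intro sum.cong refl)
    fix x assume "x \<in> units_mod q"
    hence "coprime x q" by (simp add: units_mod_def)
    have "[m * modular_inverse q x + n * modular_inverse q (modular_inverse q x)
        = m * modular_inverse q x + n * x] (mod q)"
      by (intro cong_add cong_mult cong_refl inv2 \<open>coprime x q\<close>)
    from unit_exp_cong[OF q this]
    show "?F (modular_inverse q x) = unit_exp q (n * x + m * modular_inverse q x)"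
      by (simp add: add.commute)
  qed
  finally show ?thesis .
qed

section \<open>Prime power moduli\<close>

text \<open>Averaging over the shifts \<open>x \<mapsto> x + M v\<close>, on which the phase is affine in \<open>v\<close> because
  \<open>q\<close> divides \<open>M\<^sup>2\<close>, restricts the Kloosterman sum to its stationary points.\<close>

lemma kloosterman_stationary:
  assumes q: "q = N * M" and pos: "N > 0" "M > 0" and NM: "N dvd M"
    and cop: "\<And>x v. coprime (x + M * v) q \<longleftrightarrow> coprime x q"
  shows "kloosterman q m n =
    (\<Sum>x\<in>{x \<in> units_mod q. N dvd m - n * (modular_inverse q x)\<^sup>2}. unit_exp q (m * x + n * modular_inverse q x))"
proof -
  let ?F = "\<lambda>x. unit_exp q (m * x + n * modular_inverse q x)"
  have q0: "q > 0" using q pos by simp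
  have phase: "?F (x + M * v) = ?F x * unit_exp N (v * (m - n * (modular_inverse q x)\<^sup>2))"
    if x: "coprime x q" for x v
  proof -
    define y where "y = modular_inverse q x"
    have xy: "[x * y = 1] (mod q)" unfolding y_def by (rule cong_modular_inverse1[OF x])
    \<comment> \<open>First-order expansion of the inverse, exact modulo q because q divides
      M^2.\<close>
    have "[(modular_inverse q (x + M * v)) = y - M * v * y\<^sup>2] (mod q)"
    proof (rule modular_inverse_cong[OF q0])
      have M2: "q dvd M * M" using NM q by (auto elim!: dvdE)
      have "(x + M * v) * (y - M * v * y\<^sup>2) - 1 = (x * y - 1) * (1 - M * v * y) - M * M * (v\<^sup>2 * y\<^sup>2)"
        by (simp add: power2_eq_square algebra_simps)
      moreover have "q dvd x * y - 1" using xy by (simp add: cong_iff_dvd_diff)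
      ultimately have "q dvd (x + M * v) * (y - M * v * y\<^sup>2) - 1"
        using M2 by (simp add: dvd_diff dvd_mult2)
      thus "[(x + M * v) * (y - M * v * y\<^sup>2) = 1] (mod q)" by (simp add: cong_iff_dvd_diff)
    qed
    hence "?F (x + M * v) = unit_exp q (m * (x + M * v) + n * (y - M * v * y\<^sup>2))"
      by (intro unit_exp_cong q0 cong_add cong_mult cong_refl)
    also have "m * (x + M * v) + n * (y - M * v * y\<^sup>2) = (m * x + n * y) + M * (v * (m - n * y\<^sup>2))"
      by (simp add: algebra_simps)
    also have "unit_exp q \<dots> = ?F x * unit_exp q (M * (v * (m - n * y\<^sup>2)))"
      by (simp add: unit_exp_add y_def)
    also have "unit_exp q (M * (v * (m - n * y\<^sup>2))) = unit_exp N (v * (m - n * y\<^sup>2))"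
      using pos by (simp add: unit_exp_def q mult_ac)
    finally show ?thesis by (simp add: y_def)
  qed
  have "of_int N * kloosterman q m n = (\<Sum>v\<in>{0..<N}. kloosterman q m n)" using pos by simp
  also have "\<dots> = (\<Sum>v\<in>{0..<N}. \<Sum>x\<in>units_mod q. ?F (x + M * v))"
    unfolding kloosterman_def
    by (intro sum.cong refl sum_units_shift[symmetric] q0 kloosterman_phase_cong cop)
  also have "\<dots> = (\<Sum>x\<in>units_mod q. \<Sum>v\<in>{0..<N}. ?F (x + M * v))" by (rule sum.swap)
  also have "\<dots> = (\<Sum>x\<in>units_mod q. ?F x * (if N dvd m - n * (modular_inverse q x)\<^sup>2 then of_int N else 0))"
  proof (intro sum.cong refl)
    fix x assume "x \<in> units_mod q"
    hence x: "coprime x q" by (simp add: units_mod_def)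
    show "(\<Sum>v\<in>{0..<N}. ?F (x + M * v)) = ?F x * (if N dvd m - n * (modular_inverse q x)\<^sup>2 then of_int N else 0)"
      unfolding phase[OF x] sum_distrib_left[symmetric] sum_unit_exp[OF pos(1)] ..
  qed
  also have "\<dots> = (\<Sum>x\<in>{x \<in> units_mod q. N dvd m - n * (modular_inverse q x)\<^sup>2}. ?F x * of_int N)"
    by (subst sum.inter_filter) (auto intro!: sum.cong)
  also have "\<dots> = of_int N * (\<Sum>x\<in>{x \<in> units_mod q. N dvd m - n * (modular_inverse q x)\<^sup>2}. ?F x)"
    by (simp add: sum_distrib_left mult.commute)
  finally show ?thesis using pos by simp
qed

text \<open>Multiplication by the unit x^2 removes the inverse and leaves a quadratic
  congruence.\<close>

lemma stationary_iff:
  fixes q N x :: int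
  assumes "q > 0" "N dvd q" "coprime x q"
  shows "N dvd m - n * (modular_inverse q x)\<^sup>2 \<longleftrightarrow> N dvd m * x\<^sup>2 - n"
proof -
  define y where "y = modular_inverse q x"
  have "[x * y = 1] (mod q)" unfolding y_def by (rule cong_modular_inverse1[OF assms(3)])
  hence xy: "[x * y = 1] (mod N)" using assms(2) cong_dvd_modulus by blast
  have "coprime x N" using assms(2,3) by (metis coprime_divisors dvd_refl)
  hence "N dvd m - n * y\<^sup>2 \<longleftrightarrow> N dvd (m - n * y\<^sup>2) * x\<^sup>2"
    by (metis coprime_commute coprime_dvd_mult_left_iff coprime_power_right_iff)
  also have "(m - n * y\<^sup>2) * x\<^sup>2 = (m * x\<^sup>2 - n) - n * ((x * y)\<^sup>2 - 1)"
    by (simp add: power2_eq_square algebra_simps)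
  also have "N dvd \<dots> \<longleftrightarrow> N dvd m * x\<^sup>2 - n"
  proof -
    have "[(x * y)\<^sup>2 = 1\<^sup>2] (mod N)" by (rule cong_pow[OF xy])
    hence "N dvd n * ((x * y)\<^sup>2 - 1)" by (simp add: cong_iff_dvd_diff)
    thus ?thesis using dvd_diff_left_iff[of N "n * ((x * y)\<^sup>2 - 1)"] by blast
  qed
  finally show ?thesis by (simp add: y_def)
qed

lemma prime_power_dvd_mult:
  fixes a b p :: int
  assumes p: "prime p" and d: "p ^ s dvd a * b"
  shows "\<exists>i j. i + j = s \<and> p ^ i dvd a \<and> p ^ j dvd b"
  using d
proof (induction s arbitrary: a b)
  case (Suc s)
  have "p dvd a * b" using Suc.prems dvd_trans[of p "p ^ Suc s"] by simp
  hence "p dvd a \<or> p dvd b" using p prime_dvd_mult_iff by blast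
  thus ?case
  proof
    assume "p dvd a"
    then obtain a' where a': "a = p * a'" by (elim dvdE)
    have "p ^ s dvd a' * b" using Suc.prems p by (simp add: a' mult.assoc prime_gt_0_int)
    then obtain i j where "i + j = s" "p ^ i dvd a'" "p ^ j dvd b" using Suc.IH by blast
    thus ?thesis by (intro exI[of _ "Suc i"] exI[of _ j]) (auto simp: a')
  next
    assume "p dvd b"
    then obtain b' where b': "b = p * b'" by (elim dvdE)
    have "p ^ s dvd a * b'" using Suc.prems p by (simp add: b' mult.left_commute prime_gt_0_int)
    then obtain i j where "i + j = s" "p ^ i dvd a" "p ^ j dvd b'" using Suc.IH by blast
    thus ?thesis by (intro exI[of _ i] exI[of _ "Suc j"]) (auto simp: b')
  qed
qed simp

text \<open>Distribute p^s over the factors x - y and x + y. The smaller power divides both, hence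
  2x, hence 2. The factor 2 in the conclusion covers p = 2, where a unit square may have four
  roots.\<close>

lemma prime_power_dvd_diff_squares:
  fixes x y p :: int
  assumes p: "prime p" and d: "p ^ s dvd x\<^sup>2 - y\<^sup>2" and x: "\<not> p dvd x"
  shows "p ^ s dvd 2 * (x - y) \<or> p ^ s dvd 2 * (x + y)"
proof -
  have "p ^ s dvd (x - y) * (x + y)" using d by (simp add: power2_eq_square algebra_simps)
  from prime_power_dvd_mult[OF p this] obtain i j
    where ij: "i + j = s" "p ^ i dvd x - y" "p ^ j dvd x + y" by blast
  have key: "p ^ k dvd 2" if "p ^ k dvd x - y" "p ^ k dvd x + y" for k
  proof -
    have "p ^ k dvd (x - y) + (x + y)" using that by (rule dvd_add)
    hence "p ^ k dvd 2 * x" by simp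
    moreover have "coprime (p ^ k) x" using p x by (simp add: prime_imp_coprime)
    ultimately show ?thesis by (simp add: coprime_dvd_mult_left_iff)
  qed
  show ?thesis
  proof (cases "i \<le> j")
    case True
    hence "p ^ i dvd x + y" using ij(3) by (meson dvd_trans le_imp_power_dvd)
    hence "p ^ i dvd 2" using key ij by blast
    hence "p ^ i * p ^ j dvd 2 * (x + y)" using ij(3) by (rule mult_dvd_mono)
    thus ?thesis using ij(1) by (simp add: power_add[symmetric])
  next
    case False
    hence "p ^ j dvd x - y" using ij(2) by (meson dvd_trans le_imp_power_dvd nat_le_linear)
    hence "p ^ j dvd 2" using key ij by blast
    hence "p ^ j * p ^ i dvd 2 * (x - y)" using ij(2) by (rule mult_dvd_mono)
    thus ?thesis using ij(1) by (simp add: power_add[symmetric] add.commute)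
  qed
qed

lemma card_dvd_double_le:
  fixes N z \<sigma> :: int
  assumes N: "N > 0" and \<sigma>: "\<sigma> = 1 \<or> \<sigma> = -1"
  shows "card {y \<in> {0..<N}. N dvd 2 * (z + \<sigma> * y)} \<le> 2"
proof -
  let ?S = "{y \<in> {0..<N}. N dvd 2 * (z + \<sigma> * y)}"
  show ?thesis
  proof (cases "?S = {}")
    case False
    then obtain y0 where y0: "y0 \<in> ?S" and min: "\<And>y. y \<in> ?S \<Longrightarrow> y0 \<le> y"
    proof -
      have "finite ?S" by (rule finite_subset[of _ "{0..<N}"]) auto
      thus thesis using that[of "Min ?S"] False by (metis (no_types, lifting) Min_in Min_le)
    qed
    have "?S \<subseteq> {y0, y0 + N div 2}"
    proof
      fix y assume y: "y \<in> ?S"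
      have "N dvd 2 * (z + \<sigma> * y)" "N dvd 2 * (z + \<sigma> * y0)" using y y0 by blast+
      hence "N dvd 2 * (z + \<sigma> * y) - 2 * (z + \<sigma> * y0)" by (rule dvd_diff)
      also have "2 * (z + \<sigma> * y) - 2 * (z + \<sigma> * y0) = \<sigma> * (2 * (y - y0))" by (simp add: algebra_simps)
      finally have "N dvd \<sigma> * (2 * (y - y0))" .
      hence "N dvd \<sigma> * (\<sigma> * (2 * (y - y0)))" by (rule dvd_mult)
      moreover have "\<sigma> * (\<sigma> * (2 * (y - y0))) = 2 * (y - y0)" using \<sigma> by auto
      ultimately have "N dvd 2 * (y - y0)" by (simp only:)
      then obtain k where k: "2 * (y - y0) = N * k" by (elim dvdE)
      have b: "0 \<le> y - y0" "y - y0 < N" using min[OF y] y y0 by auto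
      have "0 \<le> N * k" unfolding k[symmetric] using b by simp
      moreover have "N * k < N * 2" unfolding k[symmetric] using b by simp
      ultimately have "0 \<le> k" "k < 2" using N by (simp_all add: zero_le_mult_iff)
      hence "k = 0 \<or> k = 1" by linarith
      thus "y \<in> {y0, y0 + N div 2}" using k by auto
    qed
    hence "card ?S \<le> card {y0, y0 + N div 2}" by (intro card_mono) auto
    also have "\<dots> \<le> 2" by (simp add: card_insert_if)
    finally show ?thesis .
  next
    case True
    show ?thesis unfolding True by simp
  qed
qed

text \<open>Two solutions have squares that agree modulo p^s; each of the two signs then allows at
  most two residues, because of the factor 2.\<close>

lemma card_sqrt_mod_prime_power_le:
  fixes p m n :: int
  assumes p: "prime p" and m: "\<not> p dvd m"
  shows "card {x \<in> {0..<p ^ s}. \<not> p dvd x \<and> p ^ s dvd m * x\<^sup>2 - n} \<le> 4"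
proof -
  let ?S = "{x \<in> {0..<p ^ s}. \<not> p dvd x \<and> p ^ s dvd m * x\<^sup>2 - n}"
  show ?thesis
  proof (cases "?S = {}")
    case False
    then obtain x where x: "x \<in> ?S" by blast
    let ?A = "\<lambda>\<sigma>::int. {y \<in> {0..<p ^ s}. p ^ s dvd 2 * (x + \<sigma> * y)}"
    have pos: "p ^ s > 0" using p by (simp add: prime_gt_0_int)
    have fin: "finite (?A \<sigma>)" for \<sigma> by (rule finite_subset[of _ "{0..<p ^ s}"]) auto
    have "?S \<subseteq> ?A 1 \<union> ?A (-1)"
    proof
      fix y assume y: "y \<in> ?S"
      have "p ^ s dvd m * x\<^sup>2 - n" "p ^ s dvd m * y\<^sup>2 - n" using x y by blast+
      hence "p ^ s dvd (m * x\<^sup>2 - n) - (m * y\<^sup>2 - n)" by (rule dvd_diff)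
      hence "p ^ s dvd m * (x\<^sup>2 - y\<^sup>2)" by (simp add: algebra_simps)
      moreover have "coprime (p ^ s) m" using p m by (simp add: prime_imp_coprime)
      ultimately have "p ^ s dvd x\<^sup>2 - y\<^sup>2" by (simp add: coprime_dvd_mult_right_iff)
      from prime_power_dvd_diff_squares[OF p this] x y show "y \<in> ?A 1 \<union> ?A (-1)" by auto
    qed
    hence "card ?S \<le> card (?A 1 \<union> ?A (-1))" by (intro card_mono finite_UnI fin)
    also have "\<dots> \<le> card (?A 1) + card (?A (-1))" by (rule card_Un_le)
    also have "\<dots> \<le> 2 + 2" by (intro add_mono card_dvd_double_le pos) auto
    finally show ?thesis by simp
  next
    case True
    show ?thesis unfolding True by simp
  qed
qed

lemma card_lift_residues_le:
  fixes N M :: int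
  assumes N: "N > 0" "M > 0" and P: "\<And>x y. [x = y] (mod N) \<Longrightarrow> P x \<Longrightarrow> P y"
  shows "real (card {x \<in> {0..<N * M}. P x}) \<le> real_of_int M * real (card {x \<in> {0..<N}. P x})"
proof -
  let ?S = "{x \<in> {0..<N}. P x}"
  have fin: "finite (?S \<times> {0..<M})" by (intro finite_cartesian_product finite_subset[of ?S "{0..<N}"]) auto
  have "{x \<in> {0..<N * M}. P x} \<subseteq> (\<lambda>(u, v). u + N * v) ` (?S \<times> {0..<M})"
  proof
    fix x assume x: "x \<in> {x \<in> {0..<N * M}. P x}"
    have "x mod N \<in> ?S" using x N P[of x "x mod N"] by simp
    moreover have "x div N \<in> {0..<M}"
    proof -
      have "N * (x div N) + x mod N = x" by simp
      moreover have "0 \<le> x mod N" using N by simp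
      moreover have "x < N * M" using x by simp
      ultimately have "N * (x div N) < N * M" by linarith
      thus ?thesis using x N by (simp add: pos_imp_zdiv_nonneg_iff)
    qed
    moreover have "x = x mod N + N * (x div N)" by simp
    ultimately show "x \<in> (\<lambda>(u, v). u + N * v) ` (?S \<times> {0..<M})" by (intro image_eqI[of _ _ "(x mod N, x div N)"]) auto
  qed
  hence "card {x \<in> {0..<N * M}. P x} \<le> card ((\<lambda>(u, v). u + N * v) ` (?S \<times> {0..<M}))"
    using fin by (intro card_mono) auto
  also have "\<dots> \<le> card (?S \<times> {0..<M})" by (rule card_image_le[OF fin])
  also have "\<dots> = card ?S * nat M" by (simp add: card_cartesian_product)
  finally have "real (card {x \<in> {0..<N * M}. P x}) \<le> real (card ?S * nat M)" by (simp only: of_nat_le_iff)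
  thus ?thesis using N by (simp add: mult.commute)
qed

lemma coprime_prime_power_iff:
  fixes p x :: int
  assumes "prime p" "r > 0"
  shows "coprime x (p ^ r) \<longleftrightarrow> \<not> p dvd x"
proof -
  have "coprime x (p ^ r) \<longleftrightarrow> coprime x p" using assms(2) by simp
  also have "\<dots> \<longleftrightarrow> \<not> p dvd x"
    using assms(1) prime_imp_coprime[of p x] by (auto simp: coprime_commute coprime_absorb_left)
  finally show ?thesis .
qed

definition stationary_points :: "int \<Rightarrow> nat \<Rightarrow> nat \<Rightarrow> int \<Rightarrow> int \<Rightarrow> int set" where
  "stationary_points p r s m n = {x \<in> units_mod (p ^ r). p ^ s dvd m - n * (modular_inverse (p ^ r) x)\<^sup>2}"

text \<open>If p divides m, a stationary point would force p to divide n as well. Otherwise there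
  are at most 4 classes modulo p^s, each with p^(r - s) lifts modulo p^r.\<close>

lemma card_stationary_points_le:
  fixes p m n :: int
  assumes p: "prime p" and s: "s > 0" "s \<le> r" and mn: "\<not> (p dvd m \<and> p dvd n)"
  shows "real (card (stationary_points p r s m n)) \<le> 4 * real_of_int p ^ (r - s)"
proof -
  have p0: "p > 0" using p by (rule prime_gt_0_int)
  have r: "r > 0" using s by simp
  have q: "p ^ r = p ^ s * p ^ (r - s)" using s by (simp flip: power_add)
  have X: "stationary_points p r s m n = {x \<in> {0..<p ^ s * p ^ (r - s)}. \<not> p dvd x \<and> p ^ s dvd m * x\<^sup>2 - n}"
  proof -
    have "(x \<in> {0..<p ^ r} \<and> coprime x (p ^ r)) \<and> p ^ s dvd m - n * (modular_inverse (p ^ r) x)\<^sup>2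
       \<longleftrightarrow> x \<in> {0..<p ^ r} \<and> \<not> p dvd x \<and> p ^ s dvd m * x\<^sup>2 - n" for x
      using stationary_iff[of "p ^ r" "p ^ s" x m n] coprime_prime_power_iff[OF p r, of x] p0 s
      by (auto simp: le_imp_power_dvd)
    thus ?thesis unfolding stationary_points_def units_mod_def q[symmetric] by blast
  qed
  show ?thesis
  proof (cases "p dvd m")
    case True
    have "stationary_points p r s m n = {}"
    proof (rule ccontr)
      assume "stationary_points p r s m n \<noteq> {}"
      then obtain x where "p ^ s dvd m * x\<^sup>2 - n" unfolding X by blast
      hence "p dvd m * x\<^sup>2 - n" using s dvd_trans[of p "p ^ s"] by (simp add: dvd_power)
      moreover have "p dvd m * x\<^sup>2" using True by simp
      ultimately have "p dvd n" by (metis dvd_diff_right_iff)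
      thus False using True mn by simp
    qed
    thus ?thesis using p0 by simp
  next
    case False
    have cong_dvd: "p dvd x \<longleftrightarrow> p dvd y" "p ^ s dvd m * x\<^sup>2 - n \<longleftrightarrow> p ^ s dvd m * y\<^sup>2 - n"
      if "[x = y] (mod p ^ s)" for x y
    proof -
      have "[x = y] (mod p)" using that s by (meson cong_dvd_modulus dvd_power dvd_refl)
      thus "p dvd x \<longleftrightarrow> p dvd y" by (rule cong_dvd_iff)
      have "[m * x\<^sup>2 - n = m * y\<^sup>2 - n] (mod p ^ s)" using that by (intro cong_diff cong_mult cong_pow cong_refl)
      thus "p ^ s dvd m * x\<^sup>2 - n \<longleftrightarrow> p ^ s dvd m * y\<^sup>2 - n" by (rule cong_dvd_iff)
    qed
    have "real (card (stationary_points p r s m n))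
        \<le> real_of_int (p ^ (r - s)) * real (card {x \<in> {0..<p ^ s}. \<not> p dvd x \<and> p ^ s dvd m * x\<^sup>2 - n})"
      unfolding X using p0 cong_dvd by (intro card_lift_residues_le) auto
    also have "\<dots> \<le> real_of_int (p ^ (r - s)) * 4"
      using card_sqrt_mod_prime_power_le[OF p False, of s n] p0 by (intro mult_left_mono) auto
    finally show ?thesis by simp
  qed
qed

lemma coprime_shift_prime_power:
  fixes p x a :: int
  assumes "prime p" "r > 0" "p dvd a"
  shows "coprime (x + a) (p ^ r) \<longleftrightarrow> coprime x (p ^ r)"
  unfolding coprime_prime_power_iff[OF assms(1,2)] using assms(3) by (simp add: dvd_add_left_iff)

lemma kloosterman_prime_power_stationary:
  fixes p m n :: int
  assumes p: "prime p" and s: "s > 0" "2 * s \<le> r"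
  shows "kloosterman (p ^ r) m n = (\<Sum>x\<in>stationary_points p r s m n.
    unit_exp (p ^ r) (m * x + n * modular_inverse (p ^ r) x))"
  unfolding stationary_points_def
proof (rule kloosterman_stationary[of _ _ "p ^ (r - s)"])
  have p0: "p > 0" using p by (rule prime_gt_0_int)
  show "p ^ r = p ^ s * p ^ (r - s)" using s by (simp flip: power_add)
  show "p ^ s > 0" "p ^ (r - s) > 0" using p0 by auto
  show "p ^ s dvd p ^ (r - s)" using s by (intro le_imp_power_dvd) simp
  show "coprime (x + p ^ (r - s) * v) (p ^ r) \<longleftrightarrow> coprime x (p ^ r)" for x v
    using p s by (intro coprime_shift_prime_power) (auto intro!: dvd_mult2 dvd_power)
qed

lemma kloosterman_even_prime_power:
  fixes p m n :: int
  assumes p: "prime p" and s: "s > 0" and mn: "\<not> (p dvd m \<and> p dvd n)"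
  shows "cmod (kloosterman (p ^ (2 * s)) m n) \<le> 4 * real_of_int p ^ s"
proof -
  have "cmod (kloosterman (p ^ (2 * s)) m n) \<le> (\<Sum>x\<in>stationary_points p (2 * s) s m n. 1)"
    unfolding kloosterman_prime_power_stationary[OF p s, of "2 * s" m n, simplified]
    by (intro sum_norm_le) simp
  also have "\<dots> \<le> 4 * real_of_int p ^ (2 * s - s)"
    using card_stationary_points_le[OF p s _ mn, of "2 * s"] by simp
  finally show ?thesis by simp
qed

text \<open>Squaring and substituting t + u for t makes the phase linear in u, so only t with p
  dividing 2t survive. For p = 2 these are both residues, whence the 2 under the root.\<close>

lemma gauss_sum_bound:
  fixes p c d :: int
  assumes p: "prime p" and d: "\<not> p dvd d"
  shows "cmod (\<Sum>t\<in>{0..<p}. unit_exp p (c * t + d * t\<^sup>2)) \<le> sqrt (2 * real_of_int p)"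
proof -
  have p0: "p > 0" using p by (rule prime_gt_0_int)
  define G where "G = (\<Sum>t\<in>{0..<p}. unit_exp p (c * t + d * t\<^sup>2))"
  let ?f = "\<lambda>t. unit_exp p (c * t + d * t\<^sup>2)"
  have f_cong: "?f x = ?f y" if "[x = y] (mod p)" for x y
    using that by (intro unit_exp_cong p0 cong_add cong_mult cong_pow cong_refl)
  have "complex_of_real ((cmod G)\<^sup>2) = G * cnj G" by (rule complex_norm_square)
  also have "\<dots> = (\<Sum>u\<in>{0..<p}. (\<Sum>t\<in>{0..<p}. ?f t) * cnj (?f u))"
    unfolding G_def cnj_sum sum_distrib_left ..
  also have "\<dots> = (\<Sum>u\<in>{0..<p}. \<Sum>t\<in>{0..<p}. ?f (t + u) * cnj (?f u))"
    unfolding sum_distrib_right[symmetric]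
    by (intro sum.cong refl arg_cong2[of _ _ _ _ "(*)"] sum_residues_shift[symmetric] p0 f_cong)
  also have "\<dots> = (\<Sum>u\<in>{0..<p}. \<Sum>t\<in>{0..<p}. ?f t * unit_exp p (u * (2 * d * t)))"
  proof (intro sum.cong refl)
    fix u t :: int
    have "(c * (t + u) + d * (t + u)\<^sup>2) + - (c * u + d * u\<^sup>2) = (c * t + d * t\<^sup>2) + u * (2 * d * t)"
      by (simp add: power2_eq_square algebra_simps)
    thus "?f (t + u) * cnj (?f u) = ?f t * unit_exp p (u * (2 * d * t))"
      unfolding cnj_unit_exp unit_exp_add[symmetric] by simp
  qed
  also have "\<dots> = (\<Sum>t\<in>{0..<p}. \<Sum>u\<in>{0..<p}. ?f t * unit_exp p (u * (2 * d * t)))" by (rule sum.swap)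
  also have "\<dots> = (\<Sum>t\<in>{0..<p}. ?f t * (if p dvd 2 * d * t then of_int p else 0))"
    unfolding sum_distrib_left[symmetric] sum_unit_exp[OF p0] ..
  finally have eq: "complex_of_real ((cmod G)\<^sup>2) = (\<Sum>t\<in>{0..<p}. ?f t * (if p dvd 2 * d * t then of_int p else 0))" .
  have "(cmod G)\<^sup>2 = cmod (complex_of_real ((cmod G)\<^sup>2))" by (simp only: norm_of_real) simp
  also have "\<dots> \<le> (\<Sum>t\<in>{0..<p}. if p dvd 2 * t then real_of_int p else 0)"
    unfolding eq
  proof (rule sum_norm_le)
    fix t
    have "p dvd 2 * d * t \<longleftrightarrow> p dvd 2 * t"
      using p d by (simp add: prime_dvd_mult_iff)
    thus "cmod (?f t * (if p dvd 2 * d * t then of_int p else 0)) \<le> (if p dvd 2 * t then real_of_int p else 0)"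
      using p0 by (simp add: norm_mult)
  qed
  also have "\<dots> = real_of_int p * real (card {t \<in> {0..<p}. p dvd 2 * t})"
    by (subst sum.inter_filter[symmetric]) auto
  also have "\<dots> \<le> real_of_int p * 2"
    using card_dvd_double_le[OF p0, of 1 0] p0 by (intro mult_left_mono) auto
  finally have "(cmod G)\<^sup>2 \<le> 2 * real_of_int p" by simp
  thus ?thesis unfolding G_def by (rule real_le_rsqrt)
qed

text \<open>Counting the stationary points of level s alone gives 4 p^(s + 1), too large by sqrt p.
  They are invariant under the shifts x + p^s t, along which the phase is quadratic in t, and the
  resulting Gauss sums recover the missing factor.\<close>

lemma kloosterman_odd_prime_power:
  fixes p m n :: int
  assumes p: "prime p" and s: "s > 0" and mn: "\<not> (p dvd m \<and> p dvd n)"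
  shows "cmod (kloosterman (p ^ (2 * s + 1)) m n) \<le> 4 * real_of_int p ^ s * sqrt (2 * real_of_int p)"
proof -
  define q where "q = p ^ (2 * s + 1)"
  define V where "V = stationary_points p (2 * s + 1) s m n"
  let ?y = "\<lambda>x. modular_inverse q x"
  let ?f = "\<lambda>x. unit_exp q (m * x + n * ?y x)"
  let ?P = "\<lambda>x. p ^ s dvd m - n * (?y x)\<^sup>2"
  \<comment> \<open>Extension by zero from the stationary points to all units, so that the shifts
    act on a sum over the whole unit group.\<close>
  define F where "F = (\<lambda>x. if ?P x then ?f x else 0)"
  have p0: "p > 0" using p by (rule prime_gt_0_int)
  have q0: "q > 0" using p0 by (simp add: q_def)
  have psq: "p ^ s dvd q" unfolding q_def by (intro le_imp_power_dvd) simp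
  have V: "V = {x \<in> units_mod q. ?P x}" by (simp add: V_def stationary_points_def q_def)
  have finX: "finite V" unfolding V by (rule finite_subset[OF _ finite_units_mod[of q]]) blast
  have P_cong: "?P x \<longleftrightarrow> ?P x'" if "[(?y x) = ?y x'] (mod p ^ s)" for x x'
  proof (rule cong_dvd_iff)
    show "[m - n * (?y x)\<^sup>2 = m - n * (?y x')\<^sup>2] (mod p ^ s)"
      using that by (intro cong_diff cong_mult cong_pow cong_refl)
  qed
  have F_cong: "F x = F x'" if "[x = x'] (mod q)" for x x'
  proof (cases "coprime x q")
    case True
    have "[(?y x) = ?y x'] (mod q)" by (rule modular_inverse_cong_arg[OF q0 True that])
    hence "[(?y x) = ?y x'] (mod p ^ s)" using psq cong_dvd_modulus by blast
    from P_cong[OF this] show ?thesis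
      unfolding F_def using kloosterman_phase_cong[OF q0 that] by simp
  next
    case False
    hence "\<not> coprime x' q" using coprime_cong_int[OF that] by simp
    thus ?thesis unfolding F_def using False kloosterman_phase_cong[OF q0 that, of m n] by simp
  qed
  have shift: "?P (x + p ^ s * t) \<longleftrightarrow> ?P x"
    "?P x \<Longrightarrow> ?f (x + p ^ s * t) = ?f x * unit_exp p ((m - n * (?y x)\<^sup>2) div p ^ s * t + n * (?y x) ^ 3 * t\<^sup>2)"
    if x: "coprime x q" for x t
  proof -
    define y h where "y = ?y x" and "h = p ^ s * t"
    have xy: "[x * y = 1] (mod q)" unfolding y_def by (rule cong_modular_inverse1[OF x])
    \<comment> \<open>Second-order expansion of the inverse; the cubic remainder vanishes modulo q
      since 3s \<ge> 2s + 1.\<close>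
    have inv: "[(?y (x + h)) = y - h * y\<^sup>2 + h\<^sup>2 * y ^ 3] (mod q)"
    proof (rule modular_inverse_cong[OF q0])
      have "p ^ (2 * s + 1) dvd p ^ (3 * s)" using s by (intro le_imp_power_dvd) simp
      hence h3: "q dvd h ^ 3" by (simp add: q_def h_def power_mult_distrib power_mult[symmetric] mult.commute dvd_mult)
      have "(x + h) * (y - h * y\<^sup>2 + h\<^sup>2 * y ^ 3) - 1 = (x * y - 1) * (1 - h * y + h\<^sup>2 * y\<^sup>2) + h ^ 3 * y ^ 3"
        by (simp add: power2_eq_square power3_eq_cube algebra_simps)
      moreover have "q dvd x * y - 1" using xy by (simp add: cong_iff_dvd_diff)
      ultimately have "q dvd (x + h) * (y - h * y\<^sup>2 + h\<^sup>2 * y ^ 3) - 1"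
        using h3 by (simp add: dvd_mult2)
      thus "[(x + h) * (y - h * y\<^sup>2 + h\<^sup>2 * y ^ 3) = 1] (mod q)" by (simp add: cong_iff_dvd_diff)
    qed
    have "[(?y (x + h)) = ?y x] (mod p ^ s)"
    proof -
      have "[(?y (x + h)) = y - h * y\<^sup>2 + h\<^sup>2 * y ^ 3] (mod p ^ s)" using inv psq cong_dvd_modulus by blast
      also have "[y - h * y\<^sup>2 + h\<^sup>2 * y ^ 3 = y] (mod p ^ s)"
      proof -
        have "y - h * y\<^sup>2 + h\<^sup>2 * y ^ 3 - y = p ^ s * (t * (h * y ^ 3 - y\<^sup>2))"
          by (simp add: h_def power2_eq_square algebra_simps)
        thus ?thesis by (simp add: cong_iff_dvd_diff)
      qed
      finally show ?thesis by (simp add: y_def)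
    qed
    thus "?P (x + p ^ s * t) \<longleftrightarrow> ?P x" unfolding h_def[symmetric] by (rule P_cong)
    assume "?P x"
    then obtain c where c: "m - n * y\<^sup>2 = p ^ s * c" unfolding y_def by (elim dvdE)
    have "?f (x + h) = unit_exp q (m * (x + h) + n * (y - h * y\<^sup>2 + h\<^sup>2 * y ^ 3))"
      by (intro unit_exp_cong q0 cong_add cong_mult cong_refl inv)
    also have "m * (x + h) + n * (y - h * y\<^sup>2 + h\<^sup>2 * y ^ 3) = (m * x + n * y) + (h * (m - n * y\<^sup>2) + n * h\<^sup>2 * y ^ 3)"
      by (simp add: algebra_simps)
    also have "h * (m - n * y\<^sup>2) + n * h\<^sup>2 * y ^ 3 = p ^ (2 * s) * (c * t + n * y ^ 3 * t\<^sup>2)"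
    proof -
      have h2: "p ^ (2 * s) = p ^ s * p ^ s" by (simp add: mult_2 power_add)
      show ?thesis unfolding c h2 h_def by (simp add: power2_eq_square algebra_simps)
    qed
    also have "unit_exp q ((m * x + n * y) + p ^ (2 * s) * (c * t + n * y ^ 3 * t\<^sup>2))
        = ?f x * unit_exp q (p ^ (2 * s) * (c * t + n * y ^ 3 * t\<^sup>2))"
      by (simp only: unit_exp_add y_def)
    also have "unit_exp q (p ^ (2 * s) * (c * t + n * y ^ 3 * t\<^sup>2)) = unit_exp p (c * t + n * y ^ 3 * t\<^sup>2)"
    proof -
      have "real_of_int (p ^ (2 * s) * z) / real_of_int q = real_of_int z / real_of_int p" for z
        using p0 by (simp add: q_def)
      thus ?thesis unfolding unit_exp_def times_divide_eq_right[symmetric] by (simp only:)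
    qed
    also have "c = (m - n * y\<^sup>2) div p ^ s" using p0 by (simp add: c)
    finally show "?f (x + p ^ s * t) = ?f x * unit_exp p ((m - n * (?y x)\<^sup>2) div p ^ s * t + n * (?y x) ^ 3 * t\<^sup>2)"
      by (simp only: h_def y_def)
  qed
  have "kloosterman q m n = (\<Sum>x\<in>V. ?f x)"
    unfolding V_def q_def by (rule kloosterman_prime_power_stationary[OF p s]) simp
  also have "\<dots> = (\<Sum>x\<in>units_mod q. F x)"
    unfolding V F_def by (rule sum.inter_filter) simp
  finally have KF: "kloosterman q m n = (\<Sum>x\<in>units_mod q. F x)" .
  have "of_int p * kloosterman q m n = (\<Sum>t\<in>{0..<p}. kloosterman q m n)" using p0 by simp
  also have "\<dots> = (\<Sum>t\<in>{0..<p}. \<Sum>x\<in>units_mod q. F (x + p ^ s * t))"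
    unfolding KF
  proof (rule sum.cong[OF refl])
    fix t
    have cop: "coprime (x + p ^ s * t) q \<longleftrightarrow> coprime x q" for x
      unfolding q_def using s by (intro coprime_shift_prime_power p) (auto intro!: dvd_mult2 dvd_power)
    have "(\<Sum>x\<in>units_mod q. F (x + p ^ s * t)) = (\<Sum>x\<in>units_mod q. F x)"
      by (rule sum_units_shift[where F = F and a = "p ^ s * t", OF q0 F_cong cop])
    thus "(\<Sum>x\<in>units_mod q. F x) = (\<Sum>x\<in>units_mod q. F (x + p ^ s * t))" by (rule sym)
  qed
  also have "\<dots> = (\<Sum>x\<in>units_mod q. \<Sum>t\<in>{0..<p}. F (x + p ^ s * t))" by (rule sum.swap)
  also have "\<dots> = (\<Sum>x\<in>V. \<Sum>t\<in>{0..<p}. F (x + p ^ s * t))"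
  proof (rule sum.mono_neutral_right)
    show "\<forall>x\<in>units_mod q - V. (\<Sum>t\<in>{0..<p}. F (x + p ^ s * t)) = 0"
    proof
      fix x assume x: "x \<in> units_mod q - V"
      hence "coprime x q" "\<not> ?P x" unfolding V by (auto simp: units_mod_def)
      hence "F (x + p ^ s * t) = 0" for t unfolding F_def using shift(1) by simp
      thus "(\<Sum>t\<in>{0..<p}. F (x + p ^ s * t)) = 0" by simp
    qed
  qed (auto simp: V)
  finally have avg: "of_int p * kloosterman q m n = (\<Sum>x\<in>V. \<Sum>t\<in>{0..<p}. F (x + p ^ s * t))" .
  have "real_of_int p * cmod (kloosterman q m n) = cmod (of_int p * kloosterman q m n)"
    using p0 by (simp add: norm_mult)
  also have "\<dots> = cmod (\<Sum>x\<in>V. \<Sum>t\<in>{0..<p}. F (x + p ^ s * t))" unfolding avg ..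
  also have "\<dots> \<le> (\<Sum>x\<in>V. sqrt (2 * real_of_int p))"
  proof (rule sum_norm_le)
    fix x assume "x \<in> V"
    hence x: "x \<in> units_mod q" "coprime x q" "?P x" unfolding V by (auto simp: units_mod_def)
    \<comment> \<open>The quadratic coefficient is a unit: if p divided n, stationarity would make p
      divide m too.\<close>
    have nn: "\<not> p dvd n * (?y x) ^ 3"
    proof
      assume "p dvd n * (?y x) ^ 3"
      moreover have "\<not> p dvd ?y x"
        using coprime_modular_inverse[OF x(2)] coprime_prime_power_iff[OF p, of "2 * s + 1"] by (simp add: q_def)
      ultimately have pn: "p dvd n" using p by (auto simp: prime_dvd_mult_iff dest: prime_dvd_power)
      have "p dvd m - n * (?y x)\<^sup>2" using x(3) s dvd_trans[of p "p ^ s"] by (simp add: dvd_power)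
      moreover have "p dvd n * (?y x)\<^sup>2" using pn by simp
      ultimately have "p dvd (m - n * (?y x)\<^sup>2) + n * (?y x)\<^sup>2" by (rule dvd_add)
      hence "p dvd m" by simp
      thus False using pn mn by simp
    qed
    have "(\<Sum>t\<in>{0..<p}. F (x + p ^ s * t))
        = (\<Sum>t\<in>{0..<p}. ?f x * unit_exp p ((m - n * (?y x)\<^sup>2) div p ^ s * t + n * (?y x) ^ 3 * t\<^sup>2))"
      using x shift by (intro sum.cong refl) (simp add: F_def)
    also have "cmod \<dots> \<le> sqrt (2 * real_of_int p)"
      unfolding sum_distrib_left[symmetric] norm_mult norm_unit_exp using gauss_sum_bound[OF p nn] by simp
    finally show "cmod (\<Sum>t\<in>{0..<p}. F (x + p ^ s * t)) \<le> sqrt (2 * real_of_int p)" .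
  qed
  also have "\<dots> = real (card V) * sqrt (2 * real_of_int p)" by simp
  also have "\<dots> \<le> 4 * real_of_int p ^ (2 * s + 1 - s) * sqrt (2 * real_of_int p)"
    unfolding V_def using p0 by (intro mult_right_mono card_stationary_points_le[OF p s _ mn]) auto
  also have "2 * s + 1 - s = Suc s" by simp
  finally have "real_of_int p * cmod (kloosterman q m n) \<le> real_of_int p * (4 * real_of_int p ^ s * sqrt (2 * real_of_int p))"
    by (simp add: mult_ac)
  thus ?thesis using p0 by (simp add: q_def)
qed

lemma units_mod_prime: "prime p \<Longrightarrow> units_mod p = {0..<p} - {0}"
proof -
  assume p: "prime p"
  have "coprime x p \<longleftrightarrow> \<not> p dvd x" for x using coprime_prime_power_iff[OF p, of 1 x] by simp
  moreover have "p dvd x \<longleftrightarrow> x = 0" if "x \<in> {0..<p}" for x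
    using that zdvd_not_zless[of x p] by (cases "x = 0") auto
  ultimately show ?thesis by (auto simp: units_mod_def)
qed

lemma kloosterman_ramanujan:
  fixes p m n :: int
  assumes p: "prime p" and m: "\<not> p dvd m" and n: "p dvd n"
  shows "kloosterman p m n = -1"
proof -
  have p0: "p > 0" using p by (rule prime_gt_0_int)
  have "kloosterman p m n = (\<Sum>x\<in>{0..<p} - {0}. unit_exp p (x * m))"
    unfolding kloosterman_def units_mod_prime[OF p]
    using n by (intro sum.cong refl unit_exp_cong p0) (auto simp: cong_iff_dvd_diff mult.commute)
  also have "\<dots> = (\<Sum>x\<in>{0..<p}. unit_exp p (x * m)) - 1"
    using p0 by (subst sum_diff1) auto
  finally show ?thesis using m by (simp add: sum_unit_exp[OF p0])
qed

lemma kloosterman_prime: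
  fixes p m n :: int
  assumes p: "prime p" and mn: "\<not> (p dvd m \<and> p dvd n)"
  shows "cmod (kloosterman p m n) \<le> 2 * sqrt (real_of_int p)"
proof -
  have p0: "p > 0" using p by (rule prime_gt_0_int)
  have p1: "real_of_int p \<ge> 1" using p0 by linarith
  hence s1: "1 \<le> 2 * sqrt (real_of_int p)" using real_sqrt_ge_one[OF p1] by linarith
  consider "p dvd m" "\<not> p dvd n" | "\<not> p dvd m" "p dvd n" | "\<not> p dvd m" "\<not> p dvd n" using mn by blast
  thus ?thesis
  proof cases
    case 1
    thus ?thesis using kloosterman_ramanujan[OF p, of n m] kloosterman_commute[OF p0, of m n] s1 by simp
  next
    case 2
    thus ?thesis using kloosterman_ramanujan[OF p, of m n] s1 by simp
  next
    case 3
    show ?thesis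
    proof (cases "odd p")
      case True
      have "prime (nat p)" "odd (nat p)" "int (nat p) = p"
        using p True p0 by (auto simp: even_nat_iff)
      from weil_bound_prime[OF this(1,2)] 3 this(3) show ?thesis
        unfolding weil_bound_at_def by simp
    next
      \<comment> \<open>For p = 2 the trivial bound 2 lies below 2 sqrt 2.\<close>
      case False
      hence "p = 2" using primes_dvd_imp_eq[of 2 p] p by simp
      have "cmod (kloosterman p m n) \<le> real_of_int p" using p0 by (intro kloosterman_trivial) simp
      also have "\<dots> \<le> 2 * sqrt (real_of_int p)" using \<open>p = 2\<close> by simp
      finally show ?thesis .
    qed
  qed
qed

section \<open>Common factors and the uniform bound for prime powers\<close>

lemma sum_lift_residues:
  fixes g :: "int \<Rightarrow> complex"
  assumes N: "N > 0" "M > 0" and P: "\<And>x y. [x = y] (mod N) \<Longrightarrow> P x \<longleftrightarrow> P y"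
    and g: "\<And>x y. [x = y] (mod N) \<Longrightarrow> g x = g y"
  shows "(\<Sum>x\<in>{x \<in> {0..<N * M}. P x}. g x) = of_int M * (\<Sum>x\<in>{x \<in> {0..<N}. P x}. g x)"
proof -
  let ?S = "{x \<in> {0..<N}. P x}"
  have fin: "finite ?S" by (rule finite_subset[of _ "{0..<N}"]) auto
  have "(\<Sum>x\<in>{x \<in> {0..<N * M}. P x}. g x) = (\<Sum>z\<in>?S \<times> {0..<M}. g (fst z))"
  proof (rule sum.reindex_bij_witness[of _ "\<lambda>z. fst z + N * snd z" "\<lambda>x. (x mod N, x div N)"])
    fix x assume x: "x \<in> {x \<in> {0..<N * M}. P x}"
    have m: "[x mod N = x] (mod N)" by simp
    have "N * (x div N) + x mod N = x" by simp
    moreover have "0 \<le> x mod N" using N by simp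
    moreover have "x < N * M" using x by simp
    ultimately have "N * (x div N) < N * M" by linarith
    hence "x div N < M" using N by simp
    moreover have "0 \<le> x div N" using x N by (simp add: pos_imp_zdiv_nonneg_iff)
    ultimately show "(x mod N, x div N) \<in> ?S \<times> {0..<M}" using x N P[OF m] by simp
    show "g (fst (x mod N, x div N)) = g x" using g[OF m] by simp
  next
    fix z assume z: "z \<in> ?S \<times> {0..<M}"
    have c: "[fst z + N * snd z = fst z] (mod N)" by (simp add: cong_def)
    have "fst z + N * snd z < N + N * (M - 1)"
      using z N by (intro add_less_le_mono mult_left_mono) auto
    hence "fst z + N * snd z < N * M" by (simp add: algebra_simps)
    thus "fst z + N * snd z \<in> {x \<in> {0..<N * M}. P x}" using z N P[OF c] by auto
    show "((fst z + N * snd z) mod N, (fst z + N * snd z) div N) = z"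
      using z N by (auto simp: prod_eq_iff div_add_self2 div_pos_pos_trivial)
  qed auto
  also have "\<dots> = (\<Sum>x\<in>?S. \<Sum>v\<in>{0..<M}. g x)"
    using sum.cartesian_product[of "\<lambda>x v. g x" "{0..<M}" ?S] by (simp add: split_def)
  also have "\<dots> = of_int M * (\<Sum>x\<in>?S. g x)" using N by (simp add: sum_distrib_left)
  finally show ?thesis .
qed

text \<open>The phase depends on x modulo p^r only. Since r > 0, the units modulo p^(r + 1) are all
  the lifts of the units modulo p^r, p for each.\<close>

lemma kloosterman_common_factor:
  fixes p m n :: int
  assumes p: "prime p" and r: "r > 0"
  shows "kloosterman (p ^ Suc r) (p * m) (p * n) = of_int p * kloosterman (p ^ r) m n"
proof -
  have p0: "p > 0" using p by (rule prime_gt_0_int)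
  define q where "q = p ^ r"
  have q0: "q > 0" using p0 by (simp add: q_def)
  have qq: "p ^ Suc r = q * p" by (simp add: q_def)
  have units: "units_mod (p ^ k) = {x \<in> {0..<p ^ k}. \<not> p dvd x}" if "k > 0" for k
    unfolding units_mod_def coprime_prime_power_iff[OF p that] ..
  have "kloosterman (p ^ Suc r) (p * m) (p * n)
      = (\<Sum>x\<in>units_mod (p ^ Suc r). unit_exp q (m * x + n * modular_inverse q x))"
    unfolding kloosterman_def
  proof (intro sum.cong refl)
    fix x assume "x \<in> units_mod (p ^ Suc r)"
    hence x: "coprime x (p ^ Suc r)" by (simp add: units_mod_def)
    let ?y = "modular_inverse (p ^ Suc r) x"
    have eq: "p * m * x + p * n * ?y = p * (m * x + n * ?y)" by (simp add: algebra_simps)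
    have "unit_exp (q * p) (p * z) = unit_exp q z" for z
      using p0 by (simp add: unit_exp_def mult_ac)
    hence "unit_exp (p ^ Suc r) (p * m * x + p * n * ?y) = unit_exp q (m * x + n * ?y)"
      unfolding eq by (simp only: qq)
    also have "\<dots> = unit_exp q (m * x + n * modular_inverse q x)"
    proof -
      have "[x * ?y = 1] (mod p ^ Suc r)" by (rule cong_modular_inverse1[OF x])
      hence "[x * ?y = 1] (mod q)" unfolding qq by (rule cong_dvd_modulus) simp
      hence "[(modular_inverse q x) = ?y] (mod q)" by (rule modular_inverse_cong[OF q0])
      from cong_sym[OF this] show ?thesis by (intro unit_exp_cong q0 cong_add cong_mult cong_refl)
    qed
    finally show "unit_exp (p ^ Suc r) (p * m * x + p * n * ?y) = unit_exp q (m * x + n * modular_inverse q x)" .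
  qed
  also have "\<dots> = (\<Sum>x\<in>{x \<in> {0..<q * p}. \<not> p dvd x}. unit_exp q (m * x + n * modular_inverse q x))"
    using units[of "Suc r"] by (simp only: qq)
  also have "\<dots> = of_int p * (\<Sum>x\<in>{x \<in> {0..<q}. \<not> p dvd x}. unit_exp q (m * x + n * modular_inverse q x))"
  proof (rule sum_lift_residues[OF q0 p0])
    fix x y :: int assume xy: "[x = y] (mod q)"
    have "[x = y] (mod p)" using xy r unfolding q_def by (meson cong_dvd_modulus dvd_power dvd_refl)
    thus "\<not> p dvd x \<longleftrightarrow> \<not> p dvd y" by (simp add: cong_dvd_iff)
    show "unit_exp q (m * x + n * modular_inverse q x) = unit_exp q (m * y + n * modular_inverse q y)"
      by (rule kloosterman_phase_cong[OF q0 xy])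
  qed
  also have "\<dots> = of_int p * kloosterman (p ^ r) m n"
    using units[OF r] by (simp add: kloosterman_def q_def)
  finally show ?thesis .
qed

text \<open>The gcd is essential: if q divides m and n, every term is 1 and there is no
  cancellation, and the Fourier argument meets all frequencies.\<close>

definition kloosterman_bound :: "int \<Rightarrow> real \<Rightarrow> bool" where
  "kloosterman_bound q C \<longleftrightarrow>
     (\<forall>m n. cmod (kloosterman q m n) \<le> C * sqrt (real_of_int q) * sqrt (real_of_int (gcd (gcd m n) q)))"

text \<open>A common factor p of m and n scales both sides by p: on the right, sqrt q and the root
  of the gcd each gain sqrt p. Without a common factor the constants are 2 for primes, 4 for even
  exponents and 4 sqrt 2 for odd ones, all at most 8.\<close>

lemma kloosterman_bound_prime_power:
  fixes p :: int
  assumes p: "prime p"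
  shows "kloosterman_bound (p ^ Suc r) 8"
proof (induction r)
  case 0
  have p0: "p > 0" using p by (rule prime_gt_0_int)
  show ?case unfolding kloosterman_bound_def
  proof (intro allI)
    fix m n :: int
    have s0: "sqrt (real_of_int p) \<ge> 0" using p0 by simp
    show "cmod (kloosterman (p ^ Suc 0) m n) \<le> 8 * sqrt (real_of_int (p ^ Suc 0)) * sqrt (real_of_int (gcd (gcd m n) (p ^ Suc 0)))"
    proof (cases "p dvd m \<and> p dvd n")
      case True
      hence "gcd (gcd m n) p = p" using p0 by (simp add: gcd_proj2_if_dvd)
      moreover have "cmod (kloosterman p m n) \<le> real_of_int p" using p0 by (intro kloosterman_trivial) simp
      moreover have "real_of_int p = sqrt (real_of_int p) * sqrt (real_of_int p)" using p0 by simp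
      ultimately have "cmod (kloosterman p m n) \<le> sqrt (real_of_int p) * sqrt (real_of_int (gcd (gcd m n) p))" by simp
      also have "\<dots> \<le> 8 * sqrt (real_of_int p) * sqrt (real_of_int (gcd (gcd m n) p))"
        using p0 by (intro mult_right_mono) auto
      finally show ?thesis by simp
    next
      case False
      have "gcd (gcd m n) p \<ge> 1" using p0 by (simp add: int_one_le_iff_zero_less)
      hence g: "1 \<le> sqrt (real_of_int (gcd (gcd m n) p))" by simp
      have "cmod (kloosterman p m n) \<le> 2 * sqrt (real_of_int p)" by (rule kloosterman_prime[OF p False])
      also have "\<dots> \<le> 8 * sqrt (real_of_int p) * 1" using s0 by simp
      also have "\<dots> \<le> 8 * sqrt (real_of_int p) * sqrt (real_of_int (gcd (gcd m n) p))"
        using g s0 by (intro mult_left_mono) auto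
      finally show ?thesis by simp
    qed
  qed
next
  case (Suc r)
  have p0: "p > 0" using p by (rule prime_gt_0_int)
  define R where "R = Suc (Suc r)"
  show ?case unfolding kloosterman_bound_def
  proof (intro allI)
    fix m n :: int
    have s0: "sqrt (real_of_int p ^ R) \<ge> 0" using p0 by simp
    show "cmod (kloosterman (p ^ Suc (Suc r)) m n) \<le> 8 * sqrt (real_of_int (p ^ Suc (Suc r))) * sqrt (real_of_int (gcd (gcd m n) (p ^ Suc (Suc r))))"
    proof (cases "p dvd m \<and> p dvd n")
      case True
      then obtain m' n' where mn: "m = p * m'" "n = p * n'" by (auto elim!: dvdE)
      have "gcd (gcd m n) (p ^ Suc (Suc r)) = p * gcd (gcd m' n') (p ^ Suc r)"
        using p0 by (simp add: mn gcd_mult_left)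
      moreover have "cmod (kloosterman (p ^ Suc r) m' n') \<le> 8 * sqrt (real_of_int (p ^ Suc r)) * sqrt (real_of_int (gcd (gcd m' n') (p ^ Suc r)))"
        using Suc.IH unfolding kloosterman_bound_def by blast
      moreover have "cmod (kloosterman (p ^ Suc (Suc r)) m n) = real_of_int p * cmod (kloosterman (p ^ Suc r) m' n')"
        unfolding mn kloosterman_common_factor[OF p zero_less_Suc] using p0 by (simp add: norm_mult)
      moreover have "real_of_int p = sqrt (real_of_int p) * sqrt (real_of_int p)" using p0 by simp
      ultimately have "cmod (kloosterman (p ^ Suc (Suc r)) m n) \<le> (sqrt (real_of_int p) * sqrt (real_of_int p))
           * (8 * sqrt (real_of_int (p ^ Suc r)) * sqrt (real_of_int (gcd (gcd m' n') (p ^ Suc r))))"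
        using p0 by (metis mult_left_mono of_int_0_le_iff less_imp_le)
      also have "\<dots> = 8 * (sqrt (real_of_int p) * sqrt (real_of_int (p ^ Suc r)))
           * (sqrt (real_of_int p) * sqrt (real_of_int (gcd (gcd m' n') (p ^ Suc r))))" by (simp only: mult_ac)
      also have "\<dots> = 8 * sqrt (real_of_int (p ^ Suc (Suc r))) * sqrt (real_of_int (gcd (gcd m n) (p ^ Suc (Suc r))))"
        using \<open>gcd (gcd m n) (p ^ Suc (Suc r)) = _\<close> by (simp only: real_sqrt_mult[symmetric] of_int_mult[symmetric] power_Suc[symmetric])
      finally show ?thesis .
    next
      case False
      have "gcd (gcd m n) (p ^ R) > 0" using p0 by simp
      hence "gcd (gcd m n) (p ^ R) \<ge> 1" by linarith
      hence g: "1 \<le> sqrt (real_of_int (gcd (gcd m n) (p ^ R)))" by simp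
      have "cmod (kloosterman (p ^ R) m n) \<le> 8 * sqrt (real_of_int p ^ R)"
      proof (cases "even R")
        case True
        then obtain s where s: "R = 2 * s" by (elim evenE)
        have "s > 0" using s by (simp add: R_def)
        from kloosterman_even_prime_power[OF p this False]
        have "cmod (kloosterman (p ^ R) m n) \<le> 4 * real_of_int p ^ s" by (simp add: s)
        also have "real_of_int p ^ s = sqrt (real_of_int p ^ R)" using p0 by (simp add: s power_even_eq)
        finally show ?thesis using s0 by linarith
      next
        case odd: False
        then obtain s where s: "R = 2 * s + 1" by (elim oddE)
        have "s > 0" using s by (simp add: R_def)
        from kloosterman_odd_prime_power[OF p this False]
        have "cmod (kloosterman (p ^ R) m n) \<le> 4 * real_of_int p ^ s * sqrt (2 * real_of_int p)" by (simp add: s)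
        also have "\<dots> = 4 * sqrt 2 * sqrt (real_of_int p ^ R)"
          using p0 by (simp add: s power_even_eq real_sqrt_mult)
        also have "\<dots> \<le> 4 * 2 * sqrt (real_of_int p ^ R)"
          using s0 sqrt2_less_2 by (intro mult_right_mono mult_left_mono) auto
        finally show ?thesis by simp
      qed
      also have "\<dots> \<le> 8 * sqrt (real_of_int p ^ R) * sqrt (real_of_int (gcd (gcd m n) (p ^ R)))"
        using mult_left_mono[OF g, of "8 * sqrt (real_of_int p ^ R)"] s0 by simp
      finally show ?thesis by (simp only: R_def of_int_power)
    qed
  qed
qed

section \<open>Composite moduli\<close>

lemma crt_units_bij:
  fixes q1 q2 :: int
  assumes q: "q1 > 0" "q2 > 0" and cop: "coprime q1 q2"
  shows "bij_betw (\<lambda>x. (x mod q1, x mod q2)) (units_mod (q1 * q2)) (units_mod q1 \<times> units_mod q2)"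
proof -
  obtain i1 i2 where i: "i1 * q1 + i2 * q2 = 1"
    using bezout_int[of q1 q2] cop by auto
  define glue where "glue = (\<lambda>z. (fst z * (i2 * q2) + snd z * (i1 * q1)) mod (q1 * q2))"
  have b1: "[glue z = fst z] (mod q1)" for z
  proof -
    have "fst z * (i2 * q2) + snd z * (i1 * q1) - fst z = fst z * ((i1 * q1 + i2 * q2) - 1) + q1 * (i1 * (snd z - fst z))"
      by (simp add: algebra_simps)
    hence "[fst z * (i2 * q2) + snd z * (i1 * q1) = fst z] (mod q1)" unfolding i by (simp add: cong_iff_dvd_diff)
    thus ?thesis by (simp add: glue_def cong_def mod_mod_cancel)
  qed
  have b2: "[glue z = snd z] (mod q2)" for z
  proof -
    have "fst z * (i2 * q2) + snd z * (i1 * q1) - snd z = snd z * ((i1 * q1 + i2 * q2) - 1) + q2 * (i2 * (fst z - snd z))"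
      by (simp add: algebra_simps)
    hence "[fst z * (i2 * q2) + snd z * (i1 * q1) = snd z] (mod q2)" unfolding i by (simp add: cong_iff_dvd_diff)
    thus ?thesis by (simp add: glue_def cong_def mod_mod_cancel)
  qed
  show ?thesis
  proof (rule bij_betw_byWitness[where f' = glue])
    show "\<forall>x\<in>units_mod (q1 * q2). glue (x mod q1, x mod q2) = x"
    proof
      fix x assume x: "x \<in> units_mod (q1 * q2)"
      have "[glue (x mod q1, x mod q2) = x] (mod q1)" "[glue (x mod q1, x mod q2) = x] (mod q2)"
        using b1[of "(x mod q1, x mod q2)"] b2[of "(x mod q1, x mod q2)"] by (simp_all add: cong_def)
      hence "[glue (x mod q1, x mod q2) = x] (mod q1 * q2)" using cop by (rule coprime_cong_mult)
      moreover have "0 \<le> glue (x mod q1, x mod q2)" "glue (x mod q1, x mod q2) < q1 * q2"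
        using q by (auto simp: glue_def)
      ultimately show "glue (x mod q1, x mod q2) = x"
        using x by (intro cong_less_imp_eq_int) (auto simp: units_mod_def)
    qed
    show "\<forall>z\<in>units_mod q1 \<times> units_mod q2. (glue z mod q1, glue z mod q2) = z"
      using b1 b2 by (auto simp: cong_def units_mod_def)
    show "(\<lambda>x. (x mod q1, x mod q2)) ` units_mod (q1 * q2) \<subseteq> units_mod q1 \<times> units_mod q2"
      using q by (auto simp: units_mod_def)
    show "glue ` (units_mod q1 \<times> units_mod q2) \<subseteq> units_mod (q1 * q2)"
    proof
      fix x assume "x \<in> glue ` (units_mod q1 \<times> units_mod q2)"
      then obtain z where z: "z \<in> units_mod q1 \<times> units_mod q2" "x = glue z" by blast
      have "coprime x q1" "coprime x q2"
        using z coprime_cong_int[OF b1[of z]] coprime_cong_int[OF b2[of z]] by (auto simp: units_mod_def)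
      thus "x \<in> units_mod (q1 * q2)" using z(2) q by (simp add: units_mod_def glue_def)
    qed
  qed
qed

text \<open>Partial fractions 1/(q1 q2) = i2/q1 + i1/q2 split the phase, and the Chinese remainder
  theorem splits the units. The twists i1, i2 are units and leave the relevant gcds
  unchanged.\<close>

lemma kloosterman_twisted_mult:
  fixes q1 q2 m n :: int
  assumes q: "q1 > 0" "q2 > 0" and i: "i1 * q1 + i2 * q2 = 1"
  shows "kloosterman (q1 * q2) m n = kloosterman q1 (m * i2) (n * i2) * kloosterman q2 (m * i1) (n * i1)"
proof -
  have cop: "coprime q1 q2"
    by (rule coprimeI) (metis i dvd_add dvd_mult)
  have split: "unit_exp (q1 * q2) z = unit_exp q1 (z * i2) * unit_exp q2 (z * i1)" for z
  proof -
    have i': "real_of_int i1 * real_of_int q1 + real_of_int i2 * real_of_int q2 = 1"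
      using i by (metis of_int_1 of_int_add of_int_mult)
    have "real_of_int (z * i2) / real_of_int q1 + real_of_int (z * i1) / real_of_int q2
        = real_of_int z * (real_of_int i1 * real_of_int q1 + real_of_int i2 * real_of_int q2) / real_of_int (q1 * q2)"
      using q by (simp add: field_simps)
    also have "\<dots> = real_of_int z / real_of_int (q1 * q2)" unfolding i' by simp
    finally have "2 * pi * real_of_int z / real_of_int (q1 * q2)
        = 2 * pi * real_of_int (z * i2) / real_of_int q1 + 2 * pi * real_of_int (z * i1) / real_of_int q2"
      by (metis distrib_left times_divide_eq_right)
    thus ?thesis by (simp add: unit_exp_def cis_mult)
  qed
  let ?g1 = "\<lambda>x. unit_exp q1 (m * i2 * x + n * i2 * modular_inverse q1 x)"
  let ?g2 = "\<lambda>x. unit_exp q2 (m * i1 * x + n * i1 * modular_inverse q2 x)"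
  have "kloosterman (q1 * q2) m n = (\<Sum>x\<in>units_mod (q1 * q2). ?g1 (x mod q1) * ?g2 (x mod q2))"
    unfolding kloosterman_def
  proof (intro sum.cong refl)
    fix x assume "x \<in> units_mod (q1 * q2)"
    hence x: "coprime x (q1 * q2)" by (simp add: units_mod_def)
    define y where "y = modular_inverse (q1 * q2) x"
    have xy: "[x * y = 1] (mod q1 * q2)" unfolding y_def by (rule cong_modular_inverse1[OF x])
    have "[x * y = 1] (mod q1)" "[x * y = 1] (mod q2)" using xy cong_dvd_modulus dvd_triv_left dvd_triv_right by blast+
    moreover have "[(x mod q1) * y = x * y] (mod q1)" "[(x mod q2) * y = x * y] (mod q2)" by (simp_all add: cong_def mod_mult_left_eq)
    ultimately have "[(x mod q1) * y = 1] (mod q1)" "[(x mod q2) * y = 1] (mod q2)" using cong_trans by blast+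
    hence y: "[(modular_inverse q1 (x mod q1)) = y] (mod q1)" "[(modular_inverse q2 (x mod q2)) = y] (mod q2)"
      using q by (auto intro: modular_inverse_cong)
    have "unit_exp (q1 * q2) (m * x + n * y) = unit_exp q1 (m * i2 * x + n * i2 * y) * unit_exp q2 (m * i1 * x + n * i1 * y)"
      unfolding split by (simp add: algebra_simps)
    also have "unit_exp q1 (m * i2 * x + n * i2 * y) = ?g1 (x mod q1)"
      using y(1) by (intro unit_exp_cong q cong_add cong_mult cong_refl) (simp_all add: cong_sym)
    also have "unit_exp q2 (m * i1 * x + n * i1 * y) = ?g2 (x mod q2)"
      using y(2) by (intro unit_exp_cong q cong_add cong_mult cong_refl) (simp_all add: cong_sym)
    finally show "unit_exp (q1 * q2) (m * x + n * modular_inverse (q1 * q2) x) = ?g1 (x mod q1) * ?g2 (x mod q2)"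
      by (simp only: y_def)
  qed
  also have "\<dots> = (\<Sum>z\<in>units_mod q1 \<times> units_mod q2. ?g1 (fst z) * ?g2 (snd z))"
    using sum.reindex_bij_betw[OF crt_units_bij[OF q cop], of "\<lambda>z. ?g1 (fst z) * ?g2 (snd z)"] by simp
  also have "\<dots> = (\<Sum>x\<in>units_mod q1. \<Sum>y\<in>units_mod q2. ?g1 x * ?g2 y)"
    using sum.cartesian_product[of "\<lambda>x y. ?g1 x * ?g2 y" "units_mod q2" "units_mod q1"] by (simp add: split_def)
  also have "\<dots> = kloosterman q1 (m * i2) (n * i2) * kloosterman q2 (m * i1) (n * i1)"
    unfolding kloosterman_def sum_product ..
  finally show ?thesis .
qed

lemma gcd_gcd_mult_cancel:
  fixes m n i q :: int
  assumes "coprime i q"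
  shows "gcd (gcd (m * i) (n * i)) q = gcd (gcd m n) q"
proof (rule zdvd_antisym_nonneg)
  let ?d = "gcd (gcd (m * i) (n * i)) q"
  have "coprime ?d i" using assms by (meson coprime_commute coprime_divisors dvd_refl gcd_dvd2)
  moreover have "?d dvd m * i" "?d dvd n * i" by (meson dvd_trans gcd_dvd1 gcd_dvd2)+
  ultimately have "?d dvd m" "?d dvd n" by (simp_all add: coprime_dvd_mult_left_iff)
  thus "?d dvd gcd (gcd m n) q" by simp
  show "gcd (gcd m n) q dvd ?d" by (intro gcd_mono gcd_greatest dvd_refl dvd_mult2 gcd_dvd1 gcd_dvd2)
qed auto

lemma kloosterman_bound_mult:
  fixes q1 q2 :: int
  assumes q: "q1 > 0" "q2 > 0" and cop: "coprime q1 q2"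
    and C: "C1 \<ge> 0" "C2 \<ge> 0" and b: "kloosterman_bound q1 C1" "kloosterman_bound q2 C2"
  shows "kloosterman_bound (q1 * q2) (C1 * C2)"
  unfolding kloosterman_bound_def
proof (intro allI)
  fix m n :: int
  obtain i1 i2 where i: "i1 * q1 + i2 * q2 = 1"
    using bezout_int[of q1 q2] cop by auto
  have c1: "coprime i2 q1" by (rule coprimeI) (metis i dvd_add dvd_mult dvd_mult2)
  have c2: "coprime i1 q2" by (rule coprimeI) (metis i dvd_add dvd_mult dvd_mult2)
  define g where "g = gcd m n"
  have g1: "gcd (gcd (m * i2) (n * i2)) q1 = gcd g q1"
    unfolding g_def by (rule gcd_gcd_mult_cancel[OF c1])
  have g2: "gcd (gcd (m * i1) (n * i1)) q2 = gcd g q2"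
    unfolding g_def by (rule gcd_gcd_mult_cancel[OF c2])
  have "gcd g q1 * gcd g q2 dvd gcd g (q1 * q2)"
  proof (rule gcd_greatest)
    have "coprime (gcd g q1) (gcd g q2)" using cop by (meson coprime_divisors gcd_dvd2)
    thus "gcd g q1 * gcd g q2 dvd g" by (intro divides_mult) auto
    show "gcd g q1 * gcd g q2 dvd q1 * q2" by (intro mult_dvd_mono) auto
  qed
  moreover have "gcd g (q1 * q2) > 0" using q by simp
  ultimately have gle: "gcd g q1 * gcd g q2 \<le> gcd g (q1 * q2)" by (rule zdvd_imp_le)
  let ?s = "\<lambda>x::int. sqrt (real_of_int x)"
  have "cmod (kloosterman (q1 * q2) m n)
      = cmod (kloosterman q1 (m * i2) (n * i2)) * cmod (kloosterman q2 (m * i1) (n * i1))"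
    unfolding kloosterman_twisted_mult[OF q i] by (rule norm_mult)
  also have "\<dots> \<le> (C1 * ?s q1 * ?s (gcd g q1)) * (C2 * ?s q2 * ?s (gcd g q2))"
    using b unfolding kloosterman_bound_def g1[symmetric] g2[symmetric]
    using C q by (intro mult_mono) auto
  also have "\<dots> = C1 * C2 * ?s (q1 * q2) * ?s (gcd g q1 * gcd g q2)" by (simp add: real_sqrt_mult)
  also have "\<dots> \<le> C1 * C2 * ?s (q1 * q2) * ?s (gcd g (q1 * q2))"
    using C q gle by (intro mult_left_mono) (auto simp del: of_int_mult)
  finally show "cmod (kloosterman (q1 * q2) m n) \<le> C1 * C2 * ?s (q1 * q2) * ?s (gcd (gcd m n) (q1 * q2))"
    by (simp only: g_def)
qed

lemma prime_power_coprime_induct [consumes 1, case_names one step]: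
  assumes "q > 0"
    and "P 1"
    and step: "\<And>p r q. prime p \<Longrightarrow> \<not> p dvd q \<Longrightarrow> q > 0 \<Longrightarrow> P q \<Longrightarrow> P (p ^ Suc r * q)"
  shows "P (q :: nat)"
  using assms(1)
proof (induction q rule: less_induct)
  case (less q)
  show ?case
  proof (cases "q = 1")
    case False
    then obtain p where p: "prime p" "p dvd q" using prime_factor_nat by blast
    obtain q' where q': "q = p ^ multiplicity p q * q'" "\<not> p dvd q'"
      using multiplicity_decompose'[of q p] p less.prems by (metis not_prime_unit gr_implies_not0)
    have "multiplicity p q > 0" using p less.prems by (simp add: prime_multiplicity_gt_zero_iff)
    then obtain r where r: "multiplicity p q = Suc r" using gr0_implies_Suc by blast
    have "q' > 0" using q' less.prems by (metis gr0I mult_0_right)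
    moreover have "q' < q"
    proof -
      have "1 < p ^ Suc r" using p(1) by (metis one_less_power prime_gt_1_nat zero_less_Suc)
      thus ?thesis using q'(1) \<open>q' > 0\<close> unfolding r by (metis mult_less_cancel2 mult_1)
    qed
    ultimately have "P (p ^ Suc r * q')" using less.IH[of q'] q' p by (intro step) auto
    thus ?thesis using q'(1) unfolding r by simp
  qed (use assms in simp)
qed

section \<open>Quantities controlled by the number of prime factors\<close>

definition omega :: "nat \<Rightarrow> nat" where
  "omega q = card (prime_factors q)"

lemma omega_step:
  assumes "prime p" "\<not> p dvd q" "q > 0"
  shows "omega (p ^ Suc r * q) = Suc (omega q)"
proof -
  have "prime_factors (p ^ Suc r * q) = insert p (prime_factors q)"
    using assms prime_gt_0_nat[OF assms(1)]
    by (subst prime_factors_product) (simp_all add: prime_factors_power prime_prime_factors del: power_Suc)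
  moreover have "p \<notin> prime_factors q" using assms by auto
  ultimately show ?thesis by (simp add: omega_def)
qed

theorem kloosterman_bound_general:
  assumes "q > 0"
  shows "kloosterman_bound (int q) (8 ^ omega q)"
  using assms
proof (induction q rule: prime_power_coprime_induct)
  case one
  have "cmod (kloosterman 1 m n) \<le> 1" for m n using kloosterman_trivial[of 1 m n] by simp
  thus ?case by (simp add: kloosterman_bound_def omega_def)
next
  case (step p r q)
  have "kloosterman_bound (int p ^ Suc r * int q) (8 * 8 ^ omega q)"
  proof (rule kloosterman_bound_mult)
    show "int p ^ Suc r > 0" "int q > 0" using step by (auto simp: prime_gt_0_nat)
    have "coprime p q" using step by (simp add: prime_imp_coprime)
    thus "coprime (int p ^ Suc r) (int q)" by simp
    show "kloosterman_bound (int p ^ Suc r) 8" using step by (intro kloosterman_bound_prime_power) simp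
  qed (use step in auto)
  thus ?case unfolding omega_step[OF step(1-3)] by simp
qed

text \<open>Primes p > B satisfy p^\<epsilon> \<ge> A, and their product divides q. The remaining
  primes are at most B in number up to one, and their contribution goes into the constant.\<close>

lemma omega_power_le:
  fixes A \<epsilon> :: real
  assumes A: "A \<ge> 1" and \<epsilon>: "\<epsilon> > 0"
  obtains C where "C > 0" "\<And>q. q > 0 \<Longrightarrow> A ^ omega q \<le> C * real q powr \<epsilon>"
proof -
  define B where "B = nat \<lceil>A powr (1 / \<epsilon>)\<rceil>"
  have "A ^ omega q \<le> A ^ Suc B * real q powr \<epsilon>" if q: "q > 0" for q
  proof -
    let ?S = "{p \<in> prime_factors q. p \<le> B}" and ?L = "{p \<in> prime_factors q. \<not> p \<le> B}"
    have fin: "finite ?S" "finite ?L" by auto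
    have "prime_factors q = ?S \<union> ?L" by auto
    hence "omega q = card ?S + card ?L" unfolding omega_def using fin by (metis (no_types, lifting) card_Un_disjoint disjoint_iff mem_Collect_eq)
    hence "A ^ omega q = A ^ card ?S * A ^ card ?L" by (simp add: power_add)
    also have "A ^ card ?S \<le> A ^ Suc B"
    proof (rule power_increasing[OF _ A])
      have "card ?S \<le> card {..B}" by (rule card_mono) auto
      thus "card ?S \<le> Suc B" by simp
    qed
    also have "A ^ card ?L \<le> real q powr \<epsilon>"
    proof -
      have "A ^ card ?L = (\<Prod>p\<in>?L. A)" by simp
      also have "\<dots> \<le> (\<Prod>p\<in>?L. real p powr \<epsilon>)"
      proof (rule prod_mono)
        fix p assume p: "p \<in> ?L"
        have "A powr (1 / \<epsilon>) \<le> real B" unfolding B_def by linarith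
        also have "\<dots> \<le> real p" using p by simp
        finally have "(A powr (1 / \<epsilon>)) powr \<epsilon> \<le> real p powr \<epsilon>" using \<epsilon> by (intro powr_mono2) auto
        thus "0 \<le> A \<and> A \<le> real p powr \<epsilon>" using A \<epsilon> by (simp add: powr_powr)
      qed
      also have "\<dots> = (\<Prod>p\<in>?L. real p) powr \<epsilon>" by (intro prod_powr_distrib[symmetric])
      also have "\<dots> \<le> real q powr \<epsilon>"
      proof (intro powr_mono2)
        have "(\<Prod>p\<in>?L. p) dvd (\<Prod>p\<in>prime_factors q. p)" by (rule prod_dvd_prod_subset) auto
        also have "(\<Prod>p\<in>prime_factors q. p) dvd (\<Prod>p\<in>prime_factors q. p ^ multiplicity p q)"
          by (intro prod_dvd_prod dvd_power) (auto simp: prime_factors_multiplicity)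
        also have "\<dots> = q" using q by (simp add: prime_factorization_nat[symmetric])
        finally have "(\<Prod>p\<in>?L. p) \<le> q" using q by (intro dvd_imp_le) auto
        thus "(\<Prod>p\<in>?L. real p) \<le> real q" by (simp only: of_nat_prod[symmetric] of_nat_le_iff)
      qed (use \<epsilon> in \<open>auto intro: prod_nonneg\<close>)
      finally show ?thesis .
    qed
    finally show ?thesis using A by (simp add: mult_left_mono mult_right_mono)
  qed
  thus thesis using that[of "A ^ Suc B"] A by simp
qed

lemma totient_ge:
  assumes "q > 0"
  shows "real q \<le> 2 ^ omega q * real (totient q)"
proof -
  have "(1 / 2) ^ omega q = (\<Prod>p\<in>prime_factors q. 1 / 2 :: real)" by (simp add: omega_def)
  also have "\<dots> \<le> (\<Prod>p\<in>prime_factors q. 1 - 1 / real p)"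
  proof (rule prod_mono)
    fix p assume "p \<in> prime_factors q"
    hence "p \<ge> 2" using prime_ge_2_nat by auto
    hence "1 / real p \<le> 1 / 2" by (intro divide_left_mono) auto
    thus "0 \<le> (1 / 2 :: real) \<and> 1 / 2 \<le> 1 - 1 / real p" by simp
  qed
  finally have "real q * (1 / 2) ^ omega q \<le> real (totient q)"
    unfolding totient_formula2 by (intro mult_left_mono) auto
  thus ?thesis by (simp add: power_one_over field_simps)
qed

text \<open>The sum factors over prime powers into geometric series with ratio 1 / sqrt p \<le> 1 /
  sqrt 2 \<le> 3/4, each at most 4.\<close>

lemma sum_inverse_sqrt_divisors_le:
  assumes "q > 0"
  shows "(\<Sum>g | g dvd q. 1 / sqrt (real g)) \<le> 4 ^ omega q"
  using assms
proof (induction q rule: prime_power_coprime_induct)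
  case one
  have "{g::nat. g dvd 1} = {1}" by auto
  thus ?case by simp
next
  case (step p r q)
  let ?f = "\<lambda>g::nat. 1 / sqrt (real g)"
  let ?D = "{g. g dvd q}"
  have finD: "finite ?D" using step by auto
  have p: "p \<ge> 2" using step prime_ge_2_nat by auto
  have geom: "(\<Sum>i\<le>Suc r. ?f (p ^ i)) \<le> 4"
  proof -
    define z where "z = 1 / sqrt (real p)"
    have "sqrt (real p) \<ge> sqrt 2" using p by simp
    moreover have "sqrt 2 \<ge> (4 / 3 :: real)" by (rule real_le_rsqrt) (simp add: power2_eq_square)
    ultimately have sp: "sqrt (real p) \<ge> 4 / 3" by linarith
    hence "1 / sqrt (real p) \<le> 1 / (4 / 3)" using p by (intro divide_left_mono) auto
    hence z: "0 \<le> z" "z \<le> 3 / 4" by (auto simp: z_def)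
    have "?f (p ^ i) = z ^ i" for i by (simp add: z_def real_sqrt_power power_one_over)
    hence "(\<Sum>i\<le>Suc r. ?f (p ^ i)) = (\<Sum>i\<le>Suc r. z ^ i)" by simp
    also have "\<dots> \<le> 1 / (1 - z)" using z by (subst sum_gp0) (auto simp: divide_simps)
    also have "\<dots> \<le> 4" using z by (simp add: field_simps)
    finally show ?thesis .
  qed
  have "{g. g dvd p ^ Suc r * q} \<subseteq> (\<lambda>(i, d). p ^ i * d) ` ({..Suc r} \<times> ?D)"
  proof
    fix g assume "g \<in> {g. g dvd p ^ Suc r * q}"
    then obtain b c where bc: "g = b * c" "b dvd p ^ Suc r" "c dvd q" using division_decomp by blast
    obtain i where "i \<le> Suc r" "b = p ^ i" using bc(2) step(1) divides_primepow_nat by blast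
    thus "g \<in> (\<lambda>(i, d). p ^ i * d) ` ({..Suc r} \<times> ?D)" using bc by auto
  qed
  hence "(\<Sum>g | g dvd p ^ Suc r * q. ?f g) \<le> sum ?f ((\<lambda>(i, d). p ^ i * d) ` ({..Suc r} \<times> ?D))"
    using finD by (intro sum_mono2) auto
  also have "\<dots> \<le> sum (?f \<circ> (\<lambda>(i, d). p ^ i * d)) ({..Suc r} \<times> ?D)"
    using finD by (intro sum_image_le) auto
  also have "\<dots> = (\<Sum>z\<in>{..Suc r} \<times> ?D. ?f (p ^ fst z) * ?f (snd z))"
    by (intro sum.cong refl) (auto simp: real_sqrt_mult)
  also have "\<dots> = (\<Sum>i\<le>Suc r. ?f (p ^ i)) * (\<Sum>d\<in>?D. ?f d)"
    unfolding sum_product using sum.cartesian_product[of "\<lambda>i d. ?f (p ^ i) * ?f d" ?D "{..Suc r}"] by (simp add: split_def)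
  also have "\<dots> \<le> 4 * 4 ^ omega q"
    using geom step.IH by (intro mult_mono) (auto intro: sum_nonneg)
  finally show ?case unfolding omega_step[OF step(1-3)] by simp
qed

lemma card_units_mod:
  assumes "q > 1"
  shows "card (units_mod (int q)) = totient q"
proof -
  have "units_mod (int q) = int ` totatives q"
  proof (intro equalityI subsetI)
    fix x assume x: "x \<in> units_mod (int q)"
    have "x \<noteq> 0" using x assms by (auto simp: units_mod_def)
    hence "nat x \<in> totatives q" using x by (auto simp: units_mod_def in_totatives_iff simp flip: coprime_int_iff)
    moreover have "x = int (nat x)" using x by (simp add: units_mod_def)
    ultimately show "x \<in> int ` totatives q" by blast
  next
    fix x assume "x \<in> int ` totatives q"
    thus "x \<in> units_mod (int q)" using assms totatives_less by (auto simp: units_mod_def in_totatives_iff)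
  qed
  thus ?thesis by (simp add: card_image totient_def)
qed

section \<open>Points of the modular hyperbola in boxes\<close>

text \<open>An unnormalised Fejer kernel: the Fourier transform of
  \<open>difference_count\<close>.\<close>

definition interval_weight :: "int \<Rightarrow> int \<Rightarrow> int \<Rightarrow> real" where
  "interval_weight q L h = (cmod (\<Sum>i\<in>{0..<L}. unit_exp q (h * i)))\<^sup>2"

text \<open>The autocorrelation of the interval modulo q. A nonzero value shows that n is congruent
  to some u with \<bar>u\<bar> < L.\<close>

definition difference_count :: "int \<Rightarrow> int \<Rightarrow> int \<Rightarrow> nat" where
  "difference_count q L n = card {z \<in> {0..<L} \<times> {0..<L}. q dvd fst z - snd z - n}"

lemma interval_weight_eq:
  "complex_of_real (interval_weight q L h) = (\<Sum>z\<in>{0..<L} \<times> {0..<L}. unit_exp q (h * (fst z - snd z)))"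
proof -
  have "complex_of_real (interval_weight q L h)
      = (\<Sum>i\<in>{0..<L}. unit_exp q (h * i)) * cnj (\<Sum>i\<in>{0..<L}. unit_exp q (h * i))"
    unfolding interval_weight_def by (rule complex_norm_square)
  also have "\<dots> = (\<Sum>i\<in>{0..<L}. \<Sum>j\<in>{0..<L}. unit_exp q (h * (i - j)))"
    unfolding cnj_sum sum_product
    by (intro sum.cong refl) (simp add: cnj_unit_exp unit_exp_add[symmetric] algebra_simps)
  also have "\<dots> = (\<Sum>z\<in>{0..<L} \<times> {0..<L}. unit_exp q (h * (fst z - snd z)))"
    using sum.cartesian_product[of "\<lambda>i j. unit_exp q (h * (i - j))" "{0..<L}" "{0..<L}"] by (simp add: split_def)
  finally show ?thesis .
qed

lemma interval_weight_nonneg: "interval_weight q L h \<ge> 0"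
  by (simp add: interval_weight_def)

lemma interval_weight_0: "L \<ge> 0 \<Longrightarrow> interval_weight q L 0 = (real_of_int L)\<^sup>2"
  by (simp add: interval_weight_def)

lemma difference_count_fourier:
  assumes q: "q > 0"
  shows "(\<Sum>h\<in>{0..<q}. complex_of_real (interval_weight q L h) * unit_exp q (- (h * n)))
    = of_int q * of_nat (difference_count q L n)"
proof -
  let ?I = "{0..<L} \<times> {0..<L}"
  have "(\<Sum>h\<in>{0..<q}. complex_of_real (interval_weight q L h) * unit_exp q (- (h * n)))
      = (\<Sum>h\<in>{0..<q}. \<Sum>z\<in>?I. unit_exp q (h * (fst z - snd z - n)))"
    unfolding interval_weight_eq sum_distrib_right
    by (intro sum.cong refl) (simp add: unit_exp_add[symmetric] algebra_simps)
  also have "\<dots> = (\<Sum>z\<in>?I. \<Sum>h\<in>{0..<q}. unit_exp q (h * (fst z - snd z - n)))" by (rule sum.swap)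
  also have "\<dots> = (\<Sum>z\<in>?I. if q dvd fst z - snd z - n then of_int q else 0)"
    unfolding sum_unit_exp[OF q] ..
  also have "\<dots> = (\<Sum>z\<in>{z \<in> ?I. q dvd fst z - snd z - n}. of_int q)"
    by (rule sum.inter_filter[symmetric]) simp
  also have "\<dots> = of_int q * of_nat (difference_count q L n)"
    by (simp add: difference_count_def)
  finally show ?thesis .
qed

lemma card_residue_class_le:
  assumes N: "N > 0" and L: "L > 0"
  shows "real (card {j \<in> {0..<L}. N dvd i - j}) \<le> real_of_int L / real_of_int N + 1"
proof -
  let ?S = "{j \<in> {0..<L}. N dvd i - j}"
  have inj: "inj_on (\<lambda>j. j div N) ?S"
  proof (rule inj_onI)
    fix j k assume jk: "j \<in> ?S" "k \<in> ?S" "j div N = k div N"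
    hence "[i = j] (mod N)" "[i = k] (mod N)" by (simp_all add: cong_iff_dvd_diff)
    hence "j mod N = k mod N" by (simp add: cong_def)
    thus "j = k" using jk(3) by (metis div_mult_mod_eq)
  qed
  have "(\<lambda>j. j div N) ` ?S \<subseteq> {0..(L - 1) div N}"
    using N by (auto simp: pos_imp_zdiv_nonneg_iff intro!: zdiv_mono1)
  hence "card ?S \<le> card {0..(L - 1) div N}" using inj by (intro card_inj_on_le) auto
  also have "\<dots> = nat ((L - 1) div N + 1)" by simp
  finally have "real (card ?S) \<le> real (nat ((L - 1) div N + 1))" by (simp only: of_nat_le_iff)
  also have "\<dots> = real_of_int ((L - 1) div N) + 1"
    using N L by (simp add: pos_imp_zdiv_nonneg_iff)
  also have "real_of_int ((L - 1) div N) \<le> real_of_int (L - 1) / real_of_int N"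
    by (rule real_of_int_div4)
  also have "\<dots> \<le> real_of_int L / real_of_int N" using N by (intro divide_right_mono) auto
  finally show ?thesis by simp
qed

text \<open>Orthogonality over the multiples of g leaves N times the number of pairs of the interval
  that are congruent modulo N, and a class meets the interval at most L/N + 1 times.\<close>

lemma sum_interval_weight_multiples_le:
  fixes g N L :: int
  assumes g: "g > 0" and N: "N > 0" and L: "L > 0"
  shows "(\<Sum>h\<in>{h \<in> {0..<g * N}. g dvd h}. interval_weight (g * N) L h)
    \<le> (real_of_int L)\<^sup>2 + real_of_int L * real_of_int N"
proof -
  let ?I = "{0..<L} \<times> {0..<L}"
  let ?S = "\<Sum>h\<in>{h \<in> {0..<g * N}. g dvd h}. interval_weight (g * N) L h"
  have "complex_of_real ?S = (\<Sum>h\<in>{h \<in> {0..<g * N}. g dvd h}. \<Sum>z\<in>?I. unit_exp (g * N) (h * (fst z - snd z)))"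
    by (simp add: interval_weight_eq)
  also have "\<dots> = (\<Sum>h\<in>{0..<N}. \<Sum>z\<in>?I. unit_exp (g * N) (g * h * (fst z - snd z)))"
    by (rule sum.reindex_bij_witness[of _ "\<lambda>h. g * h" "\<lambda>h. h div g"])
       (use g in \<open>auto simp: pos_imp_zdiv_nonneg_iff elim!: dvdE\<close>)
  also have "\<dots> = (\<Sum>h\<in>{0..<N}. \<Sum>z\<in>?I. unit_exp N (h * (fst z - snd z)))"
    using g by (intro sum.cong refl) (simp add: unit_exp_def mult_ac)
  also have "\<dots> = (\<Sum>z\<in>?I. \<Sum>h\<in>{0..<N}. unit_exp N (h * (fst z - snd z)))" by (rule sum.swap)
  also have "\<dots> = (\<Sum>z\<in>?I. if N dvd fst z - snd z then of_int N else 0)"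
    unfolding sum_unit_exp[OF N] ..
  also have "\<dots> = (\<Sum>i\<in>{0..<L}. \<Sum>j\<in>{0..<L}. if N dvd i - j then of_int N else 0)"
    using sum.cartesian_product[of "\<lambda>i j. if N dvd i - j then of_int N else (0::complex)" "{0..<L}" "{0..<L}"]
    by (simp add: split_def)
  also have "\<dots> = (\<Sum>i\<in>{0..<L}. \<Sum>j\<in>{j \<in> {0..<L}. N dvd i - j}. of_int N)"
    by (intro sum.cong refl sum.inter_filter[symmetric]) simp
  also have "\<dots> = complex_of_real (\<Sum>i\<in>{0..<L}. real_of_int N * real (card {j \<in> {0..<L}. N dvd i - j}))"
    by (simp add: mult.commute)
  finally have "?S = (\<Sum>i\<in>{0..<L}. real_of_int N * real (card {j \<in> {0..<L}. N dvd i - j}))"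
    by (simp only: of_real_eq_iff)
  also have "\<dots> \<le> (\<Sum>i\<in>{0..<L}. real_of_int N * (real_of_int L / real_of_int N + 1))"
    using N L by (intro sum_mono mult_left_mono card_residue_class_le) auto
  also have "\<dots> = (real_of_int L)\<^sup>2 + real_of_int L * real_of_int N"
    using N L by (simp add: power2_eq_square field_simps)
  finally show ?thesis .
qed

text \<open>The root of the gcd is at most the sum of sqrt g over the common divisors g. For fixed g
  and q = g N the sum over pairs is a square, bounded by (L^2 + L N)^2. Removing the origin takes
  away L^4 and leaves at most 3 L^2 N q, and N sqrt g = q / sqrt g makes the sum over g
  cheap.\<close>

lemma weighted_gcd_sum_le:
  fixes q :: nat and L :: int
  assumes q: "q > 0" and L: "0 < L" "L \<le> int q"
  shows "(\<Sum>z\<in>{0..<int q} \<times> {0..<int q} - {(0, 0)}.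
      interval_weight (int q) L (fst z) * interval_weight (int q) L (snd z) * sqrt (real_of_int (gcd (gcd (fst z) (snd z)) (int q))))
    \<le> 3 * (real_of_int L)\<^sup>2 * (real q)\<^sup>2 * 4 ^ omega q"
proof -
  let ?W = "interval_weight (int q) L"
  let ?Z = "{0..<int q} \<times> {0..<int q} - {(0::int, 0::int)}"
  let ?D = "{g. g dvd q}"
  let ?G = "\<lambda>z::int\<times>int. gcd (gcd (fst z) (snd z)) (int q)"
  let ?P = "\<lambda>g z. int g dvd fst z \<and> int g dvd snd (z::int\<times>int)"
  have finD: "finite ?D" using q by auto
  have sqrt_le: "sqrt (real_of_int (?G z)) \<le> (\<Sum>g\<in>?D. if ?P g z then sqrt (real g) else 0)" for z
  proof -
    define g where "g = nat (?G z)"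
    have g: "int g = ?G z" by (simp add: g_def)
    have "int g dvd int q" unfolding g by simp
    hence gD: "g \<in> ?D" by simp
    have "?P g z" unfolding g by (meson dvd_trans gcd_dvd1 gcd_dvd2)
    hence "sqrt (real_of_int (?G z)) = (if ?P g z then sqrt (real g) else 0)" unfolding g[symmetric] by simp
    also have "\<dots> \<le> (\<Sum>g\<in>?D. if ?P g z then sqrt (real g) else 0)"
      using gD finD by (intro member_le_sum) auto
    finally show ?thesis .
  qed
  have part: "(\<Sum>z\<in>{z \<in> ?Z. ?P g z}. ?W (fst z) * ?W (snd z)) * sqrt (real g)
      \<le> 3 * (real_of_int L)\<^sup>2 * (real q)\<^sup>2 * (1 / sqrt (real g))" if "g \<in> ?D" for g
  proof -
    have "g dvd q" using that by simp
    then obtain N where N: "q = g * N" by (elim dvdE)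
    have pos: "g > 0" "N > 0" using q N by auto
    define A where "A = {h \<in> {0..<int q}. int g dvd h}"
    define a where "a = (\<Sum>h\<in>A. ?W h)"
    have finA: "finite A" unfolding A_def by (rule finite_subset[of _ "{0..<int q}"]) auto
    have a: "a \<le> (real_of_int L)\<^sup>2 + real_of_int L * real N"
      using sum_interval_weight_multiples_le[of "int g" "int N" L] pos L by (simp add: a_def A_def N)
    have a0: "a \<ge> 0" unfolding a_def by (intro sum_nonneg interval_weight_nonneg)
    have "{z \<in> ?Z. ?P g z} = A \<times> A - {(0, 0)}" by (auto simp: A_def)
    hence "(\<Sum>z\<in>{z \<in> ?Z. ?P g z}. ?W (fst z) * ?W (snd z)) = (\<Sum>z\<in>A \<times> A. ?W (fst z) * ?W (snd z)) - ?W 0 * ?W 0"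
      using finA q by (simp add: sum_diff1 A_def)
    also have "(\<Sum>z\<in>A \<times> A. ?W (fst z) * ?W (snd z)) = a * a"
      unfolding a_def sum_product using sum.cartesian_product[of "\<lambda>h k. ?W h * ?W k" A A] by (simp add: split_def)
    also have "?W 0 * ?W 0 = (real_of_int L)\<^sup>2 * (real_of_int L)\<^sup>2" using L by (simp add: interval_weight_0)
    also have "a * a \<le> ((real_of_int L)\<^sup>2 + real_of_int L * real N) * ((real_of_int L)\<^sup>2 + real_of_int L * real N)"
      using a a0 by (intro mult_mono) auto
    also have "\<dots> - (real_of_int L)\<^sup>2 * (real_of_int L)\<^sup>2
        = (real_of_int L)\<^sup>2 * real N * (2 * real_of_int L + real N)"
      by (simp add: power2_eq_square algebra_simps)
    also have "\<dots> \<le> (real_of_int L)\<^sup>2 * real N * (2 * real q + real q)"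
    proof (intro mult_left_mono add_mono)
      have "N \<le> q" using N pos by simp
      thus "real N \<le> real q" by simp
      have "real_of_int L \<le> real_of_int (int q)" using L(2) by (simp only: of_int_le_iff)
      thus "real_of_int L \<le> real q" by simp
    qed auto
    finally have "(\<Sum>z\<in>{z \<in> ?Z. ?P g z}. ?W (fst z) * ?W (snd z)) * sqrt (real g)
       \<le> (real_of_int L)\<^sup>2 * real N * (2 * real q + real q) * sqrt (real g)"
      by (intro mult_right_mono) auto
    also have "\<dots> = 3 * (real_of_int L)\<^sup>2 * real q * (real N * sqrt (real g))" by (simp add: algebra_simps)
    also have "real N * sqrt (real g) = real q * (1 / sqrt (real g))"
    proof -
      have "sqrt (real g) * sqrt (real g) = real g" by simp
      thus ?thesis using pos by (simp add: N field_simps)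
    qed
    finally show ?thesis by (simp add: power2_eq_square mult_ac)
  qed
  have "(\<Sum>z\<in>?Z. ?W (fst z) * ?W (snd z) * sqrt (real_of_int (?G z)))
      \<le> (\<Sum>z\<in>?Z. ?W (fst z) * ?W (snd z) * (\<Sum>g\<in>?D. if ?P g z then sqrt (real g) else 0))"
    by (intro sum_mono mult_left_mono sqrt_le mult_nonneg_nonneg interval_weight_nonneg)
  also have "\<dots> = (\<Sum>z\<in>?Z. \<Sum>g\<in>?D. if ?P g z then ?W (fst z) * ?W (snd z) * sqrt (real g) else 0)"
    unfolding sum_distrib_left by (intro sum.cong refl) simp
  also have "\<dots> = (\<Sum>g\<in>?D. \<Sum>z\<in>?Z. if ?P g z then ?W (fst z) * ?W (snd z) * sqrt (real g) else 0)"
    by (rule sum.swap)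
  also have "\<dots> = (\<Sum>g\<in>?D. (\<Sum>z\<in>{z \<in> ?Z. ?P g z}. ?W (fst z) * ?W (snd z)) * sqrt (real g))"
    unfolding sum_distrib_right by (intro sum.cong refl sum.inter_filter[symmetric]) simp
  also have "\<dots> \<le> (\<Sum>g\<in>?D. 3 * (real_of_int L)\<^sup>2 * (real q)\<^sup>2 * (1 / sqrt (real g)))"
    by (intro sum_mono part)
  also have "\<dots> = 3 * (real_of_int L)\<^sup>2 * (real q)\<^sup>2 * (\<Sum>g\<in>?D. 1 / sqrt (real g))"
    by (simp only: sum_distrib_left)
  also have "\<dots> \<le> 3 * (real_of_int L)\<^sup>2 * (real q)\<^sup>2 * 4 ^ omega q"
    by (intro mult_left_mono sum_inverse_sqrt_divisors_le q) auto
  finally show ?thesis .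
qed

text \<open>T counts the pairs (x, 1/x) near (a, b) with nonnegative weights, so T \<noteq> 0 yields
  a point. In its Fourier expansion the zero frequency gives L^4 \<phi>(q) and the others are
  Kloosterman sums; the hypothesis \<open>big\<close> says that the former wins, after cancelling
  L^2.\<close>

lemma inverse_pair_in_box:
  fixes q :: nat and L a b :: int
  assumes q: "q > 1" and L: "0 < L" "L \<le> int q"
    and big: "3 * 8 ^ omega q * 4 ^ omega q * (real q)\<^sup>2 * sqrt (real q) < (real_of_int L)\<^sup>2 * real (totient q)"
  shows "\<exists>x\<in>units_mod (int q). \<exists>u v. \<bar>u\<bar> < L \<and> \<bar>v\<bar> < L \<and>
    [x = a + u] (mod int q) \<and> [(modular_inverse (int q) x) = b + v] (mod int q)"
proof -
  define n where "n = int q"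
  have n0: "n > 0" using q by (simp add: n_def)
  let ?W = "interval_weight n L"
  let ?r = "difference_count n L"
  let ?U = "units_mod n"
  define T where "T = (\<Sum>x\<in>?U. real (?r (x - a)) * real (?r (modular_inverse n x - b)))"
  let ?F = "\<lambda>x h k. complex_of_real (?W h * ?W k) * unit_exp n (h * a + k * b)
      * unit_exp n (- h * x + - k * modular_inverse n x)"
  let ?t = "\<lambda>h k. complex_of_real (?W h * ?W k) * unit_exp n (h * a + k * b) * kloosterman n (- h) (- k)"
  have "of_int n * of_int n * complex_of_real T
      = (\<Sum>x\<in>?U. (of_int n * of_nat (?r (x - a))) * (of_int n * of_nat (?r (modular_inverse n x - b))))"
    by (simp add: T_def sum_distrib_left mult_ac)
  also have "\<dots> = (\<Sum>x\<in>?U. \<Sum>h\<in>{0..<n}. \<Sum>k\<in>{0..<n}. ?F x h k)"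
    unfolding difference_count_fourier[OF n0, symmetric] sum_product
  proof (intro sum.cong refl)
    fix x h k
    have "unit_exp n (- (h * (x - a))) * unit_exp n (- (k * (modular_inverse n x - b)))
        = unit_exp n (h * a + k * b) * unit_exp n (- h * x + - k * modular_inverse n x)"
      unfolding unit_exp_add[symmetric] by (simp add: algebra_simps)
    thus "complex_of_real (?W h) * unit_exp n (- (h * (x - a))) *
        (complex_of_real (?W k) * unit_exp n (- (k * (modular_inverse n x - b))))
      = ?F x h k"
      by (simp add: mult_ac)
  qed
  also have "\<dots> = (\<Sum>h\<in>{0..<n}. \<Sum>x\<in>?U. \<Sum>k\<in>{0..<n}. ?F x h k)"
    by (rule sum.swap)
  also have "\<dots> = (\<Sum>h\<in>{0..<n}. \<Sum>k\<in>{0..<n}. \<Sum>x\<in>?U. ?F x h k)"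
    by (intro sum.cong refl sum.swap)
  also have "\<dots> = (\<Sum>h\<in>{0..<n}. \<Sum>k\<in>{0..<n}. ?t h k)"
    by (simp only: kloosterman_def sum_distrib_left)
  also have "\<dots> = (\<Sum>z\<in>{0..<n} \<times> {0..<n}. ?t (fst z) (snd z))"
    using sum.cartesian_product[of ?t "{0..<n}" "{0..<n}"] by (simp add: split_def)
  also have "\<dots> = ?t 0 0 + (\<Sum>z\<in>{0..<n} \<times> {0..<n} - {(0, 0)}. ?t (fst z) (snd z))"
    using n0 by (subst sum.remove[of _ "(0, 0)"]) auto
  finally have eq: "of_int n * of_int n * complex_of_real T
      = ?t 0 0 + (\<Sum>z\<in>{0..<n} \<times> {0..<n} - {(0, 0)}. ?t (fst z) (snd z))" .
  have main: "?t 0 0 = complex_of_real ((real_of_int L)\<^sup>2 * (real_of_int L)\<^sup>2 * real (totient q))"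
    using L card_units_mod[OF q] by (simp add: interval_weight_0 kloosterman_def n_def)
  have err: "cmod (\<Sum>z\<in>{0..<n} \<times> {0..<n} - {(0, 0)}. ?t (fst z) (snd z))
      \<le> 8 ^ omega q * sqrt (real q) * (3 * (real_of_int L)\<^sup>2 * (real q)\<^sup>2 * 4 ^ omega q)"
  proof -
    let ?Z = "{0..<n} \<times> {0..<n} - {(0, 0)}"
    let ?c = "8 ^ omega q * sqrt (real q)" and ?g = "\<lambda>z. sqrt (real_of_int (gcd (gcd (fst z) (snd z)) n))"
    have "cmod (\<Sum>z\<in>?Z. ?t (fst z) (snd z))
       \<le> (\<Sum>z\<in>?Z. ?W (fst z) * ?W (snd z) * (?c * ?g z))"
    proof (rule sum_norm_le)
      fix z :: "int \<times> int"
      have "cmod (kloosterman n (- fst z) (- snd z)) \<le> 8 ^ omega q * sqrt (real q) * ?g z"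
      proof -
        have "gcd (gcd (- fst z) (- snd z)) n = gcd (gcd (fst z) (snd z)) n" by simp
        moreover have "kloosterman_bound n (8 ^ omega q)"
          unfolding n_def using q by (intro kloosterman_bound_general) simp
        hence "cmod (kloosterman n (- fst z) (- snd z))
            \<le> 8 ^ omega q * sqrt (real_of_int n) * sqrt (real_of_int (gcd (gcd (- fst z) (- snd z)) n))"
          unfolding kloosterman_bound_def by blast
        ultimately show ?thesis by (simp add: n_def)
      qed
      thus "cmod (?t (fst z) (snd z)) \<le> ?W (fst z) * ?W (snd z) * (?c * ?g z)"
        by (simp add: norm_mult interval_weight_nonneg abs_of_nonneg mult_left_mono)
    qed
    also have "\<dots> = 8 ^ omega q * sqrt (real q) * (\<Sum>z\<in>?Z. ?W (fst z) * ?W (snd z) * ?g z)"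
      unfolding sum_distrib_left by (intro sum.cong refl) (simp only: mult_ac)
    also have "\<dots> \<le> 8 ^ omega q * sqrt (real q) * (3 * (real_of_int L)\<^sup>2 * (real q)\<^sup>2 * 4 ^ omega q)"
      unfolding n_def using q by (intro mult_left_mono weighted_gcd_sum_le L) auto
    finally show ?thesis .
  qed
  have "T \<noteq> 0"
  proof
    assume "T = 0"
    hence "?t 0 0 + (\<Sum>z\<in>{0..<n} \<times> {0..<n} - {(0, 0)}. ?t (fst z) (snd z)) = 0"
      unfolding eq[symmetric] by (simp only: of_real_0 mult_zero_right)
    hence "(\<Sum>z\<in>{0..<n} \<times> {0..<n} - {(0, 0)}. ?t (fst z) (snd z)) = - ?t 0 0"
      by (simp only: add_eq_0_iff)
    hence "cmod (?t 0 0) \<le> 8 ^ omega q * sqrt (real q) * (3 * (real_of_int L)\<^sup>2 * (real q)\<^sup>2 * 4 ^ omega q)"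
      using err by (simp only: norm_minus_cancel)
    hence "(real_of_int L)\<^sup>2 * ((real_of_int L)\<^sup>2 * real (totient q))
        \<le> (real_of_int L)\<^sup>2 * (3 * 8 ^ omega q * 4 ^ omega q * (real q)\<^sup>2 * sqrt (real q))"
      unfolding main by (simp only: norm_of_real) (simp add: mult_ac abs_mult)
    hence "(real_of_int L)\<^sup>2 * real (totient q) \<le> 3 * 8 ^ omega q * 4 ^ omega q * (real q)\<^sup>2 * sqrt (real q)"
      using L by (subst (asm) mult_le_cancel_left_pos) auto
    thus False using big by simp
  qed
  have "\<exists>x\<in>?U. ?r (x - a) \<noteq> 0 \<and> ?r (modular_inverse n x - b) \<noteq> 0"
  proof (rule ccontr)
    assume "\<not> ?thesis"
    hence "T = 0" unfolding T_def by (intro sum.neutral) auto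
    thus False using \<open>T \<noteq> 0\<close> by simp
  qed
  then obtain x where x: "x \<in> ?U" "?r (x - a) \<noteq> 0" "?r (modular_inverse n x - b) \<noteq> 0" by blast
  have ex: "\<exists>u. \<bar>u\<bar> < L \<and> [y = c + u] (mod n)" if "?r (y - c) \<noteq> 0" for y c
  proof -
    have "{z \<in> {0..<L} \<times> {0..<L}. n dvd fst z - snd z - (y - c)} \<noteq> {}"
    proof
      assume e: "{z \<in> {0..<L} \<times> {0..<L}. n dvd fst z - snd z - (y - c)} = {}"
      have "?r (y - c) = 0" unfolding difference_count_def e by simp
      thus False using that by simp
    qed
    then obtain i j where ij: "i \<in> {0..<L}" "j \<in> {0..<L}" "n dvd i - j - (y - c)" by auto
    have "n dvd - (i - j - (y - c))" using ij(3) by (simp only: dvd_minus_iff)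
    also have "- (i - j - (y - c)) = y - (c + (i - j))" by simp
    finally have "[y = c + (i - j)] (mod n)" by (simp add: cong_iff_dvd_diff)
    thus ?thesis using ij by (intro exI[of _ "i - j"]) auto
  qed
  from ex[OF x(2)] ex[OF x(3)] x(1) show ?thesis unfolding n_def by blast
qed

section \<open>The covering exponent\<close>

lemma dist_to_torus_le:
  fixes k l :: int
  assumes "\<bar>fst z - fst w - of_int k\<bar> \<le> r" "\<bar>snd z - snd w - of_int l\<bar> \<le> r"
  shows "dist (to_torus z) (to_torus w) \<le> 2 * r"
proof -
  have "dist (to_torus z) (to_torus w) \<le> dist (z - w) (of_int k, of_int l)"
    unfolding dist_to_torus by (rule infdist_le) auto
  also have "\<dots> = sqrt ((fst z - fst w - of_int k)\<^sup>2 + (snd z - snd w - of_int l)\<^sup>2)"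
    by (simp add: dist_prod_def dist_real_def)
  also have "\<dots> \<le> \<bar>fst z - fst w - of_int k\<bar> + \<bar>snd z - snd w - of_int l\<bar>"
    by (rule sqrt_sum_squares_le_sum_abs)
  finally show ?thesis using assms by linarith
qed

lemma covering_radius_inverse_points_le:
  fixes q :: nat and L :: int
  assumes q: "q > 1" and L: "0 < L" "L \<le> int q"
    and big: "3 * 8 ^ omega q * 4 ^ omega q * (real q)\<^sup>2 * sqrt (real q) < (real_of_int L)\<^sup>2 * real (totient q)"
  shows "covering_radius (inverse_points q) \<le> 2 * (real_of_int L / real q)"
proof (rule covering_radius_is_least(3))
  show "finite (inverse_points q)" by (simp add: inverse_points_def)
  show "inverse_points q \<noteq> {}" using q by (simp add: inverse_points_def)
  show "2 * (real_of_int L / real q) > 0" using q L by simp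
  show "\<forall>t. \<exists>p\<in>inverse_points q. dist t p \<le> 2 * (real_of_int L / real q)"
  proof
    fix t :: torus
    obtain z where z: "t = to_torus z" using surj_to_torus by (metis UNIV_I imageE)
    define a b where "a = \<lfloor>real q * fst z\<rfloor>" and "b = \<lfloor>real q * snd z\<rfloor>"
    obtain x u v where x: "x \<in> units_mod (int q)" and uv: "\<bar>u\<bar> < L" "\<bar>v\<bar> < L"
      and xa: "[x = a + u] (mod int q)" and yb: "[(modular_inverse (int q) x) = b + v] (mod int q)"
      using inverse_pair_in_box[OF q L big, of a b] by blast
    define d where "d = nat x"
    have d: "int d = x" using x by (simp add: d_def units_mod_def)
    have "x \<noteq> 0" using x q by (auto simp: units_mod_def)
    hence dt: "d \<in> totatives q" using x unfolding d[symmetric] by (auto simp: units_mod_def in_totatives_iff)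
    have near: "\<exists>k::int. \<bar>y - real_of_int c / real q - of_int k\<bar> \<le> real_of_int L / real q"
      if c: "[c = \<lfloor>real q * y\<rfloor> + w] (mod int q)" and w: "\<bar>w\<bar> < L" for y c w
    proof -
      obtain k where "\<lfloor>real q * y\<rfloor> + w - c = int q * k"
        using cong_sym[OF c] unfolding cong_iff_dvd_diff by (elim dvdE)
      hence k: "real_of_int c = real_of_int \<lfloor>real q * y\<rfloor> + real_of_int w - real q * real_of_int k"
        by (metis (no_types, opaque_lifting) add_diff_cancel_left' diff_add_cancel of_int_add of_int_diff of_int_mult of_int_of_nat_eq)
      have f: "0 \<le> real q * y - real_of_int \<lfloor>real q * y\<rfloor>" "real q * y - real_of_int \<lfloor>real q * y\<rfloor> < 1" by linarith+
      have w': "\<bar>real_of_int w\<bar> \<le> real_of_int L - 1" using w by linarith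
      \<comment> \<open>Rounding down costs less than 1 and \<bar>w\<bar> is at most L - 1, so the
        total error is at most L.\<close>
      have "\<bar>real q * y - real_of_int c - real q * real_of_int k\<bar> \<le> real_of_int L"
        unfolding k using f w' by linarith
      moreover have "y - real_of_int c / real q - of_int k = (real q * y - real_of_int c - real q * real_of_int k) / real q"
        using q by (simp add: field_simps)
      ultimately show ?thesis using q by (intro exI[of _ k]) (simp add: divide_right_mono)
    qed
    let ?w = "(real d / real q, real_of_int (modular_inverse (int q) (int d)) / real q)"
    obtain k where k: "\<bar>fst z - fst ?w - of_int k\<bar> \<le> real_of_int L / real q"
      using near[OF xa[unfolded a_def] uv(1)] d by (metis fst_conv of_int_of_nat_eq)
    obtain l where l: "\<bar>snd z - snd ?w - of_int l\<bar> \<le> real_of_int L / real q"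
      using near[OF yb[unfolded b_def] uv(2)] d by auto
    have "dist t (to_torus ?w) \<le> 2 * (real_of_int L / real q)"
      unfolding z by (rule dist_to_torus_le[OF k l])
    moreover have "to_torus ?w \<in> inverse_points q" using dt by (auto simp: inverse_points_def)
    ultimately show "\<exists>p\<in>inverse_points q. dist t p \<le> 2 * (real_of_int L / real q)" by blast
  qed
qed

text \<open>With L of order q^(3/4 + \<epsilon>) the box criterion is met, since 8^\<omega>(q) is
  O(q^\<epsilon>); the radius is then of order L/q.\<close>

lemma covering_radius_power_bound:
  assumes \<epsilon>: "0 < \<epsilon>" "\<epsilon> < 1 / 4"
  obtains K where "K > 0"
    "\<forall>\<^sub>F q in sequentially. covering_radius (inverse_points q) \<le> K * real q powr (\<epsilon> - 1 / 4)"
proof -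
  obtain C where C: "C > 0" "\<And>q. q > 0 \<Longrightarrow> 8 ^ omega q \<le> C * real q powr \<epsilon>"
    using omega_power_le[of 8 \<epsilon>] \<epsilon> by auto
  define M where "M = 2 * C + 1"
  have "\<forall>\<^sub>F q in sequentially. M * real q powr (3 / 4 + \<epsilon>) \<le> real q"
    using \<epsilon> C by real_asymp
  hence "\<forall>\<^sub>F q in sequentially. covering_radius (inverse_points q) \<le> (2 * M) * real q powr (\<epsilon> - 1 / 4)"
    using eventually_gt_at_top[of "1::nat"]
  proof eventually_elim
    case (elim q)
    define r where "r = real q powr (3 / 4 + \<epsilon>)"
    \<comment> \<open>The factor 2 makes L^2 at least 4 A^2 q^(3/2), against a coefficient 3 in the
      error term. Rounding up is covered by M = 2C + 1, as r \<ge> 1.\<close>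
    define L where "L = \<lceil>2 * C * r\<rceil>"
    have q: "q > 1" "real q > 1" using elim by simp_all
    have r1: "r \<ge> 1" unfolding r_def using q \<epsilon> by (intro ge_one_powr_ge_zero) auto
    have Lr: "2 * C * r \<le> real_of_int L" "real_of_int L \<le> M * r"
      using r1 unfolding L_def M_def by (linarith, simp add: algebra_simps, linarith)
    have "0 < 2 * C * r" using C r1 by simp
    hence L0: "0 < L" using Lr(1) by linarith
    have "real_of_int L \<le> real q" using Lr(2) elim(1) by (simp add: r_def)
    hence Lq: "L \<le> int q" by linarith
    define A where "A = (8::real) ^ omega q"
    define B where "B = (2::real) ^ omega q"
    have AB: "A > 0" "B > 0" by (simp_all add: A_def B_def)
    have four: "(4::real) ^ omega q * B = A" unfolding A_def B_def power_mult_distrib[symmetric] by simp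
    have "A \<le> C * real q powr \<epsilon>" using C(2)[of q] q by (simp add: A_def)
    hence "2 * A * real q powr (3 / 4) \<le> 2 * (C * real q powr \<epsilon>) * real q powr (3 / 4)"
      by (intro mult_right_mono mult_left_mono) auto
    also have "\<dots> = 2 * C * r" by (simp add: r_def powr_add mult_ac)
    finally have LA: "2 * A * real q powr (3 / 4) \<le> real_of_int L" using Lr(1) by linarith
    have p34: "(real q powr (3 / 4))\<^sup>2 = real q * sqrt (real q)"
    proof -
      have "(real q powr (3 / 4))\<^sup>2 = real q powr (1 + 1 / 2)"
        by (simp add: power2_eq_square powr_add[symmetric])
      also have "\<dots> = real q * sqrt (real q)" using q by (simp only: powr_add) (simp add: powr_half_sqrt)
      finally show ?thesis .
    qed
    have "(2 * A * real q powr (3 / 4))\<^sup>2 \<le> (real_of_int L)\<^sup>2"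
      using LA AB by (intro power_mono) auto
    hence L2: "4 * A\<^sup>2 * (real q * sqrt (real q)) \<le> (real_of_int L)\<^sup>2"
      by (simp add: power_mult_distrib p34)
    have tot: "real q \<le> B * real (totient q)" using totient_ge[of q] q by (simp add: B_def)
    \<comment> \<open>Multiplying by B = 2^\<omega>(q) serves twice: it combines with 4^\<omega>(q)
      to a second A, and it turns the totient into an upper bound for q.\<close>
    have "B * (3 * A * 4 ^ omega q * (real q)\<^sup>2 * sqrt (real q)) = 3 * A\<^sup>2 * (real q * sqrt (real q)) * real q"
      by (simp add: four[symmetric] power2_eq_square mult_ac)
    also have "\<dots> < 4 * A\<^sup>2 * (real q * sqrt (real q)) * real q"
      using q AB by (intro mult_strict_right_mono) auto
    also have "\<dots> \<le> (real_of_int L)\<^sup>2 * (B * real (totient q))"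
      using L2 tot by (intro mult_mono) auto
    also have "\<dots> = B * ((real_of_int L)\<^sup>2 * real (totient q))" by (simp only: mult_ac)
    finally have "3 * A * 4 ^ omega q * (real q)\<^sup>2 * sqrt (real q) < (real_of_int L)\<^sup>2 * real (totient q)"
      using AB(2) by (simp only: mult_less_cancel_left_pos)
    from covering_radius_inverse_points_le[OF q(1) L0 Lq this[unfolded A_def]]
    have "covering_radius (inverse_points q) \<le> 2 * (real_of_int L / real q)" .
    also have "\<dots> \<le> 2 * (M * r / real q)" using Lr(2) q by (intro mult_left_mono divide_right_mono) auto
    also have "\<dots> = (2 * M) * real q powr (\<epsilon> - 1 / 4)"
    proof -
      have "r / real q = real q powr (3 / 4 + \<epsilon>) / real q powr 1" using q by (simp add: r_def)
      also have "\<dots> = real q powr (\<epsilon> - 1 / 4)" unfolding powr_diff[symmetric] by (simp add: algebra_simps)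
      finally have eq: "r / real q = real q powr (\<epsilon> - 1 / 4)" .
      have "2 * (M * r / real q) = 2 * M * (r / real q)" by simp
      thus ?thesis by (simp only: eq)
    qed
    finally show ?case .
  qed
  thus thesis using that[of "2 * M"] C by (simp add: M_def)
qed

lemma eventually_ratio_ge:
  assumes \<delta>: "\<delta> > 0"
  shows "\<forall>\<^sub>F q in sequentially.
    - (2 + \<delta>) \<le> ln (real (totient q)) / ln (ball_vol (covering_radius (inverse_points q)))"
proof -
  \<comment> \<open>Chosen so that (2 + \<delta>)(1/2 - 2\<epsilon>) = 1 + \<delta>/4; the surplus
    \<delta>/4 times ln q eventually absorbs the constants.\<close>
  define \<epsilon> where "\<epsilon> = \<delta> / (8 * (2 + \<delta>))"
  have \<epsilon>: "0 < \<epsilon>" "\<epsilon> < 1 / 4" using \<delta> by (auto simp: \<epsilon>_def field_simps)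
  have exponent: "(2 + \<delta>) * (1 / 2 - 2 * \<epsilon>) = 1 + \<delta> / 4"
  proof -
    have "(2 + \<delta>) * \<epsilon> = \<delta> / 8" using \<delta> by (simp add: \<epsilon>_def field_simps)
    thus ?thesis by (simp add: algebra_simps)
  qed
  obtain K where K: "K > 0"
    "\<forall>\<^sub>F q in sequentially. covering_radius (inverse_points q) \<le> K * real q powr (\<epsilon> - 1 / 4)"
    using covering_radius_power_bound[OF \<epsilon>] by blast
  define c where "c = ln (pi * K\<^sup>2)"
  have "\<forall>\<^sub>F q in sequentially. K * real q powr (\<epsilon> - 1 / 4) < 1 / 2"
    using \<epsilon> K(1) by real_asymp
  moreover have "\<forall>\<^sub>F q in sequentially. (2 + \<delta>) * c + 1 < \<delta> / 4 * ln (real q)"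
    using \<delta> by real_asymp
  ultimately show ?thesis
    using K(2) eventually_gt_at_top[of "1::nat"]
  proof eventually_elim
    case (elim q)
    define R where "R = covering_radius (inverse_points q)"
    define V where "V = ball_vol R"
    have q: "real q > 1" using elim by simp
    have R0: "R > 0" unfolding R_def
      by (rule covering_radius_is_least(1)) (use elim in \<open>auto simp: inverse_points_def\<close>)
    have RK: "R \<le> K * real q powr (\<epsilon> - 1 / 4)" using elim by (simp add: R_def)
    have V: "V = pi * R\<^sup>2" unfolding V_def using R0 RK elim by (intro ball_vol_eq) auto
    have V0: "V > 0" using V R0 by simp
    have "V \<le> pi * (K * real q powr (\<epsilon> - 1 / 4))\<^sup>2"
      unfolding V using RK R0 by (intro mult_left_mono power_mono) auto
    also have "\<dots> = pi * K\<^sup>2 * real q powr (2 * (\<epsilon> - 1 / 4))"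
      by (simp add: power_mult_distrib power2_eq_square[of "real q powr _"] powr_add[symmetric])
    finally have "ln V \<le> ln (pi * K\<^sup>2 * real q powr (2 * (\<epsilon> - 1 / 4)))"
      using V0 by simp
    also have "\<dots> = c + 2 * (\<epsilon> - 1 / 4) * ln (real q)"
      using K(1) q by (simp add: ln_mult c_def)
    finally have lnV: "(1 / 2 - 2 * \<epsilon>) * ln (real q) - c \<le> - ln V" by (simp add: algebra_simps)
    have lnq: "ln (real q) > 0" using q by simp
    have "ln (real q) + 1 < (1 + \<delta> / 4) * ln (real q) - (2 + \<delta>) * c" using elim by (simp add: algebra_simps)
    also have "\<dots> = (2 + \<delta>) * ((1 / 2 - 2 * \<epsilon>) * ln (real q) - c)"
      unfolding exponent[symmetric] by (simp add: algebra_simps)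
    also have "\<dots> \<le> (2 + \<delta>) * (- ln V)" using lnV \<delta> by (intro mult_left_mono) auto
    finally have main: "ln (real q) + 1 < (2 + \<delta>) * (- ln V)" .
    hence "0 < (2 + \<delta>) * (- ln V)" using lnq by linarith
    \<comment> \<open>The volume is below 1, so dividing by its logarithm reverses the inequality.
      On the totient side \<phi>(q) \<le> q is enough.\<close>
    hence negV: "ln V < 0" using \<delta> by (simp add: zero_less_mult_iff mult_less_0_iff)
    have "totient q > 0" "totient q \<le> q" using elim by (auto simp: totient_le)
    hence "ln (real (totient q)) \<le> ln (real q)" by simp
    hence "ln (real (totient q)) \<le> - (2 + \<delta>) * ln V" using main by linarith
    thus "- (2 + \<delta>) \<le> ln (real (totient q)) / ln (ball_vol (covering_radius (inverse_points q)))"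
      using negV unfolding V_def R_def by (simp add: neg_le_divide_eq)
  qed
qed

theorem theorem1p3:
  shows "covering_exponent inverse_points \<le> 2 \<and>
    - liminf (\<lambda>q. ereal (ln (real (totient q)) / ln (ball_vol (covering_radius (inverse_points q))))) \<le> 2"
proof -
  let ?f = "\<lambda>q. ereal (ln (real (totient q)) / ln (ball_vol (covering_radius (inverse_points q))))"
  have "- liminf ?f \<le> 2"
  proof (rule ereal_le_epsilon2)
    fix e :: real assume "0 < e"
    have "ereal (- (2 + e)) \<le> liminf ?f"
      by (rule Liminf_bounded) (use eventually_ratio_ge[OF \<open>0 < e\<close>] in \<open>simp add: eventually_mono\<close>)
    hence "- liminf ?f \<le> - ereal (- (2 + e))" by (simp only: ereal_minus_le_minus)
    thus "- liminf ?f \<le> 2 + ereal e" by (simp add: add.commute)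
  qed
  thus ?thesis by (simp add: covering_exponent_def card_inverse_points)
qed

end
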